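(* Let $\Omega\subset\mathbb R^N$ be a bounded domain which is convex or of class $C^2$, $\nu,\kappa>0$, $T_1>0$ arbitrary, $J=[0,T_1]$. Given $\tilde F\in C(J;L^2(\Omega))$ and $G=(u_0,v_0)\in\mathcal H=H^1_0(\Omega)\times L^2(\Omega)$, the pair $V=(u,u_t)$ given by $$V(t)=T(t)G+\int_0^tT(t-s)(0,\tilde F(s))\,ds,\qquad t\in J,$$ is the unique weak solution on $J$ of the linear inhomogeneous problem $$u_{tt}=-\nu u_t+\kappa\nabla^2u+\tilde F,\quad u=0\text{ on }\partial\Omega,\quad (u,u_t)|_{t=0}=(u_0,v_0).$$
   Context: $H^1_0(\Omega)$ carries the inner product $(u,w)_{H^1_0}=\kappa(\nabla u,\nabla w)_{L^2}$. $T(t)$, $t\ge0$, is the strongly continuous contraction semigroup on $\mathcal H$ generated by $U(u,v)=(v,\kappa\nabla^2u-\nu v)$ with domain $D(U)=(H^2(\Omega)\cap H^1_0(\Omega))\times H^1_0(\Omega)$. Weak solution of the linear inhomogeneous problem: a function $u$ such that (i) $(u,u_t)$ is continuous from $J$ to $\mathcal H$, with $u_{tt}$ continuous from $J$ to $H^{-1}(\Omega)$; (ii) $(u(0),u_t(0))=(u_0,v_0)$ in $\Omega$; (iii) for all $\phi\in C(J;H^1_0(\Omega))$ and all $0<t\le T_1$, $$(u_{tt},\phi)_{L^2}=-\nu(u_t,\phi)_{L^2}-\kappa(\nabla u,\nabla\phi)_{L^2}+(\tilde F,\phi)_{L^2},$$ where $(u_{tt},\phi)_{L^2}$ is understood as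 the $H^{-1}$–$H^1_0$ duality pairing. *)

theory Defs
  imports "HOL-Analysis.Analysis"
begin

section \<open>The Hilbert space of square-integrable functions\<close>

definition square_integrable :: "('a::euclidean_space \<Rightarrow> real) \<Rightarrow> bool" where
  "square_integrable f \<longleftrightarrow>
     f \<in> borel_measurable lborel \<and> integrable lborel (\<lambda>x. (f x)\<^sup>2)"

definition l2_eq :: "('a::euclidean_space \<Rightarrow> real) \<Rightarrow> ('a \<Rightarrow> real) \<Rightarrow> bool" where
  "l2_eq f g \<longleftrightarrow>
     square_integrable f \<and> square_integrable g \<and> (AE x in lborel. f x = g x)"

lemma square_integrable_zero: "square_integrable (\<lambda>x. 0)"
  by (simp add: square_integrable_def)

lemma square_integrable_mult:
  assumes "square_integrable f" "square_integrable g"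
  shows "integrable lborel (\<lambda>x. f x * g x)"
proof (rule Bochner_Integration.integrable_bound)
  show "integrable lborel (\<lambda>x. (f x)\<^sup>2 + (g x)\<^sup>2)"
    using assms by (simp add: square_integrable_def)
  show "(\<lambda>x. f x * g x) \<in> borel_measurable lborel"
    using assms unfolding square_integrable_def by (intro borel_measurable_times) auto
  have "\<bar>a * b\<bar> \<le> a\<^sup>2 + b\<^sup>2" for a b :: real
  proof -
    have "2 * (\<bar>a\<bar> * \<bar>b\<bar>) \<le> a\<^sup>2 + b\<^sup>2"
      using sum_squares_bound[of "\<bar>a\<bar>" "\<bar>b\<bar>"] by simp
    moreover have "0 \<le> \<bar>a\<bar> * \<bar>b\<bar>" by (rule mult_nonneg_nonneg) simp_all
    ultimately show ?thesis unfolding abs_mult by linarith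
  qed
  then show "AE x in lborel. norm (f x * g x) \<le> norm ((f x)\<^sup>2 + (g x)\<^sup>2)"
    by (simp add: abs_mult)
qed

lemma square_integrable_scale:
  "square_integrable f \<Longrightarrow> square_integrable (\<lambda>x. c * f x)"
  by (auto simp: square_integrable_def power_mult_distrib)

lemma square_integrable_add:
  assumes "square_integrable f" "square_integrable g"
  shows "square_integrable (\<lambda>x. f x + g x)"
proof -
  have "integrable lborel (\<lambda>x. (f x)\<^sup>2 + (g x)\<^sup>2 + 2 * (f x * g x))"
    using assms square_integrable_mult[OF assms] by (simp add: square_integrable_def)
  then have "integrable lborel (\<lambda>x. (f x + g x)\<^sup>2)"
    by (simp add: power2_sum mult.assoc)
  moreover have "(\<lambda>x. f x + g x) \<in> borel_measurable lborel"
    using assms unfolding square_integrable_def by (intro borel_measurable_add) auto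
  ultimately show ?thesis
    by (simp add: square_integrable_def)
qed

quotient_type (overloaded) 'a l2 = "'a::euclidean_space \<Rightarrow> real" / partial: l2_eq
  morphisms rep_l2 abs_l2
proof (rule part_equivpI)
  show "\<exists>f::'a \<Rightarrow> real. l2_eq f f"
    by (rule exI[of _ "\<lambda>x. 0"]) (simp add: l2_eq_def square_integrable_zero)
  show "symp (l2_eq :: ('a \<Rightarrow> real) \<Rightarrow> _)"
    by (rule sympI) (auto simp: l2_eq_def)
  show "transp (l2_eq :: ('a \<Rightarrow> real) \<Rightarrow> _)"
    by (rule transpI) (auto simp: l2_eq_def)
qed

instantiation l2 :: (euclidean_space) real_vector
begin

lift_definition zero_l2 :: "'a l2" is "\<lambda>x. 0"
  by (simp add: l2_eq_def square_integrable_zero)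

lift_definition plus_l2 :: "'a l2 \<Rightarrow> 'a l2 \<Rightarrow> 'a l2" is "\<lambda>f g x. f x + g x"
  by (auto simp: l2_eq_def intro: square_integrable_add)

lift_definition scaleR_l2 :: "real \<Rightarrow> 'a l2 \<Rightarrow> 'a l2" is "\<lambda>c f x. c * f x"
  by (auto simp: l2_eq_def intro: square_integrable_scale)

lift_definition uminus_l2 :: "'a l2 \<Rightarrow> 'a l2" is "\<lambda>f x. - f x"
  by (auto simp: l2_eq_def square_integrable_def)

definition minus_l2 :: "'a l2 \<Rightarrow> 'a l2 \<Rightarrow> 'a l2" where
  "minus_l2 f g = f + - g"

instance
proof
  fix a b c :: "'a l2" and r s :: real
  show "a + b + c = a + (b + c)"
    by transfer (auto simp: l2_eq_def add.assoc intro!: square_integrable_add)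
  show "a + b = b + a"
    by transfer (auto simp: l2_eq_def add.commute intro!: square_integrable_add)
  show "0 + a = a"
    by transfer (auto simp: l2_eq_def)
  show "- a + a = 0"
    by transfer (auto simp: l2_eq_def square_integrable_zero)
  show "a - b = a + - b"
    by (rule minus_l2_def)
  show "r *\<^sub>R (a + b) = r *\<^sub>R a + r *\<^sub>R b"
    by transfer (auto simp: l2_eq_def distrib_left
        intro!: square_integrable_add square_integrable_scale)
  show "(r + s) *\<^sub>R a = r *\<^sub>R a + s *\<^sub>R a"
    by transfer (auto simp: l2_eq_def distrib_right
        intro!: square_integrable_add square_integrable_scale)
  show "r *\<^sub>R s *\<^sub>R a = (r * s) *\<^sub>R a"
    by transfer (auto simp: l2_eq_def mult.assoc
        intro!: square_integrable_scale)
  show "1 *\<^sub>R a = a"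
    by transfer (auto simp: l2_eq_def)
qed

end

instantiation l2 :: (euclidean_space) real_inner
begin

lift_definition inner_l2 :: "'a l2 \<Rightarrow> 'a l2 \<Rightarrow> real" is "\<lambda>f g. LINT x|lborel. f x * g x"
proof -
  fix f f' g g' :: "'a \<Rightarrow> real"
  assume "l2_eq f f'" "l2_eq g g'"
  then show "(LINT x|lborel. f x * g x) = (LINT x|lborel. f' x * g' x)"
    by (intro integral_cong_AE) (auto simp: l2_eq_def square_integrable_def)
qed

definition norm_l2 :: "'a l2 \<Rightarrow> real" where "norm_l2 f = sqrt (inner f f)"
definition dist_l2 :: "'a l2 \<Rightarrow> 'a l2 \<Rightarrow> real" where "dist_l2 f g = norm (f - g)"
definition sgn_l2 :: "'a l2 \<Rightarrow> 'a l2" where "sgn_l2 f = f /\<^sub>R norm f"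
definition uniformity_l2 :: "('a l2 \<times> 'a l2) filter" where
  "uniformity_l2 = (INF e\<in>{0<..}. principal {(x, y). dist x y < e})"
definition open_l2 :: "'a l2 set \<Rightarrow> bool" where
  "open_l2 S \<longleftrightarrow> (\<forall>x\<in>S. \<forall>\<^sub>F (x', y) in uniformity. x' = x \<longrightarrow> y \<in> S)"

instance
proof
  fix a b c :: "'a l2" and r :: real
  show "dist a b = norm (a - b)" by (rule dist_l2_def)
  show "sgn a = a /\<^sub>R norm a" by (rule sgn_l2_def)
  show "(uniformity :: ('a l2 \<times> 'a l2) filter)
      = (INF e\<in>{0<..}. principal {(x, y). dist x y < e})"
    by (rule uniformity_l2_def)
  show "open S \<longleftrightarrow> (\<forall>x\<in>S. \<forall>\<^sub>F (x', y) in uniformity. x' = x \<longrightarrow> y \<in> S)" for S :: "'a l2 set"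
    by (rule open_l2_def)
  show "norm a = sqrt (inner a a)" by (rule norm_l2_def)
  show "inner a b = inner b a"
    by transfer (simp add: mult.commute)
  show "inner (a + b) c = inner a c + inner b c"
    by transfer (simp add: l2_eq_def distrib_right square_integrable_mult)
  show "inner (r *\<^sub>R a) b = r * inner a b"
    by transfer (simp add: mult.assoc)
  show "0 \<le> inner a a"
    by transfer simp
  show "inner a a = 0 \<longleftrightarrow> a = 0"
  proof transfer
    fix f :: "'a \<Rightarrow> real" assume f: "l2_eq f f"
    have "(LINT x|lborel. f x * f x) = 0 \<longleftrightarrow> (AE x in lborel. f x * f x = 0)"
      using f square_integrable_mult[of f f]
      by (intro integral_nonneg_eq_0_iff_AE) (auto simp: l2_eq_def)
    then show "(LINT x|lborel. f x * f x) = 0 \<longleftrightarrow> l2_eq f (\<lambda>x. 0)"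
      using f by (auto simp: l2_eq_def square_integrable_zero)
  qed
qed

end

text \<open>
  A subset \<open>\<Omega>\<close> cannot index a type, so \<open>L\<^sup>2(\<Omega>)\<close> is the closed subspace of those
  elements of \<open>L\<^sup>2(\<real>\<^sup>N)\<close> that vanish almost everywhere outside \<open>\<Omega>\<close>
  (extension by zero is an isometric isomorphism).
\<close>

definition L2_on :: "'a::euclidean_space set \<Rightarrow> 'a l2 set" where
  "L2_on \<Omega> = {f. AE x in lborel. x \<notin> \<Omega> \<longrightarrow> rep_l2 f x = 0}"


section \<open>Smooth functions, test functions and \<open>C\<^sup>2\<close> domains\<close>

definition partial_deriv :: "'n \<Rightarrow> (real^'n::finite \<Rightarrow> real) \<Rightarrow> real^'n \<Rightarrow> real" where
  "partial_deriv i f x = frechet_derivative f (at x) (axis i 1)"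

fun C_diff :: "nat \<Rightarrow> (real^'n::finite \<Rightarrow> real) \<Rightarrow> bool" where
  "C_diff 0 f \<longleftrightarrow> continuous_on UNIV f"
| "C_diff (Suc k) f \<longleftrightarrow>
     (\<forall>x. f differentiable (at x)) \<and> (\<forall>i. C_diff k (partial_deriv i f))"

definition test_function :: "(real^'n::finite) set \<Rightarrow> (real^'n \<Rightarrow> real) \<Rightarrow> bool" where
  "test_function \<Omega> \<phi> \<longleftrightarrow> (\<forall>k. C_diff k \<phi>) \<and>
     compact (closure {x. \<phi> x \<noteq> 0}) \<and> closure {x. \<phi> x \<noteq> 0} \<subseteq> \<Omega>"

text \<open>
  Near each boundary point, \<open>\<Omega>\<close> is the strict epigraph of a \<open>C\<^sup>2\<close> function of the other
  \<open>N - 1\<close> coordinates, after relabelling (choice of \<open>k\<close>) and reorienting (\<open>\<sigma>\<close>) the axes.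
  A function of \<open>N - 1\<close> variables is a function on \<open>\<real>\<^sup>N\<close> not depending on the \<open>k\<close>-th one.
\<close>

definition C2_domain :: "(real^'n::finite) set \<Rightarrow> bool" where
  "C2_domain \<Omega> \<longleftrightarrow> (\<forall>x0\<in>frontier \<Omega>. \<exists>r>0. \<exists>k. \<exists>\<sigma>\<in>{-1, 1}. \<exists>\<gamma>.
     C_diff 2 \<gamma> \<and> (\<forall>x y. (\<forall>j. j \<noteq> k \<longrightarrow> x $ j = y $ j) \<longrightarrow> \<gamma> x = \<gamma> y) \<and>
     \<Omega> \<inter> ball x0 r = {x \<in> ball x0 r. \<sigma> * x $ k > \<gamma> x})"


section \<open>Sobolev spaces\<close>

definition has_weak_partial ::
    "(real^'n::finite) set \<Rightarrow> 'n \<Rightarrow> (real^'n) l2 \<Rightarrow> (real^'n) l2 \<Rightarrow> bool" where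
  "has_weak_partial \<Omega> i u g \<longleftrightarrow> g \<in> L2_on \<Omega> \<and>
     (\<forall>\<phi>. test_function \<Omega> \<phi> \<longrightarrow>
        inner u (abs_l2 (partial_deriv i \<phi>)) = - inner g (abs_l2 \<phi>))"

definition weak_partial :: "(real^'n::finite) set \<Rightarrow> 'n \<Rightarrow> (real^'n) l2 \<Rightarrow> (real^'n) l2" where
  "weak_partial \<Omega> i u = (THE g. has_weak_partial \<Omega> i u g)"

definition grad :: "(real^'n::finite) set \<Rightarrow> (real^'n) l2 \<Rightarrow> (real^'n) l2 ^ 'n" where
  "grad \<Omega> u = (\<chi> i. weak_partial \<Omega> i u)"

definition laplacian :: "(real^'n::finite) set \<Rightarrow> (real^'n) l2 \<Rightarrow> (real^'n) l2" where
  "laplacian \<Omega> u = (\<Sum>i\<in>UNIV. weak_partial \<Omega> i (weak_partial \<Omega> i u))"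

definition H1 :: "(real^'n::finite) set \<Rightarrow> (real^'n) l2 set" where
  "H1 \<Omega> = {u \<in> L2_on \<Omega>. \<forall>i. \<exists>g. has_weak_partial \<Omega> i u g}"

definition H2 :: "(real^'n::finite) set \<Rightarrow> (real^'n) l2 set" where
  "H2 \<Omega> = {u \<in> H1 \<Omega>. \<forall>i. weak_partial \<Omega> i u \<in> H1 \<Omega>}"

text \<open>The closure of the test functions in the \<open>H\<^sup>1\<close> norm.\<close>

definition H10 :: "(real^'n::finite) set \<Rightarrow> (real^'n) l2 set" where
  "H10 \<Omega> = {u \<in> H1 \<Omega>. \<exists>\<phi> :: nat \<Rightarrow> real^'n \<Rightarrow> real. (\<forall>n. test_function \<Omega> (\<phi> n)) \<and>
     (\<lambda>n. abs_l2 (\<phi> n)) \<longlonglongrightarrow> u \<and>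
     (\<forall>i. (\<lambda>n. abs_l2 (partial_deriv i (\<phi> n))) \<longlonglongrightarrow> weak_partial \<Omega> i u)}"

definition H10_norm :: "real \<Rightarrow> (real^'n::finite) set \<Rightarrow> (real^'n) l2 \<Rightarrow> real" where
  "H10_norm \<kappa> \<Omega> u = sqrt (\<kappa> * inner (grad \<Omega> u) (grad \<Omega> u))"

text \<open>
  \<open>H\<^sup>-\<^sup>1(\<Omega>)\<close>, the dual of \<open>H10 \<Omega>\<close>; only the values of a functional on \<open>H10 \<Omega>\<close> matter, and
  application is the duality pairing. An \<open>L\<^sup>2\<close> function \<open>f\<close> is the functional \<open>inner f\<close>.
\<close>

definition Hm1 :: "real \<Rightarrow> (real^'n::finite) set \<Rightarrow> ((real^'n) l2 \<Rightarrow> real) set" where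
  "Hm1 \<kappa> \<Omega> = {l.
     (\<forall>v\<in>H10 \<Omega>. \<forall>w\<in>H10 \<Omega>. \<forall>a b. l (a *\<^sub>R v + b *\<^sub>R w) = a * l v + b * l w) \<and>
     (\<exists>C. \<forall>w\<in>H10 \<Omega>. \<bar>l w\<bar> \<le> C * H10_norm \<kappa> \<Omega> w)}"

definition Hm1_norm :: "real \<Rightarrow> (real^'n::finite) set \<Rightarrow> ((real^'n) l2 \<Rightarrow> real) \<Rightarrow> real" where
  "Hm1_norm \<kappa> \<Omega> l = (SUP w\<in>{w \<in> H10 \<Omega>. H10_norm \<kappa> \<Omega> w \<le> 1}. \<bar>l w\<bar>)"


section \<open>The energy space \<open>H10 \<Omega> \<times> L2_on \<Omega>\<close>\<close>

definition energy_space :: "(real^'n::finite) set \<Rightarrow> ((real^'n) l2 \<times> (real^'n) l2) set" where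
  "energy_space \<Omega> = H10 \<Omega> \<times> L2_on \<Omega>"

text \<open>
  The inner product of the energy space is not the one of the product type \<open>l2 \<times> l2\<close>. It is the
  pull-back of the inner product of \<open>l2 ^ 'n \<times> l2\<close> along \<open>(u, v) \<mapsto> (\<surd>\<kappa> \<nabla>u, v)\<close>, so that norms,
  limits, continuity and integrals in the energy space are those of the images under this
  isometric embedding.
\<close>

definition H10_emb :: "real \<Rightarrow> (real^'n::finite) set \<Rightarrow> (real^'n) l2 \<Rightarrow> (real^'n) l2 ^ 'n" where
  "H10_emb \<kappa> \<Omega> u = sqrt \<kappa> *\<^sub>R grad \<Omega> u"

definition energy_emb :: "real \<Rightarrow> (real^'n::finite) set \<Rightarrow>
    (real^'n) l2 \<times> (real^'n) l2 \<Rightarrow> ((real^'n) l2 ^ 'n) \<times> (real^'n) l2" where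
  "energy_emb \<kappa> \<Omega> x = (H10_emb \<kappa> \<Omega> (fst x), snd x)"

lemma norm_H10_emb: "norm (H10_emb \<kappa> \<Omega> u) = H10_norm \<kappa> \<Omega> u" if "\<kappa> > 0"
  using that
  by (simp add: H10_emb_def H10_norm_def real_sqrt_mult flip: norm_eq_sqrt_inner)

lemma inner_energy_emb:
  "inner (energy_emb \<kappa> \<Omega> (u, v)) (energy_emb \<kappa> \<Omega> (w, z))
     = \<kappa> * inner (grad \<Omega> u) (grad \<Omega> w) + inner v z" if "\<kappa> > 0"
  using that by (simp add: energy_emb_def H10_emb_def inner_prod_def flip: mult.assoc)

definition has_energy_integral :: "real \<Rightarrow> (real^'n::finite) set \<Rightarrow>
    (real \<Rightarrow> (real^'n) l2 \<times> (real^'n) l2) \<Rightarrow> (real^'n) l2 \<times> (real^'n) l2 \<Rightarrow> real set \<Rightarrow> bool" where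
  "has_energy_integral \<kappa> \<Omega> f y S \<longleftrightarrow>
     (\<forall>s\<in>S. f s \<in> energy_space \<Omega>) \<and> y \<in> energy_space \<Omega> \<and>
     ((\<lambda>s. energy_emb \<kappa> \<Omega> (f s)) has_integral energy_emb \<kappa> \<Omega> y) S"

definition energy_integral :: "real \<Rightarrow> (real^'n::finite) set \<Rightarrow> real set \<Rightarrow>
    (real \<Rightarrow> (real^'n) l2 \<times> (real^'n) l2) \<Rightarrow> (real^'n) l2 \<times> (real^'n) l2" where
  "energy_integral \<kappa> \<Omega> S f = (THE y. has_energy_integral \<kappa> \<Omega> f y S)"


section \<open>Semigroups on the energy space\<close>

definition contraction_semigroup :: "real \<Rightarrow> (real^'n::finite) set \<Rightarrow>
    (real \<Rightarrow> (real^'n) l2 \<times> (real^'n) l2 \<Rightarrow> (real^'n) l2 \<times> (real^'n) l2) \<Rightarrow> bool" where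
  "contraction_semigroup \<kappa> \<Omega> T \<longleftrightarrow>
     (\<forall>t\<ge>0. \<forall>x\<in>energy_space \<Omega>. T t x \<in> energy_space \<Omega>) \<and>
     (\<forall>t\<ge>0. \<forall>x\<in>energy_space \<Omega>. \<forall>y\<in>energy_space \<Omega>. \<forall>a b.
        T t (a *\<^sub>R x + b *\<^sub>R y) = a *\<^sub>R T t x + b *\<^sub>R T t y) \<and>
     (\<forall>x\<in>energy_space \<Omega>. T 0 x = x) \<and>
     (\<forall>s\<ge>0. \<forall>t\<ge>0. \<forall>x\<in>energy_space \<Omega>. T (s + t) x = T s (T t x)) \<and>
     (\<forall>t\<ge>0. \<forall>x\<in>energy_space \<Omega>.
        norm (energy_emb \<kappa> \<Omega> (T t x)) \<le> norm (energy_emb \<kappa> \<Omega> x)) \<and>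
     (\<forall>x\<in>energy_space \<Omega>. continuous_on {0..} (\<lambda>t. energy_emb \<kappa> \<Omega> (T t x)))"

text \<open>
  The infinitesimal generator of \<open>T\<close> is exactly the operator \<open>A\<close> with domain \<open>D\<close>: \<open>x\<close> lies in \<open>D\<close>
  if and only if the difference quotients converge in the energy space, and then the limit is \<open>A x\<close>.
\<close>

definition has_generator :: "real \<Rightarrow> (real^'n::finite) set \<Rightarrow>
    (real \<Rightarrow> (real^'n) l2 \<times> (real^'n) l2 \<Rightarrow> (real^'n) l2 \<times> (real^'n) l2) \<Rightarrow>
    ((real^'n) l2 \<times> (real^'n) l2) set \<Rightarrow>
    ((real^'n) l2 \<times> (real^'n) l2 \<Rightarrow> (real^'n) l2 \<times> (real^'n) l2) \<Rightarrow> bool" where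
  "has_generator \<kappa> \<Omega> T D A \<longleftrightarrow> D \<subseteq> energy_space \<Omega> \<and>
     (\<forall>x\<in>energy_space \<Omega>. \<forall>y\<in>energy_space \<Omega>.
        ((\<lambda>h. energy_emb \<kappa> \<Omega> ((1 / h) *\<^sub>R (T h x - x))) \<longlongrightarrow> energy_emb \<kappa> \<Omega> y) (at_right 0)
        \<longleftrightarrow> x \<in> D \<and> y = A x)"

definition wave_domain :: "(real^'n::finite) set \<Rightarrow> ((real^'n) l2 \<times> (real^'n) l2) set" where
  "wave_domain \<Omega> = (H2 \<Omega> \<inter> H10 \<Omega>) \<times> H10 \<Omega>"

definition wave_operator :: "real \<Rightarrow> real \<Rightarrow> (real^'n::finite) set \<Rightarrow>
    (real^'n) l2 \<times> (real^'n) l2 \<Rightarrow> (real^'n) l2 \<times> (real^'n) l2" where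
  "wave_operator \<kappa> \<nu> \<Omega> = (\<lambda>(u, v). (v, \<kappa> *\<^sub>R laplacian \<Omega> u - \<nu> *\<^sub>R v))"


section \<open>Weak solutions\<close>

text \<open>
  \<open>ut\<close> is the derivative of \<open>u\<close> in \<open>L\<^sup>2\<close> and \<open>utt\<close> the derivative of \<open>ut\<close> in \<open>H\<^sup>-\<^sup>1\<close>, one-sided at
  the end points of the time interval. The boundary condition is \<open>u t \<in> H10 \<Omega>\<close>, which is part
  of membership in the energy space.
\<close>

definition weak_solution :: "real \<Rightarrow> real \<Rightarrow> (real^'n::finite) set \<Rightarrow> real \<Rightarrow>
    (real \<Rightarrow> (real^'n) l2) \<Rightarrow> (real^'n) l2 \<Rightarrow> (real^'n) l2 \<Rightarrow> (real \<Rightarrow> (real^'n) l2) \<Rightarrow> bool" where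
  "weak_solution \<kappa> \<nu> \<Omega> T\<^sub>1 F u\<^sub>0 v\<^sub>0 u \<longleftrightarrow> (\<exists>ut utt.
     (\<forall>t\<in>{0..T\<^sub>1}. (u has_vector_derivative ut t) (at t within {0..T\<^sub>1})) \<and>
     (\<forall>t\<in>{0..T\<^sub>1}. (u t, ut t) \<in> energy_space \<Omega>) \<and>
     continuous_on {0..T\<^sub>1} (\<lambda>t. energy_emb \<kappa> \<Omega> (u t, ut t)) \<and>
     (\<forall>t\<in>{0..T\<^sub>1}. utt t \<in> Hm1 \<kappa> \<Omega>) \<and>
     (\<forall>t\<in>{0..T\<^sub>1}.
        ((\<lambda>s. Hm1_norm \<kappa> \<Omega> (\<lambda>w. inner ((1 / (s - t)) *\<^sub>R (ut s - ut t)) w - utt t w)) \<longlongrightarrow> 0)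
          (at t within {0..T\<^sub>1})) \<and>
     (\<forall>t\<in>{0..T\<^sub>1}.
        ((\<lambda>s. Hm1_norm \<kappa> \<Omega> (\<lambda>w. utt s w - utt t w)) \<longlongrightarrow> 0) (at t within {0..T\<^sub>1})) \<and>
     (u 0, ut 0) = (u\<^sub>0, v\<^sub>0) \<and>
     (\<forall>\<phi>. (\<forall>t\<in>{0..T\<^sub>1}. \<phi> t \<in> H10 \<Omega>) \<and> continuous_on {0..T\<^sub>1} (\<lambda>t. H10_emb \<kappa> \<Omega> (\<phi> t)) \<longrightarrow>
        (\<forall>t\<in>{0<..T\<^sub>1}.
           utt t (\<phi> t) = - \<nu> * inner (ut t) (\<phi> t)
             - \<kappa> * inner (grad \<Omega> (u t)) (grad \<Omega> (\<phi> t)) + inner (F t) (\<phi> t))))"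

end

theory Submission
  imports Defs
begin

text \<open>
  Existence. For a contraction semigroup with generator \<open>U\<close>, the orbit integral
  \<open>Y = \<integral>\<^bsub>0\<^esub>\<^bsup>h\<^esup> T(r) x dr\<close> lies in \<open>D(U)\<close> and \<open>T(h) x - x = U Y\<close>. Hence
  \<open>V(t) - V(t') = U Y + R\<close> for \<open>t' \<le> t\<close>, where \<open>Y = \<integral>\<^bsub>0\<^esub>\<^bsup>t - t'\<^esup> T(r) V(t') dr\<close> and
  \<open>R = \<integral>\<^bsub>t'\<^esub>\<^bsup>t\<^esup> T(t - s) (0, F(s)) ds\<close>. Since \<open>Y / (t - t')\<close> and \<open>R / (t - t')\<close> converge in the energy
  space to \<open>V\<close> and \<open>(0, F)\<close>, pairing the second component of \<open>U Y\<close> with \<open>H10\<close> functions and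
  integrating the Laplacian by parts gives the derivatives of \<open>u\<close> in \<open>L\<^sup>2\<close> and of \<open>u\<^sub>t\<close> in
  \<open>H\<^sup>-\<^sup>1\<close>, without the adjoint of \<open>U\<close> or an approximation by classical solutions.

  Uniqueness. The difference \<open>z\<close> of two weak solutions is too rough to be tested with \<open>z'\<close>; it is
  tested with \<open>\<integral>\<^bsub>t\<^esub>\<^bsup>\<tau>\<^esup> z(r) dr\<close> instead.
\<close>

section \<open>Completeness of \<open>L\<^sup>2\<close>\<close>

text \<open>Two obstacles shape the proof. The energy norm is not the norm of the product type, and
  \<open>V\<close> need not take values in the domain of \<open>U\<close>. The first is met by
  transporting everything along \<open>energy_emb\<close>, whose image is a closed subspace of a
  Banach space: integrals of continuous curves exist there by completeness, stay in the image and
  can be pulled back. The Poincare inequality carries this, through injectivity of the embedding,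
  closedness of its image and control of the L2 norm by the energy norm. The second is met by
  applying \<open>U\<close> only to time integrals of orbits. The resulting estimates allow any
  reference time between t' and t, which gives derivatives from both sides, and their error is
  proportional to the energy norm of the test element, which gives convergence in the norm of H^-1
  and not only weakly. In the uniqueness part, z'' is merely a functional on H10 while z' has values
  in L2 only; a primitive of z does have values in H10, and shifting one time derivative onto it
  makes every pairing meaningful.\<close>

lemma square_integrable_rep_l2: "square_integrable (rep_l2 f)"
  using Quotient3_l2[THEN Quotient3_rep_reflp, of f] by (simp add: l2_eq_def)

lemma abs_rep_l2: "abs_l2 (rep_l2 f) = f"
  using Quotient3_l2 by (rule Quotient3_abs_rep)

lemma abs_l2_eq_iff:
  assumes "square_integrable f" "square_integrable g"
  shows "abs_l2 f = abs_l2 g \<longleftrightarrow> (AE x in lborel. f x = g x)"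
  using Quotient3_rel[OF Quotient3_l2, of f g] assms by (simp add: l2_eq_def)

lemma square_integrable_diff:
  "square_integrable f \<Longrightarrow> square_integrable g \<Longrightarrow> square_integrable (\<lambda>x. f x - g x)"
  using square_integrable_add[of f "\<lambda>x. -1 * g x"] square_integrable_scale[of g "-1"] by simp

lemma abs_l2_add:
  "square_integrable f \<Longrightarrow> square_integrable g \<Longrightarrow> abs_l2 f + abs_l2 g = abs_l2 (\<lambda>x. f x + g x)"
  by (rule plus_l2.abs_eq) (simp_all add: l2_eq_def)

lemma abs_l2_scaleR:
  "square_integrable f \<Longrightarrow> c *\<^sub>R abs_l2 f = abs_l2 (\<lambda>x. c * f x)"
  by (rule scaleR_l2.abs_eq) (simp_all add: l2_eq_def)

lemma abs_l2_diff:
  "square_integrable f \<Longrightarrow> square_integrable g \<Longrightarrow> abs_l2 f - abs_l2 g = abs_l2 (\<lambda>x. f x - g x)"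
  using abs_l2_add[of f "\<lambda>x. -1 * g x"] abs_l2_scaleR[of g "-1"] square_integrable_scale[of g "-1"]
  by (simp add: minus_l2_def)

lemma inner_abs_l2:
  "square_integrable f \<Longrightarrow> square_integrable g \<Longrightarrow>
    inner (abs_l2 f) (abs_l2 g) = (LINT x|lborel. f x * g x)"
  by (rule inner_l2.abs_eq) (simp_all add: l2_eq_def)

lemma norm_abs_l2:
  "square_integrable f \<Longrightarrow> (norm (abs_l2 f))\<^sup>2 = (LINT x|lborel. (f x)\<^sup>2)"
  unfolding power2_norm_eq_inner by (simp add: inner_abs_l2 power2_eq_square)

lemma nn_integral_square_abs_l2:
  "square_integrable f \<Longrightarrow> (\<integral>\<^sup>+x. ennreal ((f x)\<^sup>2) \<partial>lborel) = ennreal ((norm (abs_l2 f))\<^sup>2)"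
  by (simp add: norm_abs_l2 square_integrable_def nn_integral_eq_integral)

lemma square_integrableI_nn_integral:
  assumes "f \<in> borel_measurable lborel" "(\<integral>\<^sup>+x. ennreal ((f x)\<^sup>2) \<partial>lborel) < \<infinity>"
  shows "square_integrable f"
  unfolding square_integrable_def
  using assms by (auto intro!: integrableI_bounded borel_measurable_power)

text \<open>A single term is at most the finite sum \<open>C\<close>; the weight 4^k therefore
  bounds the k-th increment by \<open>sqrt C * (1/2) ^ k\<close>, and the telescoping series
  converges.\<close>

lemma convergent_if_weighted_square_suminf_finite:
  fixes d :: "nat \<Rightarrow> real"
  assumes "(\<Sum>k. ennreal (4 ^ k * (d (Suc k) - d k)\<^sup>2)) \<noteq> \<infinity>"
  shows "convergent d"
proof -
  define e where "e = (\<lambda>k. ennreal (4 ^ k * (d (Suc k) - d k)\<^sup>2))"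
  define S where "S = suminf e"
  have "S \<noteq> \<infinity>" using assms unfolding S_def e_def .
  then obtain C where C: "C \<ge> 0" "S = ennreal C"
    by (cases S rule: ennreal_cases) auto
  have four_power: "((2::real) ^ k)\<^sup>2 = 4 ^ k" for k
    by (simp add: power2_eq_square flip: power_mult_distrib)
  have le: "\<bar>d (Suc k) - d k\<bar> \<le> sqrt C * (1/2) ^ k" for k
  proof -
    have "sum e {k} \<le> S"
      unfolding S_def by (rule sum_le_suminf) auto
    then have "ennreal (4 ^ k * (d (Suc k) - d k)\<^sup>2) \<le> ennreal C"
      unfolding C(2) by (simp add: e_def)
    then have "4 ^ k * (d (Suc k) - d k)\<^sup>2 \<le> C" using C(1) by (simp add: ennreal_le_iff)
    then have "(2 ^ k * (d (Suc k) - d k))\<^sup>2 \<le> C"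
      by (simp only: power_mult_distrib four_power)
    then have "\<bar>2 ^ k * (d (Suc k) - d k)\<bar> \<le> sqrt C"
      by (metis real_sqrt_abs real_sqrt_le_mono)
    then have "2 ^ k * \<bar>d (Suc k) - d k\<bar> \<le> sqrt C" by (simp add: abs_mult)
    then show ?thesis by (simp add: power_one_over pos_le_divide_eq mult.commute)
  qed
  have "summable (\<lambda>k. d (Suc k) - d k)"
    by (rule summable_comparison_test'[where g="\<lambda>k. sqrt C * (1/2) ^ k" and N=0])
      (auto intro!: summable_mult summable_geometric le)
  then have "convergent (\<lambda>n. \<Sum>k<n. d (Suc k) - d k)" by (simp add: summable_iff_convergent)
  then have "convergent (\<lambda>n. d n - d 0)" by (simp add: sum_lessThan_telescope)
  then show ?thesis by (simp add: convergent_diff_const_right_iff)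
qed

text \<open>Riesz--Fischer: a subsequence with geometrically fast decreasing increments converges
  almost everywhere, and Fatou's lemma turns this into convergence in the mean.\<close>

instance l2 :: (euclidean_space) banach
proof
  fix X :: "nat \<Rightarrow> 'a l2"
  assume X: "Cauchy X"
  \<comment> \<open>The rate 1/8 leaves room for the weight 4^k used below: 4^k times the square of
    (1/8)^k is (1/16)^k, which is summable.\<close>
  have "\<exists>r. strict_mono r \<and> (\<forall>k. \<forall>m\<ge>r k. \<forall>n\<ge>r k. norm (X m - X n) < (1/8) ^ k)"
  proof -
    have "\<exists>f. \<forall>k. (\<forall>m\<ge>f k. \<forall>n\<ge>f k. norm (X m - X n) < (1/8) ^ k) \<and> f k < f (Suc k)"
    proof (rule dependent_nat_choice)
      show "\<exists>x. \<forall>m\<ge>x. \<forall>n\<ge>x. norm (X m - X n) < (1/8) ^ 0"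
        using X[THEN CauchyD, of 1] by simp
      fix x n :: nat
      obtain M where "\<forall>m\<ge>M. \<forall>k\<ge>M. norm (X m - X k) < (1/8) ^ Suc n"
        using X[THEN CauchyD, of "(1/8) ^ Suc n"] by auto
      then show "\<exists>y. (\<forall>m\<ge>y. \<forall>k\<ge>y. norm (X m - X k) < (1/8) ^ Suc n) \<and> x < y"
        by (intro exI[of _ "max M (Suc x)"]) auto
    qed
    then show ?thesis by (metis strict_mono_Suc_iff)
  qed
  then obtain r where r: "strict_mono r"
    and rX: "\<And>k m n. m \<ge> r k \<Longrightarrow> n \<ge> r k \<Longrightarrow> norm (X m - X n) < (1/8) ^ k" by blast
  define d where "d = (\<lambda>k. rep_l2 (X (r k)))"
  have sd: "square_integrable (d k)" for k by (simp add: d_def square_integrable_rep_l2)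
  have ad: "abs_l2 (d k) = X (r k)" for k by (simp add: d_def abs_rep_l2)
  have [measurable]: "d k \<in> borel_measurable lborel" for k
    using sd[of k] by (simp add: square_integrable_def)
  have nd: "(\<integral>\<^sup>+x. ennreal ((d m x - d n x)\<^sup>2) \<partial>lborel) = ennreal ((norm (X (r m) - X (r n)))\<^sup>2)"
    for m n
    using nn_integral_square_abs_l2[OF square_integrable_diff[OF sd[of m] sd[of n]]]
    by (simp add: abs_l2_diff[OF sd sd, symmetric] ad)
  have nd_le: "(\<integral>\<^sup>+x. ennreal ((d m x - d n x)\<^sup>2) \<partial>lborel) \<le> ennreal (((1/8) ^ k)\<^sup>2)"
    if "m \<ge> k" "n \<ge> k" for k m n
    unfolding nd using that rX[of k "r m" "r n"] r
    by (intro ennreal_leI power_mono) (auto simp: strict_mono_less_eq less_imp_le)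
  have sixteenth: "ennreal (4 ^ k) * ennreal (((1/8) ^ k)\<^sup>2) = ennreal ((1/16) ^ k)" for k :: nat
  proof -
    have "4 ^ k * ((1/8) ^ k)\<^sup>2 = (4 * ((1/8) * (1/8)) :: real) ^ k"
      by (simp only: power_mult_distrib power2_eq_square)
    then show ?thesis by (simp flip: ennreal_mult)
  qed
  have "(\<integral>\<^sup>+x. (\<Sum>k. ennreal (4 ^ k * (d (Suc k) x - d k x)\<^sup>2)) \<partial>lborel)
      = (\<Sum>k. \<integral>\<^sup>+x. ennreal (4 ^ k * (d (Suc k) x - d k x)\<^sup>2) \<partial>lborel)"
    by (rule nn_integral_suminf) measurable
  also have "\<dots> = (\<Sum>k. ennreal (4 ^ k) * (\<integral>\<^sup>+x. ennreal ((d (Suc k) x - d k x)\<^sup>2) \<partial>lborel))"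
    by (simp add: ennreal_mult nn_integral_cmult)
  also have "\<dots> \<le> (\<Sum>k. ennreal (4 ^ k) * ennreal (((1/8) ^ k)\<^sup>2))"
    by (intro suminf_le mult_left_mono nd_le) auto
  also have "\<dots> = (\<Sum>k. ennreal ((1/16) ^ k))"
    by (simp only: sixteenth)
  also have "\<dots> = ennreal (\<Sum>k. (1/16) ^ k)"
    by (rule suminf_ennreal_eq) (auto intro!: summable_sums summable_geometric)
  also have "\<dots> < \<infinity>" by simp
  finally have "AE x in lborel. (\<Sum>k. ennreal (4 ^ k * (d (Suc k) x - d k x)\<^sup>2)) \<noteq> \<infinity>"
    by (intro nn_integral_PInf_AE) auto
  then have conv: "AE x in lborel. convergent (\<lambda>k. d k x)"
    by eventually_elim (rule convergent_if_weighted_square_suminf_finite)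
  define f where "f = (\<lambda>x. lim (\<lambda>k. d k x))"
  have [measurable]: "f \<in> borel_measurable lborel"
    unfolding f_def by (rule borel_measurable_lim_metric) simp
  have fatou: "(\<integral>\<^sup>+x. ennreal ((f x - d k x)\<^sup>2) \<partial>lborel) \<le> ennreal (((1/8) ^ k)\<^sup>2)" for k
  proof -
    have "(\<integral>\<^sup>+x. ennreal ((f x - d k x)\<^sup>2) \<partial>lborel)
        = (\<integral>\<^sup>+x. liminf (\<lambda>n. ennreal ((d n x - d k x)\<^sup>2)) \<partial>lborel)"
    proof (rule nn_integral_cong_AE, use conv in eventually_elim)
      fix x assume "convergent (\<lambda>n. d n x)"
      then have "(\<lambda>n. d n x) \<longlonglongrightarrow> f x" by (simp add: f_def convergent_LIMSEQ_iff)
      then have "(\<lambda>n. ennreal ((d n x - d k x)\<^sup>2)) \<longlonglongrightarrow> ennreal ((f x - d k x)\<^sup>2)"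
        by (intro tendsto_intros)
      then show "ennreal ((f x - d k x)\<^sup>2) = liminf (\<lambda>n. ennreal ((d n x - d k x)\<^sup>2))"
        by (rule lim_imp_Liminf[symmetric, rotated]) simp
    qed
    also have "\<dots> \<le> liminf (\<lambda>n. \<integral>\<^sup>+x. ennreal ((d n x - d k x)\<^sup>2) \<partial>lborel)"
      by (rule nn_integral_liminf) measurable
    also have "\<dots> \<le> liminf (\<lambda>n::nat. ennreal (((1/8) ^ k)\<^sup>2))"
      by (rule Liminf_mono) (auto intro!: eventually_sequentiallyI[of k] nd_le)
    also have "\<dots> = ennreal (((1/8) ^ k)\<^sup>2)" by (rule Liminf_const) simp
    finally show ?thesis .
  qed
  have sfd: "square_integrable (\<lambda>x. f x - d k x)" for k
    by (rule square_integrableI_nn_integral) (auto intro: le_less_trans[OF fatou])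
  have sf: "square_integrable f"
    using square_integrable_add[OF sfd sd, of 0 0] by simp
  have "norm (X (r k) - abs_l2 f) \<le> (1/8) ^ k" for k
  proof -
    have "ennreal ((norm (abs_l2 f - X (r k)))\<^sup>2) \<le> ennreal (((1/8) ^ k)\<^sup>2)"
      using fatou[of k] nn_integral_square_abs_l2[OF sfd[of k]]
      by (simp add: abs_l2_diff[OF sf sd, symmetric] ad)
    then have "(norm (abs_l2 f - X (r k)))\<^sup>2 \<le> ((1/8) ^ k)\<^sup>2"
      by (subst (asm) ennreal_le_iff) simp_all
    then show ?thesis by (simp add: power2_le_iff_abs_le norm_minus_commute)
  qed
  moreover have "(\<lambda>k. (1/8::real) ^ k) \<longlonglongrightarrow> 0" by (rule LIMSEQ_realpow_zero) auto
  ultimately have "(\<lambda>k. X (r k) - abs_l2 f) \<longlonglongrightarrow> 0"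
    by (intro Lim_null_comparison[of "\<lambda>k. X (r k) - abs_l2 f" "\<lambda>k. (1/8) ^ k"] always_eventually allI)
  then have "(\<lambda>k. X (r k)) \<longlonglongrightarrow> abs_l2 f" by (simp add: Lim_null[symmetric])
  then have "X \<longlonglongrightarrow> abs_l2 f"
    using Cauchy_converges_subseq[OF X r] by (simp add: o_def)
  then show "convergent X" by (auto simp: convergent_def)
qed

section \<open>The subspace of functions vanishing outside the domain\<close>

lemma square_integrable_bounded_mult:
  assumes "square_integrable f" "h \<in> borel_measurable lborel" "\<And>x. f x \<noteq> 0 \<Longrightarrow> \<bar>h x\<bar> \<le> B"
  shows "square_integrable (\<lambda>x. h x * f x)"
  unfolding square_integrable_def
proof (intro conjI)
  have [measurable]: "f \<in> borel_measurable lborel" "h \<in> borel_measurable lborel"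
    using assms by (auto simp: square_integrable_def)
  show "(\<lambda>x. h x * f x) \<in> borel_measurable lborel" by measurable
  show "integrable lborel (\<lambda>x. (h x * f x)\<^sup>2)"
  proof (rule Bochner_Integration.integrable_bound)
    show "integrable lborel (\<lambda>x. B\<^sup>2 * (f x)\<^sup>2)"
      using assms by (simp add: square_integrable_def)
    show "AE x in lborel. norm ((h x * f x)\<^sup>2) \<le> norm (B\<^sup>2 * (f x)\<^sup>2)"
    proof (rule AE_I2)
      fix x
      have "f x = 0 \<or> (h x)\<^sup>2 \<le> B\<^sup>2" using assms(3)[of x] by (metis abs_ge_zero power2_abs power_mono)
      then show "norm ((h x * f x)\<^sup>2) \<le> norm (B\<^sup>2 * (f x)\<^sup>2)"
        by (auto simp: power_mult_distrib intro: mult_right_mono)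
    qed
  qed measurable
qed

text \<open>Vanishing outside \<Omega> is orthogonality to everything supported outside \<Omega>;
  for the converse, \<open>f\<close> is tested with its own restriction to the complement. As an
  intersection of kernels of continuous functionals the set is visibly closed and a
  subspace.\<close>

lemma L2_on_eq_Inter:
  fixes \<Omega> :: "'a::euclidean_space set"
  assumes "\<Omega> \<in> sets borel"
  shows "L2_on \<Omega> = (\<Inter>g. {f. inner f (abs_l2 (\<lambda>x. indicator (-\<Omega>) x * rep_l2 g x)) = 0})"
    (is "_ = (\<Inter>g. {f. inner f (?P g) = 0})")
proof -
  have mI [measurable]: "(indicator (-\<Omega>) :: 'a \<Rightarrow> real) \<in> borel_measurable lborel"
    using assms by (simp del: indicator_simps)
  have sP: "square_integrable (\<lambda>x. indicator (-\<Omega>) x * rep_l2 g x)" for g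
    by (rule square_integrable_bounded_mult[OF square_integrable_rep_l2 mI, where B=1])
      (simp add: indicator_def)
  have inn: "inner f (?P g) = (LINT x|lborel. rep_l2 f x * (indicator (-\<Omega>) x * rep_l2 g x))" for f g
    using inner_abs_l2[OF square_integrable_rep_l2 sP, of f g] by (simp add: abs_rep_l2)
  have mf [measurable]: "rep_l2 f \<in> borel_measurable lborel" for f :: "'a l2"
    using square_integrable_rep_l2[of f] by (simp add: square_integrable_def)
  show ?thesis
  proof (intro set_eqI iffI INT_I CollectI)
    fix f g assume "f \<in> L2_on \<Omega>"
    then have "AE x in lborel. rep_l2 f x * (indicator (-\<Omega>) x * rep_l2 g x) = 0"
      unfolding L2_on_def mem_Collect_eq by eventually_elim (auto simp: indicator_def)
    then have "(LINT x|lborel. rep_l2 f x * (indicator (-\<Omega>) x * rep_l2 g x)) = 0"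
      by (rule integral_eq_zero_AE)
    then show "inner f (?P g) = 0" by (simp add: inn)
  next
    fix f assume "f \<in> (\<Inter>g. {f. inner f (?P g) = 0})"
    then have "(LINT x|lborel. rep_l2 f x * (indicator (-\<Omega>) x * rep_l2 f x)) = 0"
      by (auto simp: inn)
    then have "AE x in lborel. rep_l2 f x * (indicator (-\<Omega>) x * rep_l2 f x) = 0"
      using integral_nonneg_eq_0_iff_AE[OF square_integrable_mult[OF square_integrable_rep_l2 sP], of f f]
      by (force simp: indicator_def)
    then show "f \<in> L2_on \<Omega>"
      unfolding L2_on_def mem_Collect_eq by eventually_elim (auto simp: indicator_def)
  qed
qed

lemma closed_L2_on:
  assumes "\<Omega> \<in> sets borel" shows "closed (L2_on \<Omega>)"
  unfolding L2_on_eq_Inter[OF assms]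
  by (intro closed_INT ballI closed_Collect_eq continuous_intros)

lemma subspace_L2_on:
  assumes "\<Omega> \<in> sets borel" shows "subspace (L2_on \<Omega>)"
  unfolding L2_on_eq_Inter[OF assms] subspace_def
  by (auto simp: inner_add_left)

section \<open>Smooth functions\<close>

lemma C_diff_continuous_on: "C_diff k f \<Longrightarrow> continuous_on UNIV f"
  by (cases k) (auto intro!: differentiable_imp_continuous_on simp: differentiable_on_def)

lemma partial_deriv_eq:
  "(f has_derivative f') (at x) \<Longrightarrow> partial_deriv i f x = f' (axis i 1)"
  unfolding partial_deriv_def by (simp add: frechet_derivative_at[symmetric])

lemma differentiable_has_derivative:
  "f differentiable (at x) \<Longrightarrow> (f has_derivative frechet_derivative f (at x)) (at x)"
  by (simp add: frechet_derivative_works)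

lemma C_diff_SucD: "C_diff (Suc k) f \<Longrightarrow> C_diff k f"
proof (induction k arbitrary: f)
  case 0
  then show ?case using C_diff_continuous_on by fastforce
qed auto

lemma partial_deriv_add:
  assumes "f differentiable (at x)" "g differentiable (at x)"
  shows "partial_deriv i (\<lambda>x. f x + g x) x = partial_deriv i f x + partial_deriv i g x"
  using partial_deriv_eq[OF has_derivative_add[OF assms[THEN differentiable_has_derivative]]]
  by (simp add: partial_deriv_def)

lemma partial_deriv_mult:
  assumes "f differentiable (at x)" "g differentiable (at x)"
  shows "partial_deriv i (\<lambda>x. f x * g x) x = f x * partial_deriv i g x + partial_deriv i f x * g x"
  using partial_deriv_eq[OF has_derivative_mult[OF assms[THEN differentiable_has_derivative]]]
  by (simp add: partial_deriv_def)

lemma C_diff_add: "C_diff k f \<Longrightarrow> C_diff k g \<Longrightarrow> C_diff k (\<lambda>x. f x + g x)"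
proof (induction k arbitrary: f g)
  case (Suc k)
  then have "partial_deriv i (\<lambda>x. f x + g x) = (\<lambda>x. partial_deriv i f x + partial_deriv i g x)" for i
    by (auto simp: fun_eq_iff intro!: partial_deriv_add)
  with Suc show ?case by auto
qed (auto intro: continuous_on_add)

lemma C_diff_mult: "C_diff k f \<Longrightarrow> C_diff k g \<Longrightarrow> C_diff k (\<lambda>x. f x * g x)"
proof (induction k arbitrary: f g)
  case (Suc k)
  have "C_diff k f" "C_diff k g" using Suc.prems by (blast intro: C_diff_SucD)+
  moreover have "partial_deriv i (\<lambda>x. f x * g x)
      = (\<lambda>x. f x * partial_deriv i g x + partial_deriv i f x * g x)" for i
    using Suc.prems by (auto simp: fun_eq_iff intro!: partial_deriv_mult)
  ultimately show ?case using Suc by (auto intro!: C_diff_add)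
qed (auto intro: continuous_on_mult)

lemma C_diff_const: "C_diff k (\<lambda>x::real^'n. c)"
proof (induction k arbitrary: c)
  case (Suc k)
  have "partial_deriv i (\<lambda>x::real^'n. c) = (\<lambda>x. 0)" for i
    by (rule ext, subst partial_deriv_eq[OF has_derivative_const]) simp
  then show ?case using Suc by simp
qed simp

lemma partial_deriv_component:
  "partial_deriv i (\<lambda>x::real^'n. x $ j) = (\<lambda>x. if i = j then 1 else 0)"
proof
  fix x :: "real^'n"
  have "((\<lambda>x::real^'n. x $ j) has_derivative (\<lambda>x. x $ j)) (at x)"
    by (rule bounded_linear_imp_has_derivative[OF bounded_linear_vec_nth])
  from partial_deriv_eq[OF this] show "partial_deriv i (\<lambda>x. x $ j) x = (if i = j then 1 else 0)"
    by (simp add: axis_def)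
qed

lemma C_diff_component: "C_diff k (\<lambda>x::real^'n. x $ j)"
proof (cases k)
  case (Suc m)
  then show ?thesis
    by (auto simp: partial_deriv_component C_diff_const
        intro!: bounded_linear_imp_differentiable bounded_linear_vec_nth)
qed (auto intro!: continuous_intros)

lemma C_diff_prod: "finite I \<Longrightarrow> (\<And>j. j \<in> I \<Longrightarrow> C_diff k (f j)) \<Longrightarrow> C_diff k (\<lambda>x. \<Prod>j\<in>I. f j x)"
  by (induction I rule: finite_induct) (auto intro: C_diff_const C_diff_mult)

text \<open>The functions \<open>q (1 / s) exp (- 1 / s)\<close>, extended by zero to \<open>s \<le> 0\<close>, with \<open>q\<close> a
  polynomial, form a class that is closed under differentiation.\<close>

definition flat :: "real poly \<Rightarrow> real \<Rightarrow> real" where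
  "flat q s = (if s > 0 then poly q (inverse s) * exp (- inverse s) else 0)"

text \<open>Substituting x = 1/s reduces this to the decay of a polynomial times exp (-x) at
  infinity.\<close>

lemma flat_tendsto_0: "(flat q \<longlongrightarrow> 0) (at_right 0)"
proof -
  have "((\<lambda>x. \<Sum>k\<le>degree q. coeff q k * (x ^ k / exp x)) \<longlongrightarrow> (\<Sum>k\<le>degree q. coeff q k * 0)) at_top"
    by (intro tendsto_intros tendsto_power_div_exp_0)
  then have "((\<lambda>x. poly q x * exp (- x)) \<longlongrightarrow> 0) at_top"
    by (simp add: poly_altdef sum_distrib_right exp_minus divide_inverse mult.assoc)
  then have "((\<lambda>s. poly q (inverse s) * exp (- inverse s)) \<longlongrightarrow> 0) (at_right 0)"
    by (rule filterlim_compose) (rule filterlim_inverse_at_top_right)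
  then show ?thesis
    by (rule Lim_transform_eventually)
      (auto simp: flat_def eventually_at_filter)
qed

text \<open>By the chain rule the derivative of q(1/s) exp(-1/s) is s^-2 (q(1/s) - q'(1/s))
  exp(-1/s), and the factor s^-2 is the polynomial \<open>[:0, 0, 1:]\<close> evaluated at
  1/s.\<close>

lemma flat_has_real_derivative:
  "(flat q has_real_derivative flat ([:0, 0, 1:] * (q - pderiv q)) s) (at s)"
proof (cases s "0::real" rule: linorder_cases)
  case less
  have "((\<lambda>s. 0) has_real_derivative 0) (at s)" by simp
  moreover have "eventually (\<lambda>s. s \<in> {..<0}) (nhds s)"
    using less by (intro eventually_nhds_in_open) auto
  then have "eventually (\<lambda>s. 0 = flat q s) (nhds s)"
    by eventually_elim (simp add: flat_def)
  ultimately have "(flat q has_real_derivative 0) (at s)"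
    by (simp add: DERIV_cong_ev)
  then show ?thesis using less by (simp add: flat_def)
next
  case greater
  have "((\<lambda>s. poly q (inverse s) * exp (- inverse s)) has_real_derivative
      flat ([:0, 0, 1:] * (q - pderiv q)) s) (at s)"
    using greater
    by (auto intro!: derivative_eq_intros simp: flat_def power2_eq_square field_simps)
  moreover have "eventually (\<lambda>s. s \<in> {0<..}) (nhds s)"
    using greater by (intro eventually_nhds_in_open) auto
  then have "eventually (\<lambda>s. poly q (inverse s) * exp (- inverse s) = flat q s) (nhds s)"
    by eventually_elim (simp add: flat_def)
  ultimately show ?thesis by (simp add: DERIV_cong_ev)
next
  case equal
  have "((\<lambda>h. (flat q h - flat q 0) / (h - 0)) \<longlongrightarrow> 0) (at_left 0)"
    by (rule tendsto_eventually) (auto simp: flat_def eventually_at_filter)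
  \<comment> \<open>Since \<open>flat q 0\<close> is 0, the right difference quotient is
    \<open>flat q h\<close> divided by \<open>h\<close>, which is again a flat function, with
    polynomial \<open>[:0, 1:] * q\<close>.\<close>
  moreover have "((\<lambda>h. (flat q h - flat q 0) / (h - 0)) \<longlongrightarrow> 0) (at_right 0)"
    using flat_tendsto_0[of "[:0, 1:] * q"]
    by (rule Lim_transform_eventually)
      (auto simp: flat_def eventually_at_filter field_simps)
  ultimately have "(flat q has_real_derivative 0) (at 0)"
    by (simp add: has_field_derivative_iff filterlim_at_split)
  then show ?thesis using equal by (simp add: flat_def)
qed

text \<open>The induction runs over all \<open>q\<close> at once because differentiation changes the
  polynomial. The sign of \<open>c\<close> is free so that both faces of a box in direction
  \<open>j\<close> are covered.\<close>

lemma C_diff_flat_affine: "C_diff k (\<lambda>x::real^'n. flat q (c * x $ j + d))"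
proof (induction k arbitrary: q)
  case 0
  have "isCont (flat q) s" for s using flat_has_real_derivative DERIV_isCont by blast
  then have "continuous_on UNIV (flat q)" by (simp add: continuous_at_imp_continuous_on)
  then show ?case by (auto intro!: continuous_on_compose2[of UNIV "flat q"] continuous_intros)
next
  case (Suc k)
  let ?q = "[:0, 0, 1:] * (q - pderiv q)"
  have d: "((\<lambda>x::real^'n. flat q (c * x $ j + d)) has_derivative
      (\<lambda>h. flat ?q (c * x $ j + d) * (c * h $ j))) (at x)" for x
  proof -
    have "((\<lambda>x::real^'n. c * x $ j + d) has_derivative (\<lambda>h. c * h $ j)) (at x)"
      by (auto intro!: derivative_eq_intros bounded_linear_imp_has_derivative bounded_linear_vec_nth)
    from has_derivative_compose[OF this flat_has_real_derivative[unfolded has_field_derivative_def]]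
    show ?thesis by simp
  qed
  have "partial_deriv i (\<lambda>x::real^'n. flat q (c * x $ j + d))
      = (\<lambda>x. (c * axis i 1 $ j) * flat ?q (c * x $ j + d))" for i
    by (rule ext, subst partial_deriv_eq[OF d]) (simp add: mult.commute)
  moreover have "(\<lambda>x::real^'n. flat q (c * x $ j + d)) differentiable (at x)" for x :: "real^'n"
    using d unfolding differentiable_def by blast
  ultimately show ?case
    by (simp del: mult_pCons_left) (intro allI C_diff_mult C_diff_const Suc.IH)
qed

section \<open>Test functions\<close>

lemma test_function_C_diff: "test_function \<Omega> \<phi> \<Longrightarrow> C_diff k \<phi>"
  by (simp add: test_function_def)

lemma test_function_differentiable: "test_function \<Omega> \<phi> \<Longrightarrow> \<phi> differentiable (at x)"
  using test_function_C_diff[of \<Omega> \<phi> "Suc 0"] by simp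

lemma test_function_continuous_on: "test_function \<Omega> \<phi> \<Longrightarrow> continuous_on UNIV \<phi>"
  using test_function_C_diff[of \<Omega> \<phi> 0] by simp

lemma test_function_outside: "test_function \<Omega> \<phi> \<Longrightarrow> x \<notin> \<Omega> \<Longrightarrow> \<phi> x = 0"
  using closure_subset[of "{x. \<phi> x \<noteq> 0}"] by (auto simp: test_function_def)

lemma test_functionI_subset:
  assumes "\<And>k. C_diff k \<psi>" "test_function \<Omega> \<phi>" "{x. \<psi> x \<noteq> 0} \<subseteq> closure {x. \<phi> x \<noteq> 0}"
  shows "test_function \<Omega> \<psi>"
proof -
  have "closure {x. \<psi> x \<noteq> 0} \<subseteq> closure {x. \<phi> x \<noteq> 0}"
    using assms(3) by (simp add: closure_minimal)
  moreover from this have "compact (closure {x. \<psi> x \<noteq> 0})"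
    using assms(2) compact_Int_closed[of "closure {x. \<phi> x \<noteq> 0}" "closure {x. \<psi> x \<noteq> 0}"]
    by (simp add: test_function_def Int_absorb1)
  ultimately show ?thesis using assms(1,2) unfolding test_function_def by blast
qed

lemma test_function_partial_deriv:
  assumes "test_function \<Omega> \<phi>" shows "test_function \<Omega> (partial_deriv i \<phi>)"
proof (rule test_functionI_subset[OF _ assms])
  show "C_diff k (partial_deriv i \<phi>)" for k using test_function_C_diff[OF assms, of "Suc k"] by simp
  show "{x. partial_deriv i \<phi> x \<noteq> 0} \<subseteq> closure {x. \<phi> x \<noteq> 0}"
  proof (rule subsetI, rule ccontr)
    fix x assume x: "x \<in> {x. partial_deriv i \<phi> x \<noteq> 0}" "x \<notin> closure {x. \<phi> x \<noteq> 0}"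
    have "((\<lambda>y. 0::real) has_derivative (\<lambda>h. 0)) (at x)" by (rule has_derivative_const)
    then have "(\<phi> has_derivative (\<lambda>h. 0)) (at x)"
      by (rule has_derivative_transform_within_open[where s="- closure {x. \<phi> x \<noteq> 0}"])
        (use x closure_subset[of "{x. \<phi> x \<noteq> 0}"] in auto)
    from partial_deriv_eq[OF this] x show False by simp
  qed
qed

lemma test_function_mult_left:
  assumes "\<And>k. C_diff k h" "test_function \<Omega> \<phi>" shows "test_function \<Omega> (\<lambda>x. h x * \<phi> x)"
  by (rule test_functionI_subset[OF C_diff_mult[OF assms(1) test_function_C_diff[OF assms(2)]] assms(2)])
    (use closure_subset[of "{x. \<phi> x \<noteq> 0}"] in auto)

lemma test_function_add:
  assumes "test_function \<Omega> \<phi>" "test_function \<Omega> \<psi>" shows "test_function \<Omega> (\<lambda>x. \<phi> x + \<psi> x)"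
  unfolding test_function_def
proof (intro conjI allI)
  show "C_diff k (\<lambda>x. \<phi> x + \<psi> x)" for k
    using assms by (intro C_diff_add test_function_C_diff)
  let ?K = "closure {x. \<phi> x \<noteq> 0} \<union> closure {x. \<psi> x \<noteq> 0}"
  have "closure {x. \<phi> x + \<psi> x \<noteq> 0} \<subseteq> closure ({x. \<phi> x \<noteq> 0} \<union> {x. \<psi> x \<noteq> 0})"
    by (rule closure_mono) auto
  then have sub: "closure {x. \<phi> x + \<psi> x \<noteq> 0} \<subseteq> ?K" by simp
  have K: "compact ?K" "?K \<subseteq> \<Omega>" using assms by (auto simp: test_function_def)
  show "closure {x. \<phi> x + \<psi> x \<noteq> 0} \<subseteq> \<Omega>" using sub K(2) by (rule subset_trans)
  show "compact (closure {x. \<phi> x + \<psi> x \<noteq> 0})"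
    using sub compact_Int_closed[OF K(1), of "closure {x. \<phi> x + \<psi> x \<noteq> 0}"] by (simp add: Int_absorb1)
qed

lemma test_function_zero: "test_function \<Omega> (\<lambda>x. 0)"
  by (simp add: test_function_def C_diff_const)

lemma test_function_integrable:
  assumes "test_function \<Omega> \<phi>" shows "integrable lborel \<phi>"
proof -
  let ?K = "closure {x. \<phi> x \<noteq> 0}"
  have "integrable lborel (\<lambda>x. indicator ?K x *\<^sub>R \<phi> x)"
    using assms test_function_continuous_on[OF assms]
    by (intro borel_integrable_compact) (auto simp: test_function_def intro: continuous_on_subset)
  moreover have "(\<lambda>x. indicator ?K x *\<^sub>R \<phi> x) = \<phi>"
    using closure_subset[of "{x. \<phi> x \<noteq> 0}"] by (auto simp: fun_eq_iff indicator_def)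
  ultimately show ?thesis by simp
qed

lemma square_integrable_test_function:
  assumes "test_function \<Omega> \<phi>" shows "square_integrable \<phi>"
  using test_function_integrable[OF test_function_mult_left[OF test_function_C_diff[OF assms] assms]]
    test_function_integrable[OF assms]
  by (simp add: square_integrable_def power2_eq_square)

lemma test_function_bounded:
  assumes "test_function \<Omega> \<phi>" obtains B where "\<And>x. \<bar>\<phi> x\<bar> \<le> B"
proof -
  let ?K = "closure {x. \<phi> x \<noteq> 0}"
  have "compact (\<phi> ` ?K)"
    using assms test_function_continuous_on[OF assms]
    by (intro compact_continuous_image) (auto simp: test_function_def intro: continuous_on_subset)
  then have "bounded (\<phi> ` ?K)" by (rule compact_imp_bounded)
  then obtain B where "\<forall>y\<in>\<phi> ` ?K. norm y \<le> B"
    unfolding bounded_iff by (elim exE)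
  then have B: "x \<in> ?K \<Longrightarrow> \<bar>\<phi> x\<bar> \<le> B" for x by simp
  have "\<bar>\<phi> x\<bar> \<le> max B 0" for x
    using B[of x] closure_subset[of "{x. \<phi> x \<noteq> 0}"] by (cases "\<phi> x = 0") (auto simp: max_def)
  then show ?thesis using that by blast
qed

section \<open>The fundamental lemma of the calculus of variations\<close>

lemma AE_zero_if_box_integrals_zero:
  fixes r :: "'a::euclidean_space \<Rightarrow> real"
  assumes r: "integrable lborel r"
    and box: "\<And>a b. (LINT x|lborel. r x * indicator (box a b) x) = 0"
  shows "AE x in lborel. r x = 0"
proof -
  define f where "f = (\<lambda>x. max (r x) 0)"
  define f' where "f' = (\<lambda>x. max (- r x) 0)"
  have int: "integrable lborel f" "integrable lborel f'"
    using r by (auto simp: f_def f'_def)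
  then have [measurable]: "f \<in> borel_measurable borel" "f' \<in> borel_measurable borel"
    by (auto dest: borel_measurable_integrable)
  have pos: "0 \<le> f x" "0 \<le> f' x" and rf: "r x = f x - f' x" for x
    by (auto simp: f_def f'_def)
  have int_box: "integrable lborel (\<lambda>x. f x * indicator (box a b) x)"
    "integrable lborel (\<lambda>x. f' x * indicator (box a b) x)" for a b
    using int by (auto intro!: integrable_real_mult_indicator)
  have em: "emeasure (density lborel (\<lambda>x. ennreal (g x))) (box a b)
      = ennreal (LINT x|lborel. g x * indicator (box a b) x)"
    if g: "integrable lborel g" "\<And>x. 0 \<le> g x" for g and a b :: 'a
  proof -
    have [measurable]: "g \<in> borel_measurable borel" using g(1) by (auto dest: borel_measurable_integrable)
    have "emeasure (density lborel (\<lambda>x. ennreal (g x))) (box a b)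
        = (\<integral>\<^sup>+x. ennreal (g x * indicator (box a b) x) \<partial>lborel)"
      by (subst emeasure_density) (auto intro!: nn_integral_cong simp: indicator_def)
    also have "\<dots> = ennreal (LINT x|lborel. g x * indicator (box a b) x)"
      using g by (intro nn_integral_eq_integral integrable_real_mult_indicator) auto
    finally show ?thesis .
  qed
  \<comment> \<open>The positive and negative parts of \<open>r\<close> are densities of two
    measures that agree on boxes, an intersection-stable generator exhausting the space by sets of
    finite measure. Equal measures have densities equal almost everywhere, and the two parts of
    \<open>r\<close> can only coincide where \<open>r\<close> vanishes.\<close>
  have "density lborel (\<lambda>x. ennreal (f x)) = density lborel (\<lambda>x. ennreal (f' x))"
  proof (rule measure_eqI_generator_eq[where E="range (\<lambda>(a, b). box a b :: 'a set)" and \<Omega>=UNIV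
        and A="\<lambda>n::nat. box (- (real n *\<^sub>R One)) (real n *\<^sub>R One)"])
    show "Int_stable (range (\<lambda>(a, b). box a b :: 'a set))"
      by (auto simp: Int_stable_def box_Int_box)
    fix X assume "X \<in> range (\<lambda>(a, b). box a b :: 'a set)"
    then obtain a b where X: "X = box a b" by auto
    have "(LINT x|lborel. f x * indicator X x) - (LINT x|lborel. f' x * indicator X x)
        = (LINT x|lborel. r x * indicator X x)"
      unfolding rf left_diff_distrib X using int_box[of a b] by simp
    then show "emeasure (density lborel (\<lambda>x. ennreal (f x))) X
        = emeasure (density lborel (\<lambda>x. ennreal (f' x))) X"
      using int pos box by (simp add: X em)
  next
    show "(\<Union>n::nat. box (- (real n *\<^sub>R One)) (real n *\<^sub>R One)) = (UNIV::'a set)"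
      by (rule UN_box_eq_UNIV)
    show "emeasure (density lborel (\<lambda>x. ennreal (f x))) (box (- (real n *\<^sub>R One)) (real n *\<^sub>R One)) \<noteq> \<infinity>" for n :: nat
      using int pos by (simp add: em)
  qed (auto simp: borel_eq_box)
  then have "AE x in lborel. ennreal (f x) = ennreal (f' x)"
    using int pos
    by (subst (asm) finite_density_unique) (auto simp: nn_integral_eq_integral)
  then show ?thesis
    by eventually_elim (auto simp: f_def f'_def max_def split: if_splits)
qed

lemma flat_one_bounds: "0 \<le> flat 1 s" "flat 1 s \<le> 1" "flat 1 s \<noteq> 0 \<longleftrightarrow> s > 0"
  by (auto simp: flat_def)

lemma flat_one_tendsto: "(\<lambda>n. flat 1 (real (Suc n) * t)) \<longlonglongrightarrow> (if t > 0 then 1 else 0)"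
proof (cases "t > 0")
  case True
  have "(\<lambda>n. exp (- (inverse (real (Suc n)) * inverse t))) \<longlonglongrightarrow> exp (- (0 * inverse t))"
    by (intro tendsto_intros LIMSEQ_inverse_real_of_nat)
  then show ?thesis using True by (simp add: flat_def zero_less_mult_iff)
next
  case False
  then have "flat 1 (real (Suc n) * t) = 0" for n
    using flat_one_bounds(3)[of "real (Suc n) * t"] by (simp add: zero_less_mult_iff del: of_nat_Suc)
  then show ?thesis using False by simp
qed

text \<open>Each factor is exp(-1/s) at the scaled distance s to a face. The product is nonzero
  exactly in the open box and tends to 1 there as the scale grows, so indicators of boxes are
  reached by smooth functions without mollifiers. The scale is \<open>Suc n\<close> to keep it
  positive.\<close>

definition box_bump :: "real^'n \<Rightarrow> real^'n \<Rightarrow> nat \<Rightarrow> real^'n::finite \<Rightarrow> real" where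
  "box_bump a b n x =
     (\<Prod>j\<in>UNIV. flat 1 (real (Suc n) * (x $ j - a $ j)) * flat 1 (real (Suc n) * (b $ j - x $ j)))"

lemma box_bump_bounds: "0 \<le> box_bump a b n x" "box_bump a b n x \<le> 1"
  unfolding box_bump_def by (auto intro!: prod_nonneg prod_le_1 mult_nonneg_nonneg mult_le_one flat_one_bounds)

lemma box_bump_nonzero_iff: "box_bump a b n x \<noteq> 0 \<longleftrightarrow> x \<in> box a b"
  by (auto simp: box_bump_def flat_one_bounds mem_box_cart zero_less_mult_iff simp del: of_nat_Suc)

lemma box_bump_tendsto: "(\<lambda>n. box_bump a b n x) \<longlonglongrightarrow> indicator (box a b) x"
proof -
  have "(\<lambda>n. box_bump a b n x) \<longlonglongrightarrow>
      (\<Prod>j\<in>UNIV. (if x $ j - a $ j > 0 then 1 else 0) * (if b $ j - x $ j > 0 then 1 else 0))"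
    unfolding box_bump_def by (intro tendsto_prod tendsto_mult flat_one_tendsto)
  moreover have "(\<Prod>j\<in>UNIV. (if x $ j - a $ j > 0 then 1 else 0) * (if b $ j - x $ j > 0 then 1 else 0))
      = (indicator (box a b) x :: real)"
  proof (cases "x \<in> box a b")
    case True
    then show ?thesis by (auto simp: mem_box_cart intro!: prod.neutral)
  next
    case False
    then show ?thesis by (auto simp: mem_box_cart)
  qed
  ultimately show ?thesis by simp
qed

lemma test_function_box_bump:
  assumes "cbox a b \<subseteq> \<Omega>" shows "test_function \<Omega> (box_bump a b n)"
  unfolding test_function_def
proof (intro conjI allI)
  have "C_diff k (\<lambda>x. \<Prod>j\<in>UNIV. flat 1 (real (Suc n) * x $ j + (- real (Suc n) * a $ j))
      * flat 1 ((- real (Suc n)) * x $ j + real (Suc n) * b $ j))" for k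
    by (intro C_diff_prod C_diff_mult C_diff_flat_affine) auto
  moreover have "(\<lambda>x. \<Prod>j\<in>UNIV. flat 1 (real (Suc n) * x $ j + (- real (Suc n) * a $ j))
      * flat 1 ((- real (Suc n)) * x $ j + real (Suc n) * b $ j)) = box_bump a b n"
    unfolding box_bump_def by (intro ext prod.cong arg_cong2[where f="(*)"] arg_cong[where f="flat 1"])
      (simp_all add: algebra_simps)
  ultimately show "C_diff k (box_bump a b n)" for k by metis
  have sub: "closure {x. box_bump a b n x \<noteq> 0} \<subseteq> cbox a b"
    unfolding box_bump_nonzero_iff by (rule closure_minimal) (auto simp: box_subset_cbox)
  show "closure {x. box_bump a b n x \<noteq> 0} \<subseteq> \<Omega>" using sub assms by blast
  show "compact (closure {x. box_bump a b n x \<noteq> 0})"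
    using sub compact_Int_closed[OF compact_cbox[of a b], of "closure {x. box_bump a b n x \<noteq> 0}"]
    by (simp add: Int_absorb1)
qed

lemma square_integrable_indicator_box:
  "square_integrable (indicator (box a b) :: 'a::euclidean_space \<Rightarrow> real)"
proof -
  have "(\<lambda>x. (indicator (box a b) x :: real)\<^sup>2) = indicator (box a (b::'a))"
    by (auto simp: indicator_def)
  moreover have "integrable lborel (indicator (box a b) :: 'a \<Rightarrow> real)"
    by (rule integrable_real_indicator) (auto simp: emeasure_lborel_box_eq less_top[symmetric])
  ultimately show ?thesis
    unfolding square_integrable_def by (auto dest: borel_measurable_integrable)
qed

text \<open>Dominated convergence along \<open>box_bump\<close> makes the integral of
  \<open>g\<close> over every box with closure in \<Omega> vanish. Applied to subboxes of one such
  box, this gives \<open>g = 0\<close> almost everywhere in it, and countably many of these boxes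
  cover \<Omega>.\<close>

lemma L2_on_eq_0_if_orthogonal_test_functions:
  fixes g :: "(real^'n::finite) l2"
  assumes "open \<Omega>" "g \<in> L2_on \<Omega>"
    and ortho: "\<And>\<phi>. test_function \<Omega> \<phi> \<Longrightarrow> inner g (abs_l2 \<phi>) = 0"
  shows "g = 0"
proof -
  let ?r = "rep_l2 g"
  note sr = square_integrable_rep_l2[of g]
  have [measurable]: "?r \<in> borel_measurable borel"
    using sr by (simp add: square_integrable_def)
  have int: "integrable lborel (\<lambda>x. ?r x * indicator (box a b) x)" for a b
    by (rule square_integrable_mult[OF sr square_integrable_indicator_box])
  have box0: "(LINT x|lborel. ?r x * indicator (box a b) x) = 0" if ab: "cbox a b \<subseteq> \<Omega>" for a b
  proof -
    note bt = test_function_box_bump[OF ab]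
    have [measurable]: "box_bump a b n \<in> borel_measurable borel" for n
      using square_integrable_test_function[OF bt] by (simp add: square_integrable_def)
    have "(\<lambda>n. LINT x|lborel. ?r x * box_bump a b n x) \<longlonglongrightarrow> (LINT x|lborel. ?r x * indicator (box a b) x)"
    proof (rule integral_dominated_convergence)
      show "integrable lborel (\<lambda>x. \<bar>?r x * indicator (box a b) x\<bar>)" using int by (rule integrable_abs)
      show "AE x in lborel. (\<lambda>n. ?r x * box_bump a b n x) \<longlonglongrightarrow> ?r x * indicator (box a b) x"
        by (intro AE_I2 tendsto_intros box_bump_tendsto)
      show "AE x in lborel. norm (?r x * box_bump a b n x) \<le> \<bar>?r x * indicator (box a b) x\<bar>" for n
      proof (rule AE_I2)
        fix x
        show "norm (?r x * box_bump a b n x) \<le> \<bar>?r x * indicator (box a b) x\<bar>"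
        proof (cases "x \<in> box a b")
          case True
          then show ?thesis using box_bump_bounds[of a b n x] by (simp add: abs_mult mult_left_le)
        next
          case False
          then have "box_bump a b n x = 0" using box_bump_nonzero_iff by metis
          then show ?thesis by simp
        qed
      qed
    qed measurable
    moreover have "(LINT x|lborel. ?r x * box_bump a b n x) = 0" for n
      using ortho[OF bt] inner_abs_l2[OF sr square_integrable_test_function[OF bt]]
      by (simp add: abs_rep_l2)
    ultimately show ?thesis using LIMSEQ_unique[OF _ tendsto_const] by fastforce
  qed
  have AE_box: "AE x in lborel. x \<in> box c d \<longrightarrow> ?r x = 0" if "cbox c d \<subseteq> \<Omega>" for c d
  proof -
    have "AE x in lborel. ?r x * indicator (box c d) x = 0"
    proof (rule AE_zero_if_box_integrals_zero[OF int])
      fix a b :: "real^'n"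
      \<comment> \<open>The same corners describe the intersection of the open and of the closed
        boxes, so the closure condition is inherited from \<open>cbox c d\<close>.\<close>
      obtain p q where "box a b \<inter> box c d = box p q" "cbox p q = cbox a b \<inter> cbox c d"
        using box_Int_box[of a b c d] Int_interval[of a b c d] by blast
      with box0[of p q] that
      show "(LINT x|lborel. ?r x * indicator (box c d) x * indicator (box a b) x) = 0"
        by (simp add: mult.assoc indicator_inter_arith[symmetric] Int_commute le_infI2)
    qed
    then show ?thesis by eventually_elim (auto simp: indicator_def)
  qed
  define \<F> where "\<F> = {box c d |c d. cbox c d \<subseteq> \<Omega>}"
  \<comment> \<open>A countable subcover is taken so that the exceptional null sets can be
    united.\<close>
  obtain \<F>' where F': "\<F>' \<subseteq> \<F>" "countable \<F>'" "\<Union>\<F>' = \<Union>\<F>"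
    using Lindelof[of \<F>] by (auto simp: \<F>_def)
  have "AE x in lborel. \<forall>B\<in>\<F>'. x \<in> B \<longrightarrow> ?r x = 0"
    using F'(1) AE_box by (subst AE_ball_countable[OF F'(2)]) (auto simp: \<F>_def)
  moreover have "AE x in lborel. x \<notin> \<Omega> \<longrightarrow> ?r x = 0"
    using assms(2) by (simp add: L2_on_def)
  ultimately have "AE x in lborel. ?r x = 0"
  proof eventually_elim
    case (elim x)
    show ?case
    proof (cases "x \<in> \<Omega>")
      case True
      then obtain c d where "cbox c d \<subseteq> \<Omega>" "x \<in> box c d" using open_contains_cbox[OF assms(1)] by metis
      then have "x \<in> \<Union>\<F>" by (auto simp: \<F>_def)
      then show ?thesis using elim F'(3) by (metis UnionE)
    qed (use elim in simp)
  qed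
  then have "abs_l2 ?r = abs_l2 (\<lambda>x. 0)"
    by (simp add: abs_l2_eq_iff sr square_integrable_zero)
  then show ?thesis by (simp add: abs_rep_l2 zero_l2_def)
qed

section \<open>Integration by parts and the Poincare inequality for test functions\<close>

lemma test_function_has_derivative_along_axis:
  assumes "test_function \<Omega> \<phi>"
  shows "((\<lambda>t. \<phi> (x + t *\<^sub>R axis i 1)) has_real_derivative partial_deriv i \<phi> (x + t *\<^sub>R axis i 1)) (at t)"
proof -
  have "((\<lambda>t. x + t *\<^sub>R axis i 1) has_derivative (\<lambda>h. h *\<^sub>R axis i 1)) (at t)"
    by (auto intro!: derivative_eq_intros)
  from has_derivative_compose[OF this
      differentiable_has_derivative[OF test_function_differentiable[OF assms]]]
  have d: "((\<lambda>t. \<phi> (x + t *\<^sub>R axis i 1)) has_derivative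
      (\<lambda>h. frechet_derivative \<phi> (at (x + t *\<^sub>R axis i 1)) (h *\<^sub>R axis i 1))) (at t)" .
  have "linear (frechet_derivative \<phi> (at (x + t *\<^sub>R axis i 1)))"
    by (rule linear_frechet_derivative[OF test_function_differentiable[OF assms]])
  then have "frechet_derivative \<phi> (at (x + t *\<^sub>R axis i 1)) (h *\<^sub>R axis i 1)
      = partial_deriv i \<phi> (x + t *\<^sub>R axis i 1) * h" for h
    by (simp add: partial_deriv_def linear_scale)
  with d show ?thesis by (simp add: has_field_derivative_def)
qed

lemma integral_translate:
  fixes f :: "'a::euclidean_space \<Rightarrow> real"
  assumes "integrable lborel f"
  shows "integrable lborel (\<lambda>x. f (c + x))" "(LINT x|lborel. f (c + x)) = (LINT x|lborel. f x)"
proof -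
  have [measurable]: "f \<in> borel_measurable borel" using assms by (auto dest: borel_measurable_integrable)
  show "(LINT x|lborel. f (c + x)) = (LINT x|lborel. f x)"
    by (subst (2) lborel_distr_plus[of c, symmetric]) (simp add: integral_distr)
  have "integrable (distr lborel borel ((+) c)) f" using assms by (simp add: lborel_distr_plus)
  then show "integrable lborel (\<lambda>x. f (c + x))" by (simp add: integrable_distr_eq)
qed

text \<open>Difference quotients along the axis have integral zero by translation invariance of
  Lebesgue measure, and they converge dominatedly to the partial derivative. This replaces iterated
  integration.\<close>

lemma integral_partial_deriv_eq_0:
  fixes \<phi> :: "real^'n::finite \<Rightarrow> real"
  assumes \<phi>: "test_function \<Omega> \<phi>"
  shows "(LINT x|lborel. partial_deriv i \<phi> x) = 0"
proof -
  let ?e = "axis i 1 :: real^'n"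
  define h where "h = (\<lambda>n. inverse (real (Suc n)))"
  define q where "q = (\<lambda>n x. (\<phi> (h n *\<^sub>R ?e + x) - \<phi> x) / h n)"
  have h: "0 < h n" "h n \<le> 1" for n by (auto simp: h_def field_simps)
  obtain B where B: "\<And>x. \<bar>partial_deriv i \<phi> x\<bar> \<le> B"
    using test_function_bounded[OF test_function_partial_deriv[OF \<phi>]] by metis
  have B0: "0 \<le> B" using B[of 0] by linarith
  obtain R where R: "\<And>x. \<phi> x \<noteq> 0 \<Longrightarrow> norm x \<le> R"
  proof -
    have "bounded (closure {x. \<phi> x \<noteq> 0})" using \<phi> by (auto simp: test_function_def intro: compact_imp_bounded)
    then have "bounded {x. \<phi> x \<noteq> 0}" by (rule bounded_subset) (rule closure_subset)
    then show ?thesis using that unfolding bounded_iff by auto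
  qed
  note int = test_function_integrable[OF \<phi>]
  have [measurable]: "\<phi> \<in> borel_measurable borel" "partial_deriv i \<phi> \<in> borel_measurable borel"
    using int test_function_integrable[OF test_function_partial_deriv[OF \<phi>]]
    by (auto dest: borel_measurable_integrable)
  have q0: "(LINT x|lborel. q n x) = 0" for n
    unfolding q_def using integral_translate[OF int, of "h n *\<^sub>R ?e"] int by simp
  have lim: "(\<lambda>n. q n x) \<longlonglongrightarrow> partial_deriv i \<phi> x" for x
  proof -
    have "((\<lambda>t. (\<phi> (x + t *\<^sub>R ?e) - \<phi> x) / t) \<longlongrightarrow> partial_deriv i \<phi> x) (at 0)"
      using test_function_has_derivative_along_axis[OF \<phi>, of x i 0] by (simp add: has_field_derivative_iff)
    moreover have "filterlim h (at 0) sequentially"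
      unfolding h_def filterlim_at using LIMSEQ_inverse_real_of_nat by auto
    ultimately have "(\<lambda>n. (\<phi> (x + h n *\<^sub>R ?e) - \<phi> x) / h n) \<longlonglongrightarrow> partial_deriv i \<phi> x"
      by (rule filterlim_compose)
    then show ?thesis by (simp add: q_def add.commute)
  qed
  \<comment> \<open>The shifts \<open>h n\<close> are at most 1, so outside the ball of radius
    \<open>R + 1\<close> both terms of the quotient vanish; inside, the mean value theorem supplies
    \<open>B\<close>.\<close>
  have bound: "\<bar>q n x\<bar> \<le> B * indicator (cball 0 (R + 1)) x" for n x
  proof (cases "x \<in> cball 0 (R + 1)")
    case True
    obtain z where "\<phi> (x + h n *\<^sub>R ?e) - \<phi> (x + 0 *\<^sub>R ?e) = (h n - 0) * partial_deriv i \<phi> (x + z *\<^sub>R ?e)"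
      using MVT2[OF h(1)[of n], of "\<lambda>t. \<phi> (x + t *\<^sub>R ?e)" "\<lambda>t. partial_deriv i \<phi> (x + t *\<^sub>R ?e)"]
        test_function_has_derivative_along_axis[OF \<phi>] by metis
    then have "q n x = partial_deriv i \<phi> (x + z *\<^sub>R ?e)"
      using h(1)[of n] by (simp add: q_def add.commute)
    then show ?thesis using B True by simp
  next
    case False
    then have x: "norm x > R + 1" by simp
    have "norm x \<le> norm (h n *\<^sub>R ?e + x) + norm (h n *\<^sub>R ?e)"
      using norm_triangle_ineq4[of "h n *\<^sub>R ?e + x" "h n *\<^sub>R ?e"] by simp
    then have "norm (h n *\<^sub>R ?e + x) > R"
      using x h[of n] by (simp add: norm_axis_1)
    then have "\<phi> (h n *\<^sub>R ?e + x) = 0" "\<phi> x = 0" using R[of "h n *\<^sub>R ?e + x"] R[of x] x by auto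
    then show ?thesis using False by (simp add: q_def)
  qed
  have "(\<lambda>n. LINT x|lborel. q n x) \<longlonglongrightarrow> (LINT x|lborel. partial_deriv i \<phi> x)"
  proof (rule integral_dominated_convergence)
    show "integrable lborel (\<lambda>x. B * indicator (cball 0 (R + 1)) (x::real^'n))"
      by (intro integrable_mult_right integrable_real_indicator)
        (use emeasure_bounded_finite[OF bounded_cball, of 0 "R + 1"] in auto)
    show "q n \<in> borel_measurable lborel" for n unfolding q_def by measurable
  qed (use lim bound in auto)
  then show ?thesis using q0 LIMSEQ_unique[OF _ tendsto_const] by fastforce
qed

text \<open>Integrate \<open>\<partial>\<^sub>i (x\<^sub>i \<phi>\<^sup>2) = \<phi>\<^sup>2 + 2 x\<^sub>i \<phi> \<partial>\<^sub>i \<phi>\<close>.\<close>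

lemma poincare_test_function:
  fixes \<phi> :: "real^'n::finite \<Rightarrow> real"
  assumes \<phi>: "test_function \<Omega> \<phi>" and R: "\<And>x. x \<in> \<Omega> \<Longrightarrow> norm x \<le> R" and R0: "0 \<le> R"
  shows "norm (abs_l2 \<phi>) \<le> 2 * R * norm (abs_l2 (partial_deriv i \<phi>))"
proof (cases "norm (abs_l2 \<phi>) = 0")
  case True
  then show ?thesis using R0 by simp
next
  case False
  let ?d = "partial_deriv i \<phi>"
  let ?x = "\<lambda>x::real^'n. x $ i"
  note t = test_function_mult_left[OF test_function_C_diff[OF \<phi>] \<phi>]
  note d = test_function_partial_deriv[OF \<phi>, of i]
  note xd = test_function_mult_left[OF C_diff_component d, of i]
  have diff: "?x differentiable (at x)" "\<phi> differentiable (at x)" "(\<lambda>x. \<phi> x * \<phi> x) differentiable (at x)" for x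
    using test_function_differentiable[OF \<phi>] test_function_differentiable[OF t]
    by (auto intro: bounded_linear_imp_differentiable bounded_linear_vec_nth)
  have pd: "partial_deriv i (\<lambda>x. x $ i * (\<phi> x * \<phi> x)) = (\<lambda>x. (\<phi> x)\<^sup>2 + 2 * (\<phi> x * (x $ i * ?d x)))"
    by (rule ext) (simp only: partial_deriv_mult diff partial_deriv_component, simp add: power2_eq_square)
  have "0 = (LINT x|lborel. (\<phi> x)\<^sup>2 + 2 * (\<phi> x * (x $ i * ?d x)))"
    using integral_partial_deriv_eq_0[OF test_function_mult_left[OF C_diff_component t], of i i]
    by (simp add: pd)
  also have "\<dots> = (norm (abs_l2 \<phi>))\<^sup>2 + 2 * inner (abs_l2 \<phi>) (abs_l2 (\<lambda>x. x $ i * ?d x))"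
    using square_integrable_test_function[OF \<phi>] square_integrable_test_function[OF xd]
    by (subst Bochner_Integration.integral_add)
      (auto simp: norm_abs_l2 inner_abs_l2 square_integrable_mult square_integrable_def[of \<phi>])
  finally have "(norm (abs_l2 \<phi>))\<^sup>2 \<le> 2 * \<bar>inner (abs_l2 \<phi>) (abs_l2 (\<lambda>x. x $ i * ?d x))\<bar>" by linarith
  also have "\<dots> \<le> 2 * (norm (abs_l2 \<phi>) * norm (abs_l2 (\<lambda>x. x $ i * ?d x)))"
    by (intro mult_left_mono Cauchy_Schwarz_ineq2) auto
  finally have "norm (abs_l2 \<phi>) \<le> 2 * norm (abs_l2 (\<lambda>x. x $ i * ?d x))"
    using False by (simp add: power2_eq_square)
  also have "norm (abs_l2 (\<lambda>x. x $ i * ?d x)) \<le> R * norm (abs_l2 ?d)"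
  proof -
    have "(norm (abs_l2 (\<lambda>x. x $ i * ?d x)))\<^sup>2 = (LINT x|lborel. (x $ i * ?d x)\<^sup>2)"
      by (rule norm_abs_l2[OF square_integrable_test_function[OF xd]])
    also have "\<dots> \<le> (LINT x|lborel. R\<^sup>2 * (?d x)\<^sup>2)"
    proof (rule integral_mono)
      fix x
      have "?d x = 0 \<or> (x $ i)\<^sup>2 \<le> R\<^sup>2"
      proof (cases "x \<in> \<Omega>")
        case True
        then have "\<bar>x $ i\<bar> \<le> R" using R component_le_norm_cart order_trans by blast
        then show ?thesis by (metis abs_ge_zero power2_abs power_mono)
      qed (use test_function_outside[OF d] in blast)
      then show "(x $ i * ?d x)\<^sup>2 \<le> R\<^sup>2 * (?d x)\<^sup>2"
        by (auto simp: power_mult_distrib intro: mult_right_mono)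
    qed (use square_integrable_test_function[OF xd] square_integrable_test_function[OF d]
        in \<open>auto simp: square_integrable_def\<close>)
    also have "\<dots> = (R * norm (abs_l2 ?d))\<^sup>2"
      by (simp add: norm_abs_l2[OF square_integrable_test_function[OF d]] power_mult_distrib)
    finally show ?thesis by (rule power2_le_imp_le) (use R0 in simp)
  qed
  finally show ?thesis by simp
qed

section \<open>Sobolev spaces\<close>

locale bounded_open =
  fixes \<Omega> :: "(real^'n::finite) set"
  assumes open_domain: "open \<Omega>" and bounded_domain: "bounded \<Omega>"
begin

lemma borel_domain: "\<Omega> \<in> sets borel"
  using open_domain by simp

lemmas subspace_L2 = subspace_L2_on[OF borel_domain]
lemmas closed_L2 = closed_L2_on[OF borel_domain]

text \<open>The difference of two candidates lies in \<open>L2_on \<Omega>\<close> and is orthogonal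
  to all test functions. This gives the description in \<open>weak_partial\<close> its
  meaning.\<close>

lemma has_weak_partial_unique:
  assumes "has_weak_partial \<Omega> i u g" "has_weak_partial \<Omega> i u h" shows "g = h"
proof -
  have "g - h = 0"
    using assms subspace_diff[OF subspace_L2]
    by (intro L2_on_eq_0_if_orthogonal_test_functions[OF open_domain])
      (auto simp: has_weak_partial_def inner_diff_left)
  then show ?thesis by simp
qed

lemma weak_partial_eq: "has_weak_partial \<Omega> i u g \<Longrightarrow> weak_partial \<Omega> i u = g"
  unfolding weak_partial_def using has_weak_partial_unique by blast

lemma has_weak_partial_weak_partial:
  "u \<in> H1 \<Omega> \<Longrightarrow> has_weak_partial \<Omega> i u (weak_partial \<Omega> i u)"
  using weak_partial_eq by (fastforce simp: H1_def)

lemma has_weak_partial_linear: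
  assumes "has_weak_partial \<Omega> i u g" "has_weak_partial \<Omega> i w h"
  shows "has_weak_partial \<Omega> i (a *\<^sub>R u + b *\<^sub>R w) (a *\<^sub>R g + b *\<^sub>R h)"
  using assms subspace_L2
  by (auto simp: has_weak_partial_def inner_add_left subspace_add subspace_scale)

lemma weak_partial_linear:
  assumes "u \<in> H1 \<Omega>" "w \<in> H1 \<Omega>"
  shows "weak_partial \<Omega> i (a *\<^sub>R u + b *\<^sub>R w) = a *\<^sub>R weak_partial \<Omega> i u + b *\<^sub>R weak_partial \<Omega> i w"
  using assms by (intro weak_partial_eq has_weak_partial_linear has_weak_partial_weak_partial)

lemma H1_linear: "u \<in> H1 \<Omega> \<Longrightarrow> w \<in> H1 \<Omega> \<Longrightarrow> a *\<^sub>R u + b *\<^sub>R w \<in> H1 \<Omega>"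
  using has_weak_partial_linear[of _ u _ w] subspace_L2
  unfolding H1_def by (auto simp: subspace_add subspace_scale) blast

lemma has_weak_partial_zero: "has_weak_partial \<Omega> i 0 0"
  using subspace_0[OF subspace_L2] by (simp add: has_weak_partial_def)

lemma H10_H1: "u \<in> H10 \<Omega> \<Longrightarrow> u \<in> H1 \<Omega>" by (simp add: H10_def)

lemma H10_L2: "u \<in> H10 \<Omega> \<Longrightarrow> u \<in> L2_on \<Omega>" by (simp add: H10_def H1_def)

lemma H10_zero: "0 \<in> H10 \<Omega>"
proof -
  have "partial_deriv i (\<lambda>x::real^'n. 0) = (\<lambda>x. 0)" for i
    by (rule ext, subst partial_deriv_eq[OF has_derivative_const]) simp
  moreover have "0 \<in> H1 \<Omega>"
    using has_weak_partial_zero subspace_0[OF subspace_L2] by (auto simp: H1_def)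
  ultimately show ?thesis
    using weak_partial_eq[OF has_weak_partial_zero]
    by (auto simp: H10_def zero_l2_def[symmetric] test_function_zero intro!: exI[of _ "\<lambda>n x. 0"])
qed

lemma H10_approx:
  assumes "u \<in> H10 \<Omega>"
  obtains \<phi> where "\<And>n. test_function \<Omega> (\<phi> n)" "(\<lambda>n. abs_l2 (\<phi> n)) \<longlonglongrightarrow> u"
    "\<And>i. (\<lambda>n. abs_l2 (partial_deriv i (\<phi> n))) \<longlonglongrightarrow> weak_partial \<Omega> i u"
  using assms by (auto simp: H10_def)

lemma H10_linear:
  assumes u: "u \<in> H10 \<Omega>" and w: "w \<in> H10 \<Omega>" shows "a *\<^sub>R u + b *\<^sub>R w \<in> H10 \<Omega>"
proof -
  obtain \<phi> where \<phi>: "\<And>n. test_function \<Omega> (\<phi> n)" "(\<lambda>n. abs_l2 (\<phi> n)) \<longlonglongrightarrow> u"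
    "\<And>i. (\<lambda>n. abs_l2 (partial_deriv i (\<phi> n))) \<longlonglongrightarrow> weak_partial \<Omega> i u"
    using H10_approx[OF u] by blast
  obtain \<psi> where \<psi>: "\<And>n. test_function \<Omega> (\<psi> n)" "(\<lambda>n. abs_l2 (\<psi> n)) \<longlonglongrightarrow> w"
    "\<And>i. (\<lambda>n. abs_l2 (partial_deriv i (\<psi> n))) \<longlonglongrightarrow> weak_partial \<Omega> i w"
    using H10_approx[OF w] by blast
  define \<theta> where "\<theta> = (\<lambda>n x. a * \<phi> n x + b * \<psi> n x)"
  note t\<phi> = test_function_mult_left[OF C_diff_const \<phi>(1), of a]
  note t\<psi> = test_function_mult_left[OF C_diff_const \<psi>(1), of b]
  have t: "test_function \<Omega> (\<theta> n)" for n
    unfolding \<theta>_def by (intro test_function_add t\<phi> t\<psi>)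
  have abs\<theta>: "abs_l2 (\<theta> n) = a *\<^sub>R abs_l2 (\<phi> n) + b *\<^sub>R abs_l2 (\<psi> n)" for n
    using square_integrable_test_function[OF \<phi>(1)] square_integrable_test_function[OF \<psi>(1)]
    by (simp add: \<theta>_def abs_l2_scaleR abs_l2_add square_integrable_scale)
  have abs\<theta>': "abs_l2 (partial_deriv i (\<theta> n))
      = a *\<^sub>R abs_l2 (partial_deriv i (\<phi> n)) + b *\<^sub>R abs_l2 (partial_deriv i (\<psi> n))" for i n
  proof -
    have c: "(\<lambda>x::real^'n. c) differentiable (at x)" "partial_deriv i (\<lambda>x::real^'n. c) x = 0" for c :: real and x
      by (auto simp: partial_deriv_eq[OF has_derivative_const])
    have "partial_deriv i (\<theta> n) = (\<lambda>x. a * partial_deriv i (\<phi> n) x + b * partial_deriv i (\<psi> n) x)"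
      unfolding \<theta>_def using t\<phi>[of n] t\<psi>[of n] \<phi>(1)[of n] \<psi>(1)[of n]
      by (intro ext) (simp add: partial_deriv_add partial_deriv_mult c test_function_differentiable)
    then show ?thesis
      using square_integrable_test_function[OF test_function_partial_deriv[OF \<phi>(1)]]
        square_integrable_test_function[OF test_function_partial_deriv[OF \<psi>(1)]]
      by (simp add: abs_l2_scaleR abs_l2_add square_integrable_scale)
  qed
  have "(\<lambda>n. abs_l2 (\<theta> n)) \<longlonglongrightarrow> a *\<^sub>R u + b *\<^sub>R w"
    unfolding abs\<theta> by (intro tendsto_intros \<phi> \<psi>)
  moreover have "(\<lambda>n. abs_l2 (partial_deriv i (\<theta> n))) \<longlonglongrightarrow> weak_partial \<Omega> i (a *\<^sub>R u + b *\<^sub>R w)" for i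
    unfolding abs\<theta>' weak_partial_linear[OF H10_H1[OF u] H10_H1[OF w]] by (intro tendsto_intros \<phi> \<psi>)
  ultimately show ?thesis
    using t H1_linear[OF H10_H1[OF u] H10_H1[OF w]] by (auto simp: H10_def)
qed

lemma subspace_H10: "subspace (H10 \<Omega>)"
  unfolding subspace_def using H10_zero H10_linear[where a=1 and b=1] H10_linear[where b=0] by fastforce

lemma grad_linear:
  assumes "u \<in> H1 \<Omega>" "w \<in> H1 \<Omega>"
  shows "grad \<Omega> (a *\<^sub>R u + b *\<^sub>R w) = a *\<^sub>R grad \<Omega> u + b *\<^sub>R grad \<Omega> w"
  by (simp add: grad_def vec_eq_iff weak_partial_linear[OF assms])

lemma poincare_aux:
  "\<exists>C>0. \<forall>u\<in>H10 \<Omega>. norm u \<le> C * norm (grad \<Omega> u)"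
proof -
  obtain R where R: "R > 0" "\<And>x. x \<in> \<Omega> \<Longrightarrow> norm x \<le> R"
    using bounded_domain unfolding bounded_pos by blast
  have "norm u \<le> 2 * R * norm (grad \<Omega> u)" if u: "u \<in> H10 \<Omega>" for u
  proof -
    \<comment> \<open>Any one coordinate direction suffices, because a single partial derivative
      already bounds the function; index types are nonempty.\<close>
    fix i :: 'n
    obtain \<phi> where \<phi>: "\<And>n. test_function \<Omega> (\<phi> n)" "(\<lambda>n. abs_l2 (\<phi> n)) \<longlonglongrightarrow> u"
      "\<And>i. (\<lambda>n. abs_l2 (partial_deriv i (\<phi> n))) \<longlonglongrightarrow> weak_partial \<Omega> i u"
      using H10_approx[OF u] by blast
    have "norm u \<le> 2 * R * norm (weak_partial \<Omega> i u)"
      by (rule LIMSEQ_le[OF tendsto_norm[OF \<phi>(2)] tendsto_mult_left[OF tendsto_norm[OF \<phi>(3)]]])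
        (use poincare_test_function[OF \<phi>(1) R(2)] R(1) in auto)
    also have "\<dots> \<le> 2 * R * norm (grad \<Omega> u)"
      using Finite_Cartesian_Product.norm_nth_le[of "grad \<Omega> u" i] R(1) by (intro mult_left_mono) (auto simp: grad_def)
    finally show ?thesis .
  qed
  then show ?thesis using R(1) by (intro exI[of _ "2 * R"]) auto
qed

text \<open>The gradient on \<open>H10\<close> is a closed operator: both sides of the identity
  defining a weak derivative are continuous in L2. Approximating test functions for the limit come
  from a diagonal choice, with error below 1/(n+1) against \<open>u n\<close> and its partial
  derivatives.\<close>

lemma H10_tendsto:
  assumes u: "\<And>n. u n \<in> H10 \<Omega>" and lim: "u \<longlonglongrightarrow> w" and g: "(\<lambda>n. grad \<Omega> (u n)) \<longlonglongrightarrow> g"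
  shows "w \<in> H10 \<Omega>" "grad \<Omega> w = g"
proof -
  have gi: "(\<lambda>n. weak_partial \<Omega> i (u n)) \<longlonglongrightarrow> g $ i" for i
    using tendsto_vec_nth[OF g, of i] by (simp add: grad_def)
  have wp: "has_weak_partial \<Omega> i (u n) (weak_partial \<Omega> i (u n))" for i n
    using has_weak_partial_weak_partial H10_H1 u by blast
  have wg: "has_weak_partial \<Omega> i w (g $ i)" for i
    unfolding has_weak_partial_def
  proof (intro conjI allI impI)
    show "g $ i \<in> L2_on \<Omega>"
      by (rule closed_sequentially[OF closed_L2 _ gi]) (use wp in \<open>auto simp: has_weak_partial_def\<close>)
    fix \<phi> assume \<phi>: "test_function \<Omega> \<phi>"
    have "(\<lambda>n. inner (u n) (abs_l2 (partial_deriv i \<phi>))) \<longlonglongrightarrow> inner w (abs_l2 (partial_deriv i \<phi>))"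
      by (intro tendsto_intros lim)
    moreover have "(\<lambda>n. - inner (weak_partial \<Omega> i (u n)) (abs_l2 \<phi>)) \<longlonglongrightarrow> - inner (g $ i) (abs_l2 \<phi>)"
      by (intro tendsto_intros gi)
    moreover have "inner (u n) (abs_l2 (partial_deriv i \<phi>)) = - inner (weak_partial \<Omega> i (u n)) (abs_l2 \<phi>)" for n
      using wp \<phi> by (auto simp: has_weak_partial_def)
    ultimately show "inner w (abs_l2 (partial_deriv i \<phi>)) = - inner (g $ i) (abs_l2 \<phi>)"
      using LIMSEQ_unique by auto
  qed
  have wpw: "weak_partial \<Omega> i w = g $ i" for i using wg by (rule weak_partial_eq)
  then show "grad \<Omega> w = g" by (simp add: grad_def vec_eq_iff)
  have "w \<in> L2_on \<Omega>" by (rule closed_sequentially[OF closed_L2 _ lim]) (use u H10_L2 in blast)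
  then have "w \<in> H1 \<Omega>" using wg by (auto simp: H1_def)
  have "\<exists>\<phi>. test_function \<Omega> \<phi> \<and> norm (abs_l2 \<phi> - u n) < inverse (real (Suc n)) \<and>
      (\<forall>i. norm (abs_l2 (partial_deriv i \<phi>) - weak_partial \<Omega> i (u n)) < inverse (real (Suc n)))" for n
  proof -
    obtain \<phi> where \<phi>: "\<And>m. test_function \<Omega> (\<phi> m)" "(\<lambda>m. abs_l2 (\<phi> m)) \<longlonglongrightarrow> u n"
      "\<And>i. (\<lambda>m. abs_l2 (partial_deriv i (\<phi> m))) \<longlonglongrightarrow> weak_partial \<Omega> i (u n)"
      using H10_approx[OF u] by blast
    let ?e = "inverse (real (Suc n))"
    have e: "0 < ?e" by simp
    have "eventually (\<lambda>m. norm (abs_l2 (\<phi> m) - u n) < ?e \<and>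
      (\<forall>i\<in>UNIV. norm (abs_l2 (partial_deriv i (\<phi> m)) - weak_partial \<Omega> i (u n)) < ?e)) sequentially"
      using tendstoD[OF \<phi>(2) e] tendstoD[OF \<phi>(3) e]
      by (intro eventually_conj eventually_ball_finite) (auto simp: dist_norm)
    then obtain m where "norm (abs_l2 (\<phi> m) - u n) < ?e \<and>
      (\<forall>i\<in>UNIV. norm (abs_l2 (partial_deriv i (\<phi> m)) - weak_partial \<Omega> i (u n)) < ?e)"
      using eventually_happens'[OF sequentially_bot] by blast
    then show ?thesis using \<phi>(1) by blast
  qed
  then obtain \<phi> where \<phi>: "\<And>n. test_function \<Omega> (\<phi> n)"
    "\<And>n. norm (abs_l2 (\<phi> n) - u n) < inverse (real (Suc n))"
    "\<And>n i. norm (abs_l2 (partial_deriv i (\<phi> n)) - weak_partial \<Omega> i (u n)) < inverse (real (Suc n))"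
    by metis
  have "(\<lambda>n. abs_l2 (\<phi> n) - u n) \<longlonglongrightarrow> 0"
    by (rule Lim_null_comparison[OF always_eventually LIMSEQ_inverse_real_of_nat])
      (intro allI less_imp_le \<phi>(2))
  from tendsto_add[OF this lim] have l: "(\<lambda>n. abs_l2 (\<phi> n)) \<longlonglongrightarrow> w" by simp
  have "(\<lambda>n. abs_l2 (partial_deriv i (\<phi> n)) - weak_partial \<Omega> i (u n)) \<longlonglongrightarrow> 0" for i
    by (rule Lim_null_comparison[OF always_eventually LIMSEQ_inverse_real_of_nat])
      (intro allI less_imp_le \<phi>(3))
  then have "(\<lambda>n. abs_l2 (partial_deriv i (\<phi> n))) \<longlonglongrightarrow> weak_partial \<Omega> i w" for i
    using tendsto_add[OF _ gi[of i], of "\<lambda>n. abs_l2 (partial_deriv i (\<phi> n)) - weak_partial \<Omega> i (u n)" 0]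
    by (simp add: wpw)
  with l \<phi>(1) \<open>w \<in> H1 \<Omega>\<close> show "w \<in> H10 \<Omega>" by (auto simp: H10_def)
qed

text \<open>For test functions this is the definition of the second weak derivatives, and both sides
  are continuous in \<open>w\<close> for the H1 norm. No boundary term appears because
  \<open>w\<close> is a limit of test functions.\<close>

lemma inner_laplacian:
  assumes u: "u \<in> H2 \<Omega>" and w: "w \<in> H10 \<Omega>"
  shows "inner (laplacian \<Omega> u) w = - inner (grad \<Omega> u) (grad \<Omega> w)"
proof -
  obtain \<phi> where \<phi>: "\<And>n. test_function \<Omega> (\<phi> n)" "(\<lambda>n. abs_l2 (\<phi> n)) \<longlonglongrightarrow> w"
    "\<And>i. (\<lambda>n. abs_l2 (partial_deriv i (\<phi> n))) \<longlonglongrightarrow> weak_partial \<Omega> i w"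
    using H10_approx[OF w] by blast
  have *: "inner (weak_partial \<Omega> i u) (weak_partial \<Omega> i w)
      = - inner (weak_partial \<Omega> i (weak_partial \<Omega> i u)) w" for i
  proof -
    have "has_weak_partial \<Omega> i (weak_partial \<Omega> i u) (weak_partial \<Omega> i (weak_partial \<Omega> i u))"
      using u by (intro has_weak_partial_weak_partial) (simp add: H2_def)
    then have "inner (weak_partial \<Omega> i u) (abs_l2 (partial_deriv i (\<phi> n)))
        = - inner (weak_partial \<Omega> i (weak_partial \<Omega> i u)) (abs_l2 (\<phi> n))" for n
      using \<phi>(1) by (auto simp: has_weak_partial_def)
    moreover have "(\<lambda>n. inner (weak_partial \<Omega> i u) (abs_l2 (partial_deriv i (\<phi> n))))
        \<longlonglongrightarrow> inner (weak_partial \<Omega> i u) (weak_partial \<Omega> i w)"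
      by (intro tendsto_intros \<phi>)
    moreover have "(\<lambda>n. - inner (weak_partial \<Omega> i (weak_partial \<Omega> i u)) (abs_l2 (\<phi> n)))
        \<longlonglongrightarrow> - inner (weak_partial \<Omega> i (weak_partial \<Omega> i u)) w"
      by (intro tendsto_intros \<phi>)
    ultimately show ?thesis using LIMSEQ_unique by auto
  qed
  show ?thesis
    by (simp add: laplacian_def grad_def inner_vec_def inner_sum_left * sum_negf)
qed

end

section \<open>The energy embedding and its closed image\<close>

locale energy = bounded_open \<Omega> for \<Omega> :: "(real^'n::finite) set" +
  fixes \<kappa> :: real
  assumes kappa_pos: "\<kappa> > 0"
begin

abbreviation "E1 \<equiv> H10_emb \<kappa> \<Omega>"
abbreviation "E \<equiv> energy_emb \<kappa> \<Omega>"
abbreviation "X \<equiv> energy_space \<Omega>"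

lemma poincare_ex: "\<exists>C>0. \<forall>u\<in>H10 \<Omega>. norm u \<le> C * norm (E1 u)"
proof -
  obtain C where C: "C > 0" "\<And>u. u \<in> H10 \<Omega> \<Longrightarrow> norm u \<le> C * norm (grad \<Omega> u)"
    using poincare_aux by blast
  then show ?thesis using kappa_pos
    by (intro exI[of _ "C / sqrt \<kappa>"]) (auto simp: H10_emb_def field_simps)
qed

text \<open>A fixed Poincare constant for the energy norm, which makes explicit error constants
  available later.\<close>

definition CP :: real where
  "CP = (SOME C. C > 0 \<and> (\<forall>u\<in>H10 \<Omega>. norm u \<le> C * norm (E1 u)))"

lemma CP_pos: "CP > 0" and poincare: "u \<in> H10 \<Omega> \<Longrightarrow> norm u \<le> CP * norm (E1 u)"
  using someI_ex[OF poincare_ex[unfolded Bex_def]] unfolding CP_def by blast+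

lemma E1_linear: "u \<in> H10 \<Omega> \<Longrightarrow> w \<in> H10 \<Omega> \<Longrightarrow> E1 (a *\<^sub>R u + b *\<^sub>R w) = a *\<^sub>R E1 u + b *\<^sub>R E1 w"
  by (simp add: H10_emb_def grad_linear H10_H1 scaleR_add_right mult.commute)

lemma E1_diff: "u \<in> H10 \<Omega> \<Longrightarrow> w \<in> H10 \<Omega> \<Longrightarrow> E1 (u - w) = E1 u - E1 w"
  using E1_linear[of u w 1 "-1"] by simp

lemma E1_scaleR: "u \<in> H10 \<Omega> \<Longrightarrow> E1 (a *\<^sub>R u) = a *\<^sub>R E1 u"
  using E1_linear[of u u a 0] by simp

lemma E1_zero: "E1 0 = 0" using E1_scaleR[OF H10_zero, of 0] by simp

text \<open>By the Poincare inequality a function in \<open>H10\<close> with zero gradient is zero.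
  Injectivity makes energy-valued integrals unique and allows the semigroup to be conjugated to the
  image.\<close>

lemma inj_on_E1: "inj_on E1 (H10 \<Omega>)"
proof (rule inj_onI)
  fix u w assume uw: "u \<in> H10 \<Omega>" "w \<in> H10 \<Omega>" "E1 u = E1 w"
  then have "norm (u - w) \<le> CP * norm (E1 (u - w))" by (intro poincare subspace_diff[OF subspace_H10])
  then show "u = w" using uw by (simp add: E1_diff)
qed

text \<open>The Poincare inequality turns convergence of the gradients into the Cauchy property of
  \<open>u\<close> itself; completeness of L2 gives a limit, and closedness of the gradient
  identifies its image.\<close>

lemma H10_E1_tendsto:
  assumes "\<And>n. u n \<in> H10 \<Omega>" "(\<lambda>n. E1 (u n)) \<longlonglongrightarrow> y"
  obtains w where "w \<in> H10 \<Omega>" "E1 w = y" "u \<longlonglongrightarrow> w"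
proof -
  have "Cauchy u"
  proof (rule CauchyI)
    fix e :: real assume "e > 0"
    then have "e / CP > 0" using CP_pos by simp
    moreover have "Cauchy (\<lambda>n. E1 (u n))" using assms(2) by (rule LIMSEQ_imp_Cauchy)
    ultimately obtain M where M: "\<forall>m\<ge>M. \<forall>n\<ge>M. norm (E1 (u m) - E1 (u n)) < e / CP"
      using CauchyD by blast
    have "norm (u m - u n) < e" if "m \<ge> M" "n \<ge> M" for m n
    proof -
      have "norm (u m - u n) \<le> CP * norm (E1 (u m - u n))"
        by (intro poincare subspace_diff[OF subspace_H10] assms(1))
      also have "\<dots> = CP * norm (E1 (u m) - E1 (u n))" by (simp add: E1_diff assms(1))
      also have "\<dots> < CP * (e / CP)" using M that CP_pos by (intro mult_strict_left_mono) auto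
      finally show ?thesis using CP_pos by simp
    qed
    then show "\<exists>M. \<forall>m\<ge>M. \<forall>n\<ge>M. norm (u m - u n) < e" by blast
  qed
  then obtain w where w: "u \<longlonglongrightarrow> w" using Cauchy_convergent convergent_def by blast
  have "(\<lambda>n. grad \<Omega> (u n)) \<longlonglongrightarrow> (1 / sqrt \<kappa>) *\<^sub>R y"
    using tendsto_scaleR[OF tendsto_const assms(2), of "1 / sqrt \<kappa>"] kappa_pos by (simp add: H10_emb_def)
  from H10_tendsto[OF assms(1) w this] have "w \<in> H10 \<Omega>" "E1 w = y"
    using kappa_pos by (auto simp: H10_emb_def)
  then show ?thesis using w that by blast
qed

lemma E_linear: "x \<in> X \<Longrightarrow> y \<in> X \<Longrightarrow> E (a *\<^sub>R x + b *\<^sub>R y) = a *\<^sub>R E x + b *\<^sub>R E y"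
  by (auto simp: energy_emb_def energy_space_def E1_linear)

lemma subspace_X: "subspace X"
  unfolding energy_space_def by (rule subspace_Times[OF subspace_H10 subspace_L2])

lemma E_diff: "x \<in> X \<Longrightarrow> y \<in> X \<Longrightarrow> E (x - y) = E x - E y"
  using E_linear[of x y 1 "-1"] by simp

lemma E_add: "x \<in> X \<Longrightarrow> y \<in> X \<Longrightarrow> E (x + y) = E x + E y"
  using E_linear[of x y 1 1] by simp

lemma E_scaleR: "x \<in> X \<Longrightarrow> E (a *\<^sub>R x) = a *\<^sub>R E x"
  using E_linear[of x x a 0] by simp

lemma inj_on_E: "inj_on E X"
  using inj_on_E1 by (auto simp: inj_on_def energy_emb_def energy_space_def)

lemma subspace_E: "subspace (E ` X)"
  unfolding subspace_def
proof (intro conjI ballI allI)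
  show "0 \<in> E ` X"
    using E_scaleR[OF subspace_0[OF subspace_X], of 0] subspace_0[OF subspace_X]
    by (metis imageI scaleR_zero_left)
  fix y c assume "y \<in> E ` X"
  then obtain y' where y: "y' \<in> X" "y = E y'" by blast
  show "c *\<^sub>R y \<in> E ` X"
    using y E_scaleR subspace_scale[OF subspace_X] by (metis imageI)
  fix x assume "x \<in> E ` X"
  then obtain x' where "x' \<in> X" "x = E x'" by blast
  then show "x + y \<in> E ` X"
    using y E_add subspace_add[OF subspace_X] by (metis imageI)
qed

lemma closed_E: "closed (E ` X)"
  unfolding closed_sequential_limits
proof (intro allI impI, elim conjE)
  fix s :: "nat \<Rightarrow> _" and l assume s: "\<forall>n. s n \<in> E ` X" and lim: "s \<longlonglongrightarrow> l"
  from s have "\<forall>n. \<exists>x. x \<in> X \<and> s n = E x" by blast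
  then obtain x where x: "\<And>n. x n \<in> X" "\<And>n. s n = E (x n)" by metis
  have x1: "fst (x n) \<in> H10 \<Omega>" and x2: "snd (x n) \<in> L2_on \<Omega>" for n
    using x(1)[of n] by (auto simp: energy_space_def mem_Times_iff)
  have l1: "(\<lambda>n. E1 (fst (x n))) \<longlonglongrightarrow> fst l" and l2: "(\<lambda>n. snd (x n)) \<longlonglongrightarrow> snd l"
    using tendsto_fst[OF lim] tendsto_snd[OF lim] by (simp_all add: x(2) energy_emb_def)
  obtain w where w: "w \<in> H10 \<Omega>" "E1 w = fst l"
    using H10_E1_tendsto[OF x1 l1] by blast
  have "snd l \<in> L2_on \<Omega>" by (rule closed_sequentially[OF closed_L2 x2 l2])
  then have "(w, snd l) \<in> X" "E (w, snd l) = l" using w by (auto simp: energy_space_def energy_emb_def)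
  then show "l \<in> E ` X" by (metis imageI)
qed

end

section \<open>Integrals in closed subspaces\<close>

text \<open>Tags lie in the interval of integration, so every Riemann sum is a linear combination of
  values in \<open>S\<close>, and the integral is a limit of such sums.\<close>

lemma has_integral_in_closed_subspace:
  fixes f :: "real \<Rightarrow> 'b::real_normed_vector"
  assumes "closed S" "subspace S" and f: "\<And>x. x \<in> {a..b} \<Longrightarrow> f x \<in> S"
    and y: "(f has_integral y) {a..b}"
  shows "y \<in> S"
proof -
  have "\<exists>z\<in>S. dist z y < e" if "e > 0" for e
  proof -
    obtain g where g: "gauge g" "\<And>\<D>. \<D> tagged_division_of {a..b} \<Longrightarrow> g fine \<D> \<Longrightarrow>
        norm (sum (\<lambda>(x,k). measure lborel k *\<^sub>R f x) \<D> - y) < e"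
      using y[unfolded has_integral_real, rule_format, OF \<open>e > 0\<close>] by auto
    obtain \<D> where \<D>: "\<D> tagged_division_of {a..b}" "g fine \<D>"
      using fine_division_exists_real[OF g(1)] by blast
    have fS: "f x \<in> S" if "(x, k) \<in> \<D>" for x k
      using tagged_division_ofD(2,3)[OF \<D>(1) that] by (intro f) auto
    have "sum (\<lambda>(x,k). measure lborel k *\<^sub>R f x) \<D> \<in> S"
      using fS assms(2) by (intro subspace_sum) (auto intro!: subspace_scale)
    then show ?thesis using g(2)[OF \<D>] by (auto simp: dist_norm)
  qed
  then show ?thesis using closed_approachable[OF assms(1), of y] by blast
qed

text \<open>\<open>L\<close> is linear only on \<open>S\<close>, so the exchange with the integral
  is made on Riemann sums, which stay in \<open>S\<close>. As \<open>L\<close> does not increase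
  norms, the gauge that serves \<open>f\<close> for a given error serves the image as well.\<close>

lemma has_integral_contraction_on_subspace:
  fixes f :: "real \<Rightarrow> 'b::real_normed_vector"
  assumes S: "closed S" "subspace S"
    and lin: "\<And>x y a b. x \<in> S \<Longrightarrow> y \<in> S \<Longrightarrow> L (a *\<^sub>R x + b *\<^sub>R y) = a *\<^sub>R L x + b *\<^sub>R L y"
    and contr: "\<And>x. x \<in> S \<Longrightarrow> norm (L x) \<le> norm x"
    and f: "\<And>x. x \<in> {a..b} \<Longrightarrow> f x \<in> S" and y: "(f has_integral y) {a..b}"
  shows "((\<lambda>x. L (f x)) has_integral (L y :: 'b)) {a..b}"
  unfolding has_integral_real
proof (intro allI impI)
  fix e :: real assume "e > 0"
  obtain g where g: "gauge g" "\<And>\<D>. \<D> tagged_division_of {a..b} \<Longrightarrow> g fine \<D> \<Longrightarrow>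
      norm (sum (\<lambda>(x,k). measure lborel k *\<^sub>R f x) \<D> - y) < e"
    using y[unfolded has_integral_real, rule_format, OF \<open>e > 0\<close>] by auto
  have yS: "y \<in> S" by (rule has_integral_in_closed_subspace[OF S f y])
  have L0: "L 0 = 0" using lin[of 0 0 0 0] subspace_0[OF S(2)] by simp
  have sum: "(\<Sum>i\<in>A. c i *\<^sub>R h i) \<in> S \<and> L (\<Sum>i\<in>A. c i *\<^sub>R h i) = (\<Sum>i\<in>A. c i *\<^sub>R L (h i))"
    if "finite A" "\<And>i. i \<in> A \<Longrightarrow> h i \<in> S"
    for A :: "(real \<times> real set) set" and c :: "_ \<Rightarrow> real" and h
    using that
  proof (induction A rule: finite_induct)
    case (insert i A)
    then have "L (c i *\<^sub>R h i + 1 *\<^sub>R (\<Sum>i\<in>A. c i *\<^sub>R h i)) = c i *\<^sub>R L (h i) + 1 *\<^sub>R L (\<Sum>i\<in>A. c i *\<^sub>R h i)"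
      by (intro lin) auto
    with insert S(2) show ?case by (auto simp: subspace_add subspace_scale)
  qed (use L0 subspace_0[OF S(2)] in simp)
  have "norm (sum (\<lambda>(x,k). measure lborel k *\<^sub>R L (f x)) \<D> - L y) < e"
    if \<D>: "\<D> tagged_division_of {a..b}" "g fine \<D>" for \<D>
  proof -
    have fS: "f (fst i) \<in> S" if "i \<in> \<D>" for i
      using that tagged_division_ofD(2,3)[OF \<D>(1), of "fst i" "snd i"] by (intro f) auto
    note * = sum[of \<D> "\<lambda>i. f (fst i)" "\<lambda>i. measure lborel (snd i)", OF _ fS]
    have fin: "finite \<D>" using \<D>(1) by auto
    let ?s = "\<Sum>i\<in>\<D>. measure lborel (snd i) *\<^sub>R f (fst i)"
    have "L (1 *\<^sub>R ?s + (-1) *\<^sub>R y) = 1 *\<^sub>R L ?s + (-1) *\<^sub>R L y"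
      using * fin yS by (intro lin) auto
    moreover have "?s - y \<in> S" using * fin yS subspace_diff[OF S(2)] by auto
    ultimately have "norm (L ?s - L y) \<le> norm (?s - y)" using contr[of "?s - y"] by simp
    also have "\<dots> < e" using g(2)[OF \<D>] by (simp add: case_prod_beta)
    finally show ?thesis using * fin by (simp add: case_prod_beta)
  qed
  then show "\<exists>g. gauge g \<and> (\<forall>\<D>. \<D> tagged_division_of {a..b} \<and> g fine \<D> \<longrightarrow>
      norm (sum (\<lambda>(x,k). measure lborel k *\<^sub>R L (f x)) \<D> - L y) < e)"
    using g(1) by blast
qed

lemma norm_integral_minus_const_le:
  fixes f :: "real \<Rightarrow> 'b::banach"
  assumes "a \<le> b" "continuous_on {a..b} f" "\<And>s. s \<in> {a..b} \<Longrightarrow> norm (f s - c) \<le> e"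
  shows "norm (integral {a..b} f - (b - a) *\<^sub>R c) \<le> e * (b - a)"
proof -
  have "integral {a..b} (\<lambda>s. f s - c) = integral {a..b} f - (b - a) *\<^sub>R c"
    using assms by (subst Henstock_Kurzweil_Integration.integral_diff) (auto intro: integrable_continuous_real)
  then show ?thesis
    using integral_bound[OF assms(1) continuous_on_diff[OF assms(2) continuous_on_const] assms(3)] by simp
qed

lemma integral_average_tendsto:
  fixes f :: "real \<Rightarrow> 'b::banach"
  assumes "a < b" "continuous_on {a..b} f"
  shows "((\<lambda>k. (1 / k) *\<^sub>R integral {a..a + k} f) \<longlongrightarrow> f a) (at_right 0)"
proof (rule tendstoI)
  fix e :: real assume "e > 0"
  then have "e / 2 > 0" by simp
  then obtain d where d: "d > 0" "\<And>s. s \<in> {a..b} \<Longrightarrow> dist s a < d \<Longrightarrow> dist (f s) (f a) < e / 2"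
    using assms unfolding continuous_on_iff by (metis atLeastAtMost_iff less_imp_le order_refl)
  have "dist ((1 / k) *\<^sub>R integral {a..a + k} f) (f a) < e" if "0 < k" "k < min d (b - a)" for k
  proof -
    have "norm (integral {a..a + k} f - (a + k - a) *\<^sub>R f a) \<le> e / 2 * (a + k - a)"
    proof (rule norm_integral_minus_const_le)
      show "continuous_on {a..a + k} f" using assms(2) that by (auto intro: continuous_on_subset)
      fix s assume "s \<in> {a..a + k}"
      then show "norm (f s - f a) \<le> e / 2"
        using d(2)[of s] that by (auto simp: dist_norm intro: less_imp_le)
    qed (use that in simp)
    then have "norm (integral {a..a + k} f - k *\<^sub>R f a) \<le> e / 2 * k" by simp
    moreover have "norm ((1 / k) *\<^sub>R integral {a..a + k} f - f a) = norm (integral {a..a + k} f - k *\<^sub>R f a) / k"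
    proof -
      have "(1 / k) *\<^sub>R integral {a..a + k} f - f a = (1 / k) *\<^sub>R (integral {a..a + k} f - k *\<^sub>R f a)"
        using that by (simp add: scaleR_diff_right)
      then show ?thesis using that by simp
    qed
    ultimately have "norm ((1 / k) *\<^sub>R integral {a..a + k} f - f a) \<le> e / 2"
      using that by (simp add: pos_divide_le_eq)
    then show ?thesis using \<open>e > 0\<close> by (simp add: dist_norm)
  qed
  then show "eventually (\<lambda>k. dist ((1 / k) *\<^sub>R integral {a..a + k} f) (f a) < e) (at_right 0)"
    using d(1) assms(1) by (intro eventually_at_rightI[of 0 "min d (b - a)"]) auto
qed

section \<open>Contraction semigroups on a closed subspace of a Banach space\<close>

text \<open>The operators are constrained on \<open>S\<close> only, since the wave semigroup, once
  transported, is meaningful only on the image of the energy embedding; the surrounding Banach space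
  is where its integrals are formed.\<close>

locale subspace_semigroup =
  fixes S :: "'b::banach set" and P :: "real \<Rightarrow> 'b \<Rightarrow> 'b"
  assumes closed_S: "closed S" and subspace_S: "subspace S"
    and P_in: "0 \<le> t \<Longrightarrow> x \<in> S \<Longrightarrow> P t x \<in> S"
    and P_linear: "0 \<le> t \<Longrightarrow> x \<in> S \<Longrightarrow> y \<in> S \<Longrightarrow> P t (a *\<^sub>R x + b *\<^sub>R y) = a *\<^sub>R P t x + b *\<^sub>R P t y"
    and P_0: "x \<in> S \<Longrightarrow> P 0 x = x"
    and P_add: "0 \<le> s \<Longrightarrow> 0 \<le> t \<Longrightarrow> x \<in> S \<Longrightarrow> P (s + t) x = P s (P t x)"
    and P_contraction: "0 \<le> t \<Longrightarrow> x \<in> S \<Longrightarrow> norm (P t x) \<le> norm x"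
    and P_continuous: "x \<in> S \<Longrightarrow> continuous_on {0..} (\<lambda>t. P t x)"
begin

lemma P_diff: "0 \<le> t \<Longrightarrow> x \<in> S \<Longrightarrow> y \<in> S \<Longrightarrow> P t (x - y) = P t x - P t y"
  using P_linear[of t x y 1 "-1"] by simp

lemma P_plus: "0 \<le> t \<Longrightarrow> x \<in> S \<Longrightarrow> y \<in> S \<Longrightarrow> P t (x + y) = P t x + P t y"
  using P_linear[of t x y 1 1] by simp

lemma norm_P_diff_le: "0 \<le> t \<Longrightarrow> x \<in> S \<Longrightarrow> y \<in> S \<Longrightarrow> norm (P t x - P t y) \<le> norm (x - y)"
  using P_contraction[of t "x - y"] subspace_diff[OF subspace_S] by (simp add: P_diff)

text \<open>Strong continuity handles the time argument with \<open>f s0\<close> frozen;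
  contractivity, uniform in time, handles the error of replacing \<open>f s\<close> by
  \<open>f s0\<close>.\<close>

lemma continuous_on_P_compose:
  fixes J :: "'c::topological_space set"
  assumes r: "continuous_on J r" "\<And>s. s \<in> J \<Longrightarrow> 0 \<le> r s"
    and f: "continuous_on J f" "\<And>s. s \<in> J \<Longrightarrow> f s \<in> S"
  shows "continuous_on J (\<lambda>s. P (r s) (f s))"
  unfolding continuous_on_def
proof
  fix s0 assume s0: "s0 \<in> J"
  have "((\<lambda>s. norm (f s - f s0)) \<longlongrightarrow> norm (f s0 - f s0)) (at s0 within J)"
    using f(1) s0 unfolding continuous_on_def by (intro tendsto_intros) blast
  then have lim: "((\<lambda>s. norm (f s - f s0)) \<longlongrightarrow> 0) (at s0 within J)" by simp
  have "norm (P (r s) (f s) - P (r s) (f s0)) \<le> norm (f s - f s0)" if "s \<in> J" for s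
    using that s0 by (intro norm_P_diff_le r(2) f(2))
  then have "eventually (\<lambda>s. norm (P (r s) (f s) - P (r s) (f s0)) \<le> norm (f s - f s0)) (at s0 within J)"
    unfolding eventually_at_filter by (intro always_eventually) simp
  from Lim_null_comparison[OF this lim]
  have "((\<lambda>s. P (r s) (f s) - P (r s) (f s0)) \<longlongrightarrow> 0) (at s0 within J)" .
  moreover have "continuous_on J (\<lambda>s. P (r s) (f s0))"
    by (rule continuous_on_compose2[OF P_continuous[OF f(2)[OF s0]] r(1)]) (use r(2) in auto)
  then have "((\<lambda>s. P (r s) (f s0)) \<longlongrightarrow> P (r s0) (f s0)) (at s0 within J)"
    using s0 unfolding continuous_on_def by blast
  ultimately show "((\<lambda>s. P (r s) (f s)) \<longlongrightarrow> P (r s0) (f s0)) (at s0 within J)"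
    using tendsto_add[of "\<lambda>s. P (r s) (f s) - P (r s) (f s0)" 0 _ "\<lambda>s. P (r s) (f s0)"] by simp
qed

text \<open>Joint continuity is uniform on a compact rectangle; comparing the points (h, s) and (0,
  s') makes short evolution and a small change of the datum negligible at once, as
  \<open>P 0\<close> is the identity on \<open>S\<close>.\<close>

lemma P_uniform:
  assumes "continuous_on {0..T1} g" "\<And>s. s \<in> {0..T1} \<Longrightarrow> g s \<in> S" "e > 0"
  obtains d where "d > 0"
    "\<And>h s s'. 0 \<le> h \<Longrightarrow> h < d \<Longrightarrow> s \<in> {0..T1} \<Longrightarrow> s' \<in> {0..T1} \<Longrightarrow> \<bar>s - s'\<bar> < d \<Longrightarrow>
      norm (P h (g s) - g s') < e"
proof -
  let ?K = "{0..1::real} \<times> {0..T1}"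
  have "continuous_on ?K (\<lambda>p. P (fst p) (g (snd p)))"
    by (rule continuous_on_P_compose)
      (auto intro!: continuous_intros continuous_on_compose2[OF assms(1)] assms(2))
  then have "uniformly_continuous_on ?K (\<lambda>p. P (fst p) (g (snd p)))"
    by (intro compact_uniformly_continuous compact_Times) auto
  then obtain d where d: "d > 0" "\<And>p q. p \<in> ?K \<Longrightarrow> q \<in> ?K \<Longrightarrow> dist q p < d \<Longrightarrow>
      dist (P (fst q) (g (snd q))) (P (fst p) (g (snd p))) < e"
    using assms(3) unfolding uniformly_continuous_on_def by metis
  show ?thesis
  \<comment> \<open>The bound 1 keeps \<open>h\<close> inside the rectangle; two deviations below
    d/2 give a distance below d.\<close>
  proof (rule that[of "min 1 (d / 2)"])
    fix h s s' assume *: "0 \<le> h" "h < min 1 (d / 2)" "s \<in> {0..T1}" "s' \<in> {0..T1}" "\<bar>s - s'\<bar> < min 1 (d / 2)"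
    have "dist (h, s) (0, s') \<le> \<bar>h\<bar> + \<bar>s - s'\<bar>"
      by (simp add: dist_Pair_Pair dist_real_def sqrt_sum_squares_le_sum_abs)
    also have "\<dots> < d" using * by auto
    finally show "norm (P h (g s) - g s') < e"
      using d(2)[of "(0, s')" "(h, s)"] * assms(2) by (auto simp: dist_norm P_0)
  qed (use d(1) in auto)
qed

definition orbit_integral :: "real \<Rightarrow> 'b \<Rightarrow> 'b" where
  "orbit_integral h x = integral {0..h} (\<lambda>r. P r x)"

lemma P_integrable:
  assumes "x \<in> S" "0 \<le> a" shows "(\<lambda>r. P r x) integrable_on {a..b}"
  using P_continuous[OF assms(1)] assms(2)
  by (intro integrable_continuous_real) (auto intro: continuous_on_subset)

lemma orbit_integral_in: "x \<in> S \<Longrightarrow> orbit_integral h x \<in> S"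
  unfolding orbit_integral_def
  by (rule has_integral_in_closed_subspace[OF closed_S subspace_S _ integrable_integral[OF P_integrable]])
    (auto intro: P_in)

text \<open>\<open>P k Y - Y = (\<integral>\<^bsub>h\<^esub>\<^bsup>h + k\<^esup> - \<integral>\<^bsub>0\<^esub>\<^bsup>k\<^esup>) P r x\<close> for \<open>Y = orbit_integral h x\<close>, so the orbit
  integral lies in the domain of the generator.\<close>

lemma orbit_integral_generator:
  assumes x: "x \<in> S" and h: "0 \<le> h"
  shows "((\<lambda>k. (1 / k) *\<^sub>R (P k (orbit_integral h x) - orbit_integral h x)) \<longlongrightarrow> P h x - x) (at_right 0)"
proof -
  have cont: "continuous_on {a..b} (\<lambda>r. P r x)" if "0 \<le> a" for a b
    using P_continuous[OF x] that by (auto intro: continuous_on_subset)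
  have "P k (orbit_integral h x) - orbit_integral h x
      = integral {h..h + k} (\<lambda>r. P r x) - integral {0..0 + k} (\<lambda>r. P r x)" if k: "0 < k" for k
  proof -
    have "((\<lambda>r. P k (P r x)) has_integral P k (orbit_integral h x)) {0..h}"
      unfolding orbit_integral_def
      by (rule has_integral_contraction_on_subspace[OF closed_S subspace_S _ _ _ integrable_integral[OF P_integrable[OF x]]])
        (use k x in \<open>auto intro: P_in P_linear P_contraction\<close>)
    moreover have "P k (P r x) = P (k + r) x" if "r \<in> {0..h}" for r
      using P_add[of k r x] that k x by simp
    ultimately have "((\<lambda>r. P (k + r) x) has_integral P k (orbit_integral h x)) {0..h}"
      by (rule has_integral_eq[rotated])
    then have "integral {0..h} ((\<lambda>r. P r x) \<circ> (+) k) = P k (orbit_integral h x)"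
      unfolding o_def by (rule integral_unique)
    then have "P k (orbit_integral h x) = integral {0 + k..h + k} (\<lambda>r. P r x)"
      by (simp only: integral_shift_Icc_real)
    then show ?thesis
      using Henstock_Kurzweil_Integration.integral_combine[of 0 k "h + k" "\<lambda>r. P r x"] Henstock_Kurzweil_Integration.integral_combine[of 0 h "h + k" "\<lambda>r. P r x"]
        P_integrable[OF x, of 0 "h + k"] k h
      by (simp add: orbit_integral_def algebra_simps)
  qed
  then have eq: "eventually (\<lambda>k. (1 / k) *\<^sub>R integral {h..h + k} (\<lambda>r. P r x) - (1 / k) *\<^sub>R integral {0..0 + k} (\<lambda>r. P r x)
      = (1 / k) *\<^sub>R (P k (orbit_integral h x) - orbit_integral h x)) (at_right 0)"
    by (intro eventually_at_rightI[of 0 1]) (auto simp: scaleR_diff_right)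
  have "((\<lambda>k. (1 / k) *\<^sub>R integral {h..h + k} (\<lambda>r. P r x) - (1 / k) *\<^sub>R integral {0..0 + k} (\<lambda>r. P r x))
      \<longlongrightarrow> P h x - P 0 x) (at_right 0)"
    by (intro tendsto_diff integral_average_tendsto[of _ "h + 1"] cont) (use h in auto)
  then show ?thesis using Lim_transform_eventually[OF _ eq] by (simp add: P_0 x)
qed

end

section \<open>Mild solutions and their increments over short intervals\<close>

locale mild_solution = subspace_semigroup S P for S :: "'b::banach set" and P +
  fixes f :: "real \<Rightarrow> 'b" and x :: 'b and T1 :: real
  assumes f_continuous: "continuous_on {0..T1} f" and f_in: "s \<in> {0..T1} \<Longrightarrow> f s \<in> S" and x_in: "x \<in> S"
begin

definition duhamel :: "real \<Rightarrow> real \<Rightarrow> 'b" where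
  "duhamel t' t = integral {t'..t} (\<lambda>s. P (t - s) (f s))"

definition mild :: "real \<Rightarrow> 'b" where
  "mild t = P t x + duhamel 0 t"

lemma duhamel_integrand_continuous:
  assumes "0 \<le> t'" "r \<le> t" "r \<le> T1" shows "continuous_on {t'..r} (\<lambda>s. P (t - s) (f s))"
  by (rule continuous_on_P_compose)
    (use assms f_in in \<open>auto intro!: continuous_intros continuous_on_subset[OF f_continuous]\<close>)

lemma duhamel_has_integral:
  assumes "0 \<le> t'" "t \<le> T1"
  shows "((\<lambda>s. P (t - s) (f s)) has_integral duhamel t' t) {t'..t}"
  unfolding duhamel_def
  by (intro integrable_integral integrable_continuous_real duhamel_integrand_continuous) (use assms in auto)

lemma duhamel_in: "0 \<le> t' \<Longrightarrow> t \<le> T1 \<Longrightarrow> duhamel t' t \<in> S"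
  by (rule has_integral_in_closed_subspace[OF closed_S subspace_S _ duhamel_has_integral])
    (auto intro!: P_in f_in)

lemma mild_in: "t \<in> {0..T1} \<Longrightarrow> mild t \<in> S"
  unfolding mild_def by (intro subspace_add[OF subspace_S] P_in duhamel_in x_in) auto

lemma mild_0: "mild 0 = x"
  by (simp add: mild_def duhamel_def P_0 x_in)

lemma P_duhamel:
  assumes "0 \<le> t'" "t' \<le> T1" "0 \<le> h"
  shows "((\<lambda>s. P h (P (t' - s) (f s))) has_integral P h (duhamel 0 t')) {0..t'}"
  by (rule has_integral_contraction_on_subspace[OF closed_S subspace_S _ _ _ duhamel_has_integral])
    (use assms in \<open>auto intro!: P_in P_linear P_contraction f_in\<close>)

text \<open>The semigroup law merges the evolution up to t' with the evolution from t' to t, under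
  the integral as well. An increment thus involves only the orbit of \<open>mild t'\<close> and a
  Duhamel integral over the short interval.\<close>

lemma mild_step:
  assumes "0 \<le> t'" "t' \<le> t" "t \<le> T1"
  shows "mild t = P (t - t') (mild t') + duhamel t' t"
proof -
  have "((\<lambda>s. P (t - t') (P (t' - s) (f s))) has_integral P (t - t') (duhamel 0 t')) {0..t'}"
    using assms by (intro P_duhamel) auto
  moreover have "P (t - t') (P (t' - s) (f s)) = P (t - s) (f s)" if "s \<in> {0..t'}" for s
    using P_add[of "t - t'" "t' - s" "f s"] that assms f_in by simp
  ultimately have "((\<lambda>s. P (t - s) (f s)) has_integral P (t - t') (duhamel 0 t')) {0..t'}"
    by (rule has_integral_eq[rotated])
  then have "P (t - t') (duhamel 0 t') = integral {0..t'} (\<lambda>s. P (t - s) (f s))"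
    by (rule integral_unique[symmetric])
  moreover have "integral {0..t'} (\<lambda>s. P (t - s) (f s)) + duhamel t' t = duhamel 0 t"
    unfolding duhamel_def using assms
    by (intro Henstock_Kurzweil_Integration.integral_combine integrable_continuous_real duhamel_integrand_continuous) auto
  moreover have "P (t - t') (mild t') = P (t - t') (P t' x) + P (t - t') (duhamel 0 t')"
    unfolding mild_def using assms x_in by (intro P_plus P_in duhamel_in) auto
  moreover have "P (t - t') (P t' x) = P t x"
    using P_add[of "t - t'" t' x] assms x_in by simp
  ultimately show ?thesis by (simp add: mild_def)
qed

text \<open>The integrand is uniformly close to \<open>f t0\<close> by \<open>P_uniform\<close>. One
  \<open>d\<close> serves all positions, and \<open>t0\<close> may be either end of the interval, as
  one-sided difference quotients require.\<close>

lemma duhamel_close: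
  assumes "e > 0"
  obtains d where "d > 0" "\<And>t' t t0. 0 \<le> t' \<Longrightarrow> t' \<le> t0 \<Longrightarrow> t0 \<le> t \<Longrightarrow> t \<le> T1 \<Longrightarrow> t - t' < d \<Longrightarrow>
    norm (duhamel t' t - (t - t') *\<^sub>R f t0) \<le> e * (t - t')"
proof -
  obtain d where d: "d > 0" "\<And>h s s'. 0 \<le> h \<Longrightarrow> h < d \<Longrightarrow> s \<in> {0..T1} \<Longrightarrow> s' \<in> {0..T1} \<Longrightarrow> \<bar>s - s'\<bar> < d \<Longrightarrow>
      norm (P h (f s) - f s') < e"
    using P_uniform[OF f_continuous f_in assms] by blast
  show ?thesis
  proof (rule that[OF d(1)])
    fix t' t t0 assume t: "0 \<le> t'" "t' \<le> t0" "t0 \<le> t" "t \<le> T1" "t - t' < d"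
    show "norm (duhamel t' t - (t - t') *\<^sub>R f t0) \<le> e * (t - t')"
      unfolding duhamel_def
    proof (rule norm_integral_minus_const_le)
      fix s assume "s \<in> {t'..t}"
      then show "norm (P (t - s) (f s) - f t0) \<le> e"
        using t by (intro d(2)[THEN less_imp_le]) auto
    qed (use t in \<open>auto intro: duhamel_integrand_continuous\<close>)
  qed
qed

text \<open>In the increment, \<open>P t'\<close> and \<open>P (t' - s)\<close> commute with
  \<open>P h\<close> and are removed by contractivity. What remains is the motion of
  \<open>x\<close> and of the values \<open>f s\<close> during time h, plus a Duhamel integral over
  an interval of length h.\<close>

lemma mild_continuous: "continuous_on {0..T1} mild"
  unfolding continuous_on_iff
proof (intro ballI allI impI)
  fix t0 :: real and e :: real assume t0: "t0 \<in> {0..T1}" and e: "e > 0"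
  \<comment> \<open>The datum contributes \<open>e'\<close> and the integral at most
    \<open>e' * T1\<close>, which together make e/2; the other half is reserved for
    \<open>M * h\<close>.\<close>
  define e' where "e' = e / 2 * inverse (T1 + 1)"
  have e': "e' > 0" using e t0 by (auto simp: e'_def)
  obtain d1 where d1: "d1 > 0" "\<And>h s s'. 0 \<le> h \<Longrightarrow> h < d1 \<Longrightarrow> s \<in> {0..T1} \<Longrightarrow> s' \<in> {0..T1} \<Longrightarrow> \<bar>s - s'\<bar> < d1 \<Longrightarrow>
      norm (P h (f s) - f s') < e'"
    using P_uniform[OF f_continuous f_in e'] by blast
  obtain d2 where d2: "d2 > 0" "\<And>h s s'. 0 \<le> h \<Longrightarrow> h < d2 \<Longrightarrow> s \<in> {0..T1} \<Longrightarrow> s' \<in> {0..T1} \<Longrightarrow> \<bar>s - s'\<bar> < d2 \<Longrightarrow>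
      norm (P h x - x) < e'"
    using P_uniform[of T1 "\<lambda>s. x", OF _ _ e'] x_in by auto
  obtain M where M: "M > 0" "\<And>s. s \<in> {0..T1} \<Longrightarrow> norm (f s) \<le> M"
    using compact_imp_bounded[OF compact_continuous_image[OF f_continuous compact_Icc]]
    unfolding bounded_pos by auto
  define d where "d = min (min d1 d2) (e / (2 * M))"
  have step: "norm (mild t - mild t') < e" if t: "0 \<le> t'" "t' \<le> t" "t \<le> T1" "t - t' < d" for t' t
  proof -
    define h where "h = t - t'"
    have h: "0 \<le> h" "h < d1" "h < d2" "M * h < e / 2" using t M by (auto simp: h_def d_def field_simps)
    have a: "norm (P h (P t' x) - P t' x) \<le> e'"
    proof -
      have "P h (P t' x) - P t' x = P t' (P h x - x)"
        using P_add[of h t' x] P_add[of t' h x] t(1) h(1) x_in P_in by (simp add: P_diff add.commute)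
      then have "norm (P h (P t' x) - P t' x) \<le> norm (P h x - x)"
        using P_contraction[of t' "P h x - x"] t(1) h(1) x_in P_in subspace_diff[OF subspace_S] by simp
      also have "\<dots> < e'" using d2(2)[of h 0 0] h t d2(1) by simp
      finally show ?thesis by simp
    qed
    have b: "norm (P h (duhamel 0 t') - duhamel 0 t') \<le> e' * T1"
    proof -
      have int: "((\<lambda>s. P h (P (t' - s) (f s)) - P (t' - s) (f s)) has_integral P h (duhamel 0 t') - duhamel 0 t') {0..t'}"
        using t h by (intro has_integral_diff P_duhamel duhamel_has_integral) auto
      have "norm (P h (P (t' - s) (f s)) - P (t' - s) (f s)) \<le> e'" if s: "s \<in> {0..t'}" for s
      proof -
        have fs: "f s \<in> S" using s t by (intro f_in) auto
        have "P h (P (t' - s) (f s)) - P (t' - s) (f s) = P (t' - s) (P h (f s) - f s)"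
          using P_add[of h "t' - s" "f s"] P_add[of "t' - s" h "f s"] s h(1) fs P_in by (simp add: P_diff add.commute)
        then have "norm (P h (P (t' - s) (f s)) - P (t' - s) (f s)) \<le> norm (P h (f s) - f s)"
          using P_contraction[of "t' - s" "P h (f s) - f s"] s h(1) fs P_in subspace_diff[OF subspace_S] by simp
        also have "\<dots> < e'" using d1(2)[of h s s] h t s d1(1) by simp
        finally show ?thesis by simp
      qed
      then have "norm (P h (duhamel 0 t') - duhamel 0 t') \<le> e' * measure lborel {0..t'}"
        using has_integral_bound_real[OF less_imp_le[OF e'] finite.emptyI int] by simp
      also have "\<dots> \<le> e' * T1" using t e' by simp
      finally show ?thesis .
    qed
    have c: "norm (duhamel t' t) \<le> M * h"
      unfolding duhamel_def h_def
    proof (rule integral_bound)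
      show "norm (P (t - s) (f s)) \<le> M" if "s \<in> {t'..t}" for s
        using that t M(2) by (auto intro!: order_trans[OF P_contraction] f_in)
    qed (use t in \<open>auto intro: duhamel_integrand_continuous\<close>)
    have "P h (mild t') = P h (P t' x) + P h (duhamel 0 t')"
      unfolding mild_def using t h x_in by (intro P_plus P_in duhamel_in) auto
    then have "mild t - mild t'
        = (P h (P t' x) - P t' x) + (P h (duhamel 0 t') - duhamel 0 t') + duhamel t' t"
      using mild_step[of t' t] t by (simp add: h_def mild_def[of t'])
    then have "norm (mild t - mild t') \<le> e' + e' * T1 + M * h"
      using a b c by (metis (no_types, lifting) norm_triangle_mono)
    also have "e' + e' * T1 = e / 2"
    proof -
      have "T1 + 1 \<noteq> 0" using t0 by auto
      then have "e' * (T1 + 1) = e / 2"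
        by (simp only: e'_def mult.assoc left_inverse mult_1_right not_False_eq_True)
      then show ?thesis by (simp add: distrib_left)
    qed
    finally show ?thesis using h(4) by linarith
  qed
  have "d > 0" using d1 d2 e M by (auto simp: d_def)
  moreover have "dist (mild t) (mild t0) < e" if "t \<in> {0..T1}" "dist t t0 < d" for t
    using step[of t t0] step[of t0 t] that t0
    by (cases "t \<le> t0") (auto simp: dist_norm norm_minus_commute)
  ultimately show "\<exists>d>0. \<forall>t\<in>{0..T1}. dist t t0 < d \<longrightarrow> dist (mild t) (mild t0) < e" by blast
qed

text \<open>The orbit starts at \<open>mild t'\<close> but is compared with \<open>mild t0\<close>;
  continuity of the mild solution makes \<open>P_uniform\<close> applicable to this change of base
  point.\<close>

lemma orbit_integral_close:
  assumes "e > 0"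
  obtains d where "d > 0" "\<And>t' t t0. 0 \<le> t' \<Longrightarrow> t' \<le> t0 \<Longrightarrow> t0 \<le> t \<Longrightarrow> t \<le> T1 \<Longrightarrow> t - t' < d \<Longrightarrow>
    norm (orbit_integral (t - t') (mild t') - (t - t') *\<^sub>R mild t0) \<le> e * (t - t')"
proof -
  obtain d where d: "d > 0" "\<And>h s s'. 0 \<le> h \<Longrightarrow> h < d \<Longrightarrow> s \<in> {0..T1} \<Longrightarrow> s' \<in> {0..T1} \<Longrightarrow> \<bar>s - s'\<bar> < d \<Longrightarrow>
      norm (P h (mild s) - mild s') < e"
    using P_uniform[OF mild_continuous mild_in assms] by blast
  show ?thesis
  proof (rule that[OF d(1)])
    fix t' t t0 assume t: "0 \<le> t'" "t' \<le> t0" "t0 \<le> t" "t \<le> T1" "t - t' < d"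
    have "norm (orbit_integral (t - t') (mild t') - (t - t' - 0) *\<^sub>R mild t0) \<le> e * (t - t' - 0)"
      unfolding orbit_integral_def
    proof (rule norm_integral_minus_const_le)
      show "continuous_on {0..t - t'} (\<lambda>r. P r (mild t'))"
        using t by (intro continuous_on_subset[OF P_continuous[OF mild_in]]) auto
      fix s assume "s \<in> {0..t - t'}"
      then show "norm (P s (mild t') - mild t0) \<le> e"
        using t by (intro d(2)[THEN less_imp_le]) auto
    qed (use t in auto)
    then show "norm (orbit_integral (t - t') (mild t') - (t - t') *\<^sub>R mild t0) \<le> e * (t - t')" by simp
  qed
qed

end

lemma has_vector_derivative_iff_quotient:
  fixes f :: "real \<Rightarrow> 'b::real_normed_vector"
  shows "(f has_vector_derivative D) (at t within J)
    \<longleftrightarrow> ((\<lambda>s. (1 / (s - t)) *\<^sub>R (f s - f t)) \<longlongrightarrow> D) (at t within J)"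
proof -
  have eq: "norm (f s - f t - (s - t) *\<^sub>R D) / norm (s - t) = norm ((1 / (s - t)) *\<^sub>R (f s - f t) - D)"
    if "s \<noteq> t" for s
  proof -
    have "(1 / (s - t)) *\<^sub>R (f s - f t) - D = (1 / (s - t)) *\<^sub>R (f s - f t - (s - t) *\<^sub>R D)"
      using that by (simp add: scaleR_diff_right)
    then show ?thesis by (simp add: divide_inverse mult.commute)
  qed
  have "(f has_vector_derivative D) (at t within J)
      \<longleftrightarrow> ((\<lambda>s. norm (f s - f t - (s - t) *\<^sub>R D) / norm (s - t)) \<longlongrightarrow> 0) (at t within J)"
    by (simp add: has_vector_derivative_def has_derivative_iff_norm bounded_linear_scaleR_left)
  also have "\<dots> \<longleftrightarrow> ((\<lambda>s. norm ((1 / (s - t)) *\<^sub>R (f s - f t) - D)) \<longlongrightarrow> 0) (at t within J)"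
    by (intro filterlim_cong refl) (auto intro!: always_eventually eq simp: eventually_at_filter simp del: real_norm_def)
  also have "\<dots> \<longleftrightarrow> ((\<lambda>s. (1 / (s - t)) *\<^sub>R (f s - f t)) \<longlongrightarrow> D) (at t within J)"
    by (simp add: tendsto_norm_zero_iff Lim_null[symmetric])
  finally show ?thesis .
qed

context energy
begin

text \<open>With the subspace property, this allows a curve in \<open>H10\<close> to be integrated
  in the energy norm with a result that is again the image of an element of
  \<open>H10\<close>.\<close>

lemma closed_E1: "closed (E1 ` H10 \<Omega>)"
  unfolding closed_sequential_limits
proof (intro allI impI, elim conjE)
  fix s :: "nat \<Rightarrow> _" and l assume s: "\<forall>n. s n \<in> E1 ` H10 \<Omega>" and lim: "s \<longlonglongrightarrow> l"
  from s have "\<forall>n. \<exists>x. x \<in> H10 \<Omega> \<and> s n = E1 x" by blast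
  then obtain x where x: "\<And>n. x n \<in> H10 \<Omega>" "\<And>n. s n = E1 (x n)" by metis
  have "(\<lambda>n. E1 (x n)) \<longlonglongrightarrow> l" using lim by (simp flip: x(2))
  from H10_E1_tendsto[OF x(1) this] obtain w where "w \<in> H10 \<Omega>" "E1 w = l" by blast
  then show "l \<in> E1 ` H10 \<Omega>" by blast
qed

lemma subspace_E1: "subspace (E1 ` H10 \<Omega>)"
  unfolding subspace_def
proof (intro conjI ballI allI)
  show "0 \<in> E1 ` H10 \<Omega>" using E1_zero H10_zero by (metis imageI)
  fix y c assume "y \<in> E1 ` H10 \<Omega>"
  then obtain y' where y: "y' \<in> H10 \<Omega>" "y = E1 y'" by blast
  show "c *\<^sub>R y \<in> E1 ` H10 \<Omega>"
    using y E1_scaleR subspace_scale[OF subspace_H10] by (metis imageI)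
  fix x assume "x \<in> E1 ` H10 \<Omega>"
  then obtain x' where x: "x' \<in> H10 \<Omega>" "x = E1 x'" by blast
  have "E1 (x' + y') = x + y" using E1_linear[OF x(1) y(1), of 1 1] x y by simp
  then show "x + y \<in> E1 ` H10 \<Omega>"
    using x y subspace_add[OF subspace_H10] by (metis imageI)
qed

lemma inner_E1: "inner (E1 u) (E1 w) = \<kappa> * inner (grad \<Omega> u) (grad \<Omega> w)"
  using kappa_pos by (simp add: H10_emb_def flip: mult.assoc)

text \<open>The Poincare inequality, applied to the error of the difference quotient, passes from
  the energy norm to the L2 norm.\<close>

lemma has_vector_derivative_of_E1:
  assumes "((\<lambda>s. E1 (p s)) has_vector_derivative E1 q) (at t within J)"
    and p: "\<And>s. s \<in> J \<Longrightarrow> p s \<in> H10 \<Omega>" and "t \<in> J" and q: "q \<in> H10 \<Omega>"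
  shows "(p has_vector_derivative q) (at t within J)"
proof -
  have lim: "((\<lambda>s. (1 / (s - t)) *\<^sub>R (E1 (p s) - E1 (p t)) - E1 q) \<longlongrightarrow> 0) (at t within J)"
    using assms(1) by (simp add: has_vector_derivative_iff_quotient Lim_null[symmetric])
  have "norm ((1 / (s - t)) *\<^sub>R (p s - p t) - q)
      \<le> CP * norm ((1 / (s - t)) *\<^sub>R (E1 (p s) - E1 (p t)) - E1 q)" if "s \<in> J" for s
  proof -
    have H: "(1 / (s - t)) *\<^sub>R (p s - p t) \<in> H10 \<Omega>" "p s - p t \<in> H10 \<Omega>" "p s \<in> H10 \<Omega>" "p t \<in> H10 \<Omega>"
      using that assms subspace_H10 by (auto intro: subspace_scale subspace_diff)
    have "norm ((1 / (s - t)) *\<^sub>R (p s - p t) - q) \<le> CP * norm (E1 ((1 / (s - t)) *\<^sub>R (p s - p t) - q))"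
      by (intro poincare subspace_diff[OF subspace_H10] H q)
    also have "E1 ((1 / (s - t)) *\<^sub>R (p s - p t) - q) = (1 / (s - t)) *\<^sub>R (E1 (p s) - E1 (p t)) - E1 q"
      using H q by (simp add: E1_diff E1_scaleR)
    finally show ?thesis .
  qed
  then have "eventually (\<lambda>s. norm ((1 / (s - t)) *\<^sub>R (p s - p t) - q)
      \<le> CP * norm ((1 / (s - t)) *\<^sub>R (E1 (p s) - E1 (p t)) - E1 q)) (at t within J)"
    unfolding eventually_at_filter by (intro always_eventually) simp
  from Lim_null_comparison[OF this] tendsto_mult_left[OF tendsto_norm[OF lim], of CP]
  have "((\<lambda>s. (1 / (s - t)) *\<^sub>R (p s - p t) - q) \<longlongrightarrow> 0) (at t within J)" by simp
  then show ?thesis by (simp add: has_vector_derivative_iff_quotient Lim_null[symmetric])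
qed

section \<open>Functionals on \<open>H10\<close>\<close>

lemma Hm1_iff: "l \<in> Hm1 \<kappa> \<Omega> \<longleftrightarrow>
    (\<forall>v\<in>H10 \<Omega>. \<forall>w\<in>H10 \<Omega>. \<forall>a b. l (a *\<^sub>R v + b *\<^sub>R w) = a * l v + b * l w) \<and>
    (\<exists>C. \<forall>w\<in>H10 \<Omega>. \<bar>l w\<bar> \<le> C * norm (E1 w))"
  by (simp add: Hm1_def norm_H10_emb[OF kappa_pos])

lemma Hm1_norm_eq: "Hm1_norm \<kappa> \<Omega> l = (SUP w\<in>{w \<in> H10 \<Omega>. norm (E1 w) \<le> 1}. \<bar>l w\<bar>)"
  by (simp add: Hm1_norm_def norm_H10_emb[OF kappa_pos])

lemma Hm1_norm_le:
  assumes "0 \<le> C" "\<And>w. w \<in> H10 \<Omega> \<Longrightarrow> \<bar>l w\<bar> \<le> C * norm (E1 w)"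
  shows "Hm1_norm \<kappa> \<Omega> l \<le> C"
  unfolding Hm1_norm_eq
proof (rule cSUP_least)
  show "{w \<in> H10 \<Omega>. norm (E1 w) \<le> 1} \<noteq> {}" using H10_zero E1_zero by force
  fix w assume "w \<in> {w \<in> H10 \<Omega>. norm (E1 w) \<le> 1}"
  then show "\<bar>l w\<bar> \<le> C" using assms(2)[of w] mult_left_le[of "norm (E1 w)" C] assms(1) by auto
qed

lemma Hm1_bdd_above:
  assumes "l \<in> Hm1 \<kappa> \<Omega>" shows "bdd_above ((\<lambda>w. \<bar>l w\<bar>) ` {w \<in> H10 \<Omega>. norm (E1 w) \<le> 1})"
proof -
  obtain C where C: "\<forall>w\<in>H10 \<Omega>. \<bar>l w\<bar> \<le> C * norm (E1 w)" using assms by (auto simp: Hm1_iff)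
  show ?thesis
  proof (rule bdd_aboveI2)
    fix w assume w: "w \<in> {w \<in> H10 \<Omega>. norm (E1 w) \<le> 1}"
    then have "\<bar>l w\<bar> \<le> C * norm (E1 w)" using C by simp
    \<comment> \<open>The constant in \<open>Hm1\<close> carries no sign condition.\<close>
    also have "\<dots> \<le> \<bar>C\<bar> * norm (E1 w)" by (intro mult_right_mono) auto
    also have "\<dots> \<le> \<bar>C\<bar>" using w by (intro mult_left_le) auto
    finally show "\<bar>l w\<bar> \<le> \<bar>C\<bar>" .
  qed
qed

text \<open>Scaling \<open>w\<close> by the inverse of its norm plus 1 brings it into the unit ball
  even when \<open>w\<close> is zero; the lost sharpness is harmless in limits, and
  \<open>w = 0\<close> yields nonnegativity of the dual norm.\<close>

lemma Hm1_apply_le: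
  assumes l: "l \<in> Hm1 \<kappa> \<Omega>" and w: "w \<in> H10 \<Omega>"
  shows "\<bar>l w\<bar> \<le> (norm (E1 w) + 1) * Hm1_norm \<kappa> \<Omega> l"
proof -
  let ?N = "norm (E1 w) + 1"
  have N: "?N > 0" by (smt (verit) norm_ge_zero)
  let ?w = "(1 / ?N) *\<^sub>R w"
  have "norm (E1 ?w) \<le> 1" using w N by (simp add: E1_scaleR)
  moreover have "?w \<in> H10 \<Omega>" using w subspace_scale[OF subspace_H10] by blast
  ultimately have "\<bar>l ?w\<bar> \<le> Hm1_norm \<kappa> \<Omega> l"
    unfolding Hm1_norm_eq by (intro cSUP_upper Hm1_bdd_above l) auto
  moreover have "l (a *\<^sub>R w + 0 *\<^sub>R w) = a * l w + 0 * l w" for a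
    using l w unfolding Hm1_iff by blast
  then have "l ?w = l w / ?N" by simp
  ultimately show ?thesis using N by (simp add: abs_divide pos_divide_le_eq mult.commute)
qed

lemma Hm1_norm_nonneg: "l \<in> Hm1 \<kappa> \<Omega> \<Longrightarrow> 0 \<le> Hm1_norm \<kappa> \<Omega> l"
  using Hm1_apply_le[OF _ H10_zero, of l] by (simp add: E1_zero)

lemma inner_Hm1: "(\<lambda>w. inner f w) \<in> Hm1 \<kappa> \<Omega>"
  unfolding Hm1_iff
proof (intro conjI exI ballI)
  fix w assume "w \<in> H10 \<Omega>"
  have "\<bar>inner f w\<bar> \<le> norm f * norm w" by (rule Cauchy_Schwarz_ineq2)
  also have "\<dots> \<le> norm f * (CP * norm (E1 w))"
    by (intro mult_left_mono poincare \<open>w \<in> H10 \<Omega>\<close>) auto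
  finally show "\<bar>inner f w\<bar> \<le> norm f * CP * norm (E1 w)" by simp
qed (simp add: inner_add_right)

lemma inner_E1_Hm1: "(\<lambda>w. inner f (E1 w)) \<in> Hm1 \<kappa> \<Omega>"
  unfolding Hm1_iff
  by (intro conjI exI[of _ "norm f"]) (auto simp: E1_linear inner_add_right Cauchy_Schwarz_ineq2)

lemma Hm1_add: "l \<in> Hm1 \<kappa> \<Omega> \<Longrightarrow> m \<in> Hm1 \<kappa> \<Omega> \<Longrightarrow> (\<lambda>w. l w + m w) \<in> Hm1 \<kappa> \<Omega>"
proof -
  assume lm: "l \<in> Hm1 \<kappa> \<Omega>" "m \<in> Hm1 \<kappa> \<Omega>"
  obtain C D where "\<forall>w\<in>H10 \<Omega>. \<bar>l w\<bar> \<le> C * norm (E1 w)" "\<forall>w\<in>H10 \<Omega>. \<bar>m w\<bar> \<le> D * norm (E1 w)"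
    using lm by (auto simp: Hm1_iff)
  then have "\<forall>w\<in>H10 \<Omega>. \<bar>l w + m w\<bar> \<le> (C + D) * norm (E1 w)"
    by (smt (verit, best) distrib_right)
  then show ?thesis using lm unfolding Hm1_iff by (intro conjI) (simp add: distrib_left, blast)
qed

lemma Hm1_cmult: "l \<in> Hm1 \<kappa> \<Omega> \<Longrightarrow> (\<lambda>w. c * l w) \<in> Hm1 \<kappa> \<Omega>"
proof -
  assume l: "l \<in> Hm1 \<kappa> \<Omega>"
  obtain C where "\<forall>w\<in>H10 \<Omega>. \<bar>l w\<bar> \<le> C * norm (E1 w)" using l by (auto simp: Hm1_iff)
  then have "\<forall>w\<in>H10 \<Omega>. \<bar>c * l w\<bar> \<le> (\<bar>c\<bar> * C) * norm (E1 w)"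
    by (auto simp: abs_mult mult.assoc intro: mult_left_mono)
  then show ?thesis using l unfolding Hm1_iff by (intro conjI) (simp add: distrib_left, blast)
qed

lemma Hm1_diff: "l \<in> Hm1 \<kappa> \<Omega> \<Longrightarrow> m \<in> Hm1 \<kappa> \<Omega> \<Longrightarrow> (\<lambda>w. l w - m w) \<in> Hm1 \<kappa> \<Omega>"
  using Hm1_add[of l "\<lambda>w. -1 * m w"] Hm1_cmult[of m "-1"] by simp

lemma Hm1_tendsto_apply:
  assumes "((\<lambda>s. Hm1_norm \<kappa> \<Omega> (\<lambda>w. l s w - m w)) \<longlongrightarrow> 0) G" "\<And>s. l s \<in> Hm1 \<kappa> \<Omega>" "m \<in> Hm1 \<kappa> \<Omega>"
    and w: "w \<in> H10 \<Omega>"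
  shows "((\<lambda>s. l s w) \<longlongrightarrow> m w) G"
proof -
  have "norm (l s w - m w) \<le> (norm (E1 w) + 1) * Hm1_norm \<kappa> \<Omega> (\<lambda>w. l s w - m w)" for s
    using Hm1_apply_le[OF Hm1_diff[OF assms(2,3)] w] by simp
  moreover have "((\<lambda>s. (norm (E1 w) + 1) * Hm1_norm \<kappa> \<Omega> (\<lambda>w. l s w - m w)) \<longlongrightarrow> 0) G"
    using tendsto_mult_left[OF assms(1), of "norm (E1 w) + 1"] by (simp only: mult_zero_right)
  ultimately have "((\<lambda>s. l s w - m w) \<longlongrightarrow> 0) G"
    by (rule Lim_null_comparison[OF always_eventually, OF allI])
  then show ?thesis by (simp only: Lim_null[symmetric])
qed

section \<open>Uniqueness of weak solutions\<close>

text \<open>Test the equation at time \<open>t\<close> with \<open>\<psi> t = \<integral>\<^bsub>t\<^esub>\<^bsup>\<tau>\<^esup> z r\<close>, so that \<open>\<psi>' = - z\<close>. The functional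
  \<open>(z', \<psi>) + |z|\<^sup>2 / 2 + \<nu> (z, \<psi>) - |\<psi>|\<^sup>2 / 2\<close>, the last norm being that of \<open>H10\<close>, has
  derivative \<open>- \<nu> |z|\<^sup>2\<close>, is nonpositive at time \<open>0\<close>, and equals \<open>|z|\<^sup>2 / 2\<close> at time \<open>\<tau>\<close>.\<close>

lemma weak_solution_zero:
  fixes z zt :: "real \<Rightarrow> (real^'n) l2"
  assumes "\<nu> \<ge> 0"
    and z': "\<And>t. t \<in> {0..T1} \<Longrightarrow> (z has_vector_derivative zt t) (at t within {0..T1})"
    and zH: "\<And>t. t \<in> {0..T1} \<Longrightarrow> z t \<in> H10 \<Omega>"
    and E1z: "continuous_on {0..T1} (\<lambda>t. E1 (z t))" and ztc: "continuous_on {0..T1} zt"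
    and zt': "\<And>t \<phi>. t \<in> {0<..T1} \<Longrightarrow> \<phi> \<in> H10 \<Omega> \<Longrightarrow>
      ((\<lambda>s. inner ((1 / (s - t)) *\<^sub>R (zt s - zt t)) \<phi>) \<longlongrightarrow>
        - \<nu> * inner (zt t) \<phi> - inner (E1 (z t)) (E1 \<phi>)) (at t within {0..T1})"
    and z0: "z 0 = 0" "zt 0 = 0" and \<tau>: "\<tau> \<in> {0..T1}"
  shows "z \<tau> = 0"
proof (cases "\<tau> = 0")
  case False
  then have \<tau>0: "0 < \<tau>" using \<tau> by simp
  have E1z\<tau>: "continuous_on {0..\<tau>} (\<lambda>t. E1 (z t))"
    by (rule continuous_on_subset[OF E1z]) (use \<tau> in auto)
  \<comment> \<open>The primitive must have values in \<open>H10\<close>, so it is formed from the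
    gradients and pulled back, not integrated in L2.\<close>
  have "\<exists>p\<in>H10 \<Omega>. E1 p = integral {t..\<tau>} (\<lambda>r. E1 (z r))" if "t \<in> {0..\<tau>}" for t
  proof -
    have "((\<lambda>r. E1 (z r)) has_integral integral {t..\<tau>} (\<lambda>r. E1 (z r))) {t..\<tau>}"
      by (intro integrable_integral integrable_continuous_real continuous_on_subset[OF E1z\<tau>])
        (use that in auto)
    from has_integral_in_closed_subspace[OF closed_E1 subspace_E1 _ this]
    show ?thesis using that \<tau> zH by force
  qed
  then obtain \<psi> where \<psi>: "\<And>t. t \<in> {0..\<tau>} \<Longrightarrow> \<psi> t \<in> H10 \<Omega>"
    and E1\<psi>: "\<And>t. t \<in> {0..\<tau>} \<Longrightarrow> E1 (\<psi> t) = integral {t..\<tau>} (\<lambda>r. E1 (z r))" by metis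
  have E1\<psi>': "((\<lambda>t. E1 (\<psi> t)) has_vector_derivative - E1 (z t)) (at t within {0..\<tau>})"
    if t: "t \<in> {0..\<tau>}" for t
    by (rule has_vector_derivative_transform[OF t _ integral_has_vector_derivative'[OF E1z\<tau> t]])
      (simp add: E1\<psi>)
  have z\<tau>: "z t \<in> H10 \<Omega>" if "t \<in> {0..\<tau>}" for t using that \<tau> zH by auto
  have \<psi>': "(\<psi> has_vector_derivative - z t) (at t within {0..\<tau>})" if t: "t \<in> {0..\<tau>}" for t
  proof (rule has_vector_derivative_of_E1[OF _ \<psi> t])
    show "((\<lambda>s. E1 (\<psi> s)) has_vector_derivative E1 (- z t)) (at t within {0..\<tau>})"
      using E1\<psi>'[OF t] E1_scaleR[OF z\<tau>[OF t], of "-1"] by simp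
    show "- z t \<in> H10 \<Omega>" using subspace_neg[OF subspace_H10 z\<tau>[OF t]] .
  qed
  have z'\<tau>: "(z has_vector_derivative zt t) (at t within {0..\<tau>})" if "t \<in> {0..\<tau>}" for t
    by (rule has_vector_derivative_within_subset[OF z']) (use that \<tau> in auto)
  define \<Phi> where "\<Phi> = (\<lambda>t. inner (zt t) (\<psi> t) + (1/2) * inner (z t) (z t) + \<nu> * inner (z t) (\<psi> t)
      - (1/2) * inner (E1 (\<psi> t)) (E1 (\<psi> t)))"
  note bil = bounded_bilinear.has_vector_derivative[OF bounded_bilinear_inner]
  have \<Phi>': "(\<Phi> has_real_derivative - \<nu> * inner (z t) (z t)) (at t)" if t: "0 < t" "t < \<tau>" for t
  proof -
    have tJ: "t \<in> {0..\<tau>}" "t \<in> {0<..T1}" using t \<tau> by auto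
    have zt'\<tau>: "((\<lambda>s. inner ((1 / (s - t)) *\<^sub>R (zt s - zt t)) (\<psi> t)) \<longlongrightarrow>
        - \<nu> * inner (zt t) (\<psi> t) - inner (E1 (z t)) (E1 (\<psi> t))) (at t within {0..\<tau>})"
      by (rule tendsto_within_subset[OF zt'[OF tJ(2) \<psi>[OF tJ(1)]]]) (use \<tau> in auto)
    have ztlim: "(zt \<longlongrightarrow> zt t) (at t within {0..\<tau>})"
      using continuous_on_subset[OF ztc, of "{0..\<tau>}"] \<tau> tJ by (auto simp: continuous_on_def)
    have "((\<lambda>s. inner (zt s) (\<psi> s)) has_vector_derivative
        - \<nu> * inner (zt t) (\<psi> t) - inner (E1 (z t)) (E1 (\<psi> t)) + inner (zt t) (- z t)) (at t within {0..\<tau>})"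
    proof -
      \<comment> \<open>The product rule is done by hand because \<open>zt\<close> has no L2
        derivative. With \<psi> frozen at \<open>t\<close> the first term converges by the equation;
        the second needs only continuity of \<open>zt\<close> and the L2 derivative of
        \<psi>.\<close>
      have "((\<lambda>s. inner ((1 / (s - t)) *\<^sub>R (zt s - zt t)) (\<psi> t) + inner (zt s) ((1 / (s - t)) *\<^sub>R (\<psi> s - \<psi> t)))
          \<longlongrightarrow> - \<nu> * inner (zt t) (\<psi> t) - inner (E1 (z t)) (E1 (\<psi> t)) + inner (zt t) (- z t)) (at t within {0..\<tau>})"
        using \<psi>'[OF tJ(1)] unfolding has_vector_derivative_iff_quotient
        by (intro tendsto_add tendsto_inner zt'\<tau> ztlim)
      moreover have "inner ((1 / (s - t)) *\<^sub>R (zt s - zt t)) (\<psi> t) + inner (zt s) ((1 / (s - t)) *\<^sub>R (\<psi> s - \<psi> t))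
          = (1 / (s - t)) *\<^sub>R (inner (zt s) (\<psi> s) - inner (zt t) (\<psi> t))" for s
        by (simp add: inner_diff_left inner_diff_right right_diff_distrib)
      ultimately show ?thesis by (simp add: has_vector_derivative_iff_quotient)
    qed
    moreover have "((\<lambda>s. inner (z s) (z s)) has_vector_derivative inner (z t) (zt t) + inner (zt t) (z t))
        (at t within {0..\<tau>})" by (intro bil z'\<tau> tJ)
    moreover have "((\<lambda>s. inner (z s) (\<psi> s)) has_vector_derivative inner (z t) (- z t) + inner (zt t) (\<psi> t))
        (at t within {0..\<tau>})" by (intro bil z'\<tau> \<psi>' tJ)
    moreover have "((\<lambda>s. inner (E1 (\<psi> s)) (E1 (\<psi> s))) has_vector_derivative
        inner (E1 (\<psi> t)) (- E1 (z t)) + inner (- E1 (z t)) (E1 (\<psi> t))) (at t within {0..\<tau>})"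
      by (intro bil E1\<psi>' tJ)
    ultimately have "(\<Phi> has_real_derivative
        (- \<nu> * inner (zt t) (\<psi> t) - inner (E1 (z t)) (E1 (\<psi> t)) + inner (zt t) (- z t))
        + (1/2) * (inner (z t) (zt t) + inner (zt t) (z t))
        + \<nu> * (inner (z t) (- z t) + inner (zt t) (\<psi> t))
        - (1/2) * (inner (E1 (\<psi> t)) (- E1 (z t)) + inner (- E1 (z t)) (E1 (\<psi> t)))) (at t within {0..\<tau>})"
      unfolding \<Phi>_def has_real_derivative_iff_has_vector_derivative[symmetric]
      by (intro DERIV_add DERIV_diff DERIV_cmult)
    \<comment> \<open>All mixed terms cancel: (z', z) between the first two parts, \<nu> (z',
      \<psi>) between the equation and the damping part, and the gradient product between the
      equation and the last part.\<close>
    then have "(\<Phi> has_real_derivative - \<nu> * inner (z t) (z t)) (at t within {0..\<tau>})"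
      by (simp add: inner_commute algebra_simps)
    then show ?thesis using t by (simp add: at_within_Icc_at)
  qed
  \<comment> \<open>The equation is available for positive times only, so the derivative is used in
    the open interval and the end points are reached by continuity.\<close>
  have "\<Phi> \<tau> \<le> \<Phi> 0"
  proof (rule DERIV_nonpos_imp_decreasing_open[OF less_imp_le[OF \<tau>0]])
    fix t assume "0 < t" "t < \<tau>"
    then show "\<exists>y. DERIV \<Phi> t :> y \<and> y \<le> 0" using \<Phi>' \<open>\<nu> \<ge> 0\<close> by (intro exI[of _ "- \<nu> * inner (z t) (z t)"]) auto
  next
    have "continuous_on {0..\<tau>} zt" by (rule continuous_on_subset[OF ztc]) (use \<tau> in auto)
    moreover have "continuous_on {0..\<tau>} z" "continuous_on {0..\<tau>} \<psi>" "continuous_on {0..\<tau>} (\<lambda>t. E1 (\<psi> t))"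
      by (rule continuous_on_vector_derivative, erule z'\<tau> \<psi>' E1\<psi>')+
    ultimately show "continuous_on {0..\<tau>} \<Phi>" unfolding \<Phi>_def by (intro continuous_intros)
  qed
  moreover have "\<Phi> 0 \<le> 0" using z0 by (simp add: \<Phi>_def)
  moreover have "\<psi> \<tau> = 0"
    using E1\<psi>[of \<tau>] \<psi>[of \<tau>] inj_onD[OF inj_on_E1 _ _ H10_zero, of "\<psi> \<tau>"] \<tau>0 by (simp add: E1_zero)
  then have "\<Phi> \<tau> = (1/2) * inner (z \<tau>) (z \<tau>)" by (simp add: \<Phi>_def E1_zero)
  ultimately have "inner (z \<tau>) (z \<tau>) \<le> 0" by simp
  then show ?thesis using inner_gt_zero_iff[of "z \<tau>"] by linarith
qed (use z0 in simp)

lemma weak_solution_unique: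
  assumes "\<nu> \<ge> 0" and u: "weak_solution \<kappa> \<nu> \<Omega> T1 F u0 v0 u" and w: "weak_solution \<kappa> \<nu> \<Omega> T1 F u0 v0 w"
    and \<tau>: "\<tau> \<in> {0..T1}"
  shows "u \<tau> = w \<tau>"
proof -
  \<comment> \<open>This property keeps the equation only against fixed elements of
    \<open>H10\<close>, as a limit of L2 pairings. In this form it is affine in the solution, and
    the force cancels in a difference.\<close>
  define good where "good = (\<lambda>u ut.
    (\<forall>t\<in>{0..T1}. (u has_vector_derivative ut t) (at t within {0..T1})) \<and>
    (\<forall>t\<in>{0..T1}. u t \<in> H10 \<Omega>) \<and> continuous_on {0..T1} (\<lambda>t. E1 (u t)) \<and> continuous_on {0..T1} ut \<and>
    u 0 = u0 \<and> ut 0 = v0 \<and>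
    (\<forall>t\<in>{0<..T1}. \<forall>\<phi>\<in>H10 \<Omega>. ((\<lambda>s. inner ((1 / (s - t)) *\<^sub>R (ut s - ut t)) \<phi>) \<longlongrightarrow>
        - \<nu> * inner (ut t) \<phi> - inner (E1 (u t)) (E1 \<phi>) + inner (F t) \<phi>) (at t within {0..T1})))"
  have ex: "\<exists>ut. good u ut" if weak: "weak_solution \<kappa> \<nu> \<Omega> T1 F u0 v0 u" for u
  proof -
    from weak obtain ut utt where
      1: "\<forall>t\<in>{0..T1}. (u has_vector_derivative ut t) (at t within {0..T1})"
      and 2: "\<forall>t\<in>{0..T1}. (u t, ut t) \<in> energy_space \<Omega>"
      and 3: "continuous_on {0..T1} (\<lambda>t. energy_emb \<kappa> \<Omega> (u t, ut t))"
      and 4: "\<forall>t\<in>{0..T1}. utt t \<in> Hm1 \<kappa> \<Omega>"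
      and 5: "\<forall>t\<in>{0..T1}. ((\<lambda>s. Hm1_norm \<kappa> \<Omega> (\<lambda>w. inner ((1 / (s - t)) *\<^sub>R (ut s - ut t)) w - utt t w)) \<longlongrightarrow> 0)
          (at t within {0..T1})"
      and 6: "(u 0, ut 0) = (u0, v0)"
      and 7: "\<forall>\<phi>. (\<forall>t\<in>{0..T1}. \<phi> t \<in> H10 \<Omega>) \<and> continuous_on {0..T1} (\<lambda>t. H10_emb \<kappa> \<Omega> (\<phi> t)) \<longrightarrow>
        (\<forall>t\<in>{0<..T1}. utt t (\<phi> t) = - \<nu> * inner (ut t) (\<phi> t)
             - \<kappa> * inner (grad \<Omega> (u t)) (grad \<Omega> (\<phi> t)) + inner (F t) (\<phi> t))"
      unfolding weak_solution_def by (elim exE conjE) (rule that)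
    have "((\<lambda>s. inner ((1 / (s - t)) *\<^sub>R (ut s - ut t)) \<phi>) \<longlongrightarrow>
        - \<nu> * inner (ut t) \<phi> - inner (E1 (u t)) (E1 \<phi>) + inner (F t) \<phi>) (at t within {0..T1})"
      if t: "t \<in> {0<..T1}" and \<phi>: "\<phi> \<in> H10 \<Omega>" for t \<phi>
    proof -
      have tJ: "t \<in> {0..T1}" using t by auto
      have "((\<lambda>s. inner ((1 / (s - t)) *\<^sub>R (ut s - ut t)) \<phi>) \<longlongrightarrow> utt t \<phi>) (at t within {0..T1})"
        by (rule Hm1_tendsto_apply[OF 5[rule_format, OF tJ] inner_Hm1 4[rule_format, OF tJ] \<phi>])
      \<comment> \<open>The test curve is constant in time.\<close>
      moreover have "utt t \<phi> = - \<nu> * inner (ut t) \<phi> - inner (E1 (u t)) (E1 \<phi>) + inner (F t) \<phi>"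
        using 7[rule_format, of "\<lambda>t. \<phi>" t] \<phi> t by (simp add: inner_E1 continuous_on_const)
      ultimately show ?thesis by simp
    qed
    moreover have "continuous_on {0..T1} (\<lambda>t. E1 (u t))" "continuous_on {0..T1} ut"
      using continuous_on_fst[OF 3] continuous_on_snd[OF 3] by (simp_all add: energy_emb_def)
    ultimately have "good u ut"
      unfolding good_def using 1 2 6 by (auto simp: energy_space_def)
    then show ?thesis by blast
  qed
  obtain ut where ut: "good u ut" using ex[OF u] by blast
  obtain wt where wt: "good w wt" using ex[OF w] by blast
  have H: "u t \<in> H10 \<Omega>" "w t \<in> H10 \<Omega>" if "t \<in> {0..T1}" for t
    using ut wt that by (auto simp: good_def)
  have "u \<tau> - w \<tau> = 0"
  proof (rule weak_solution_zero[where z="\<lambda>t. u t - w t" and zt="\<lambda>t. ut t - wt t", OF \<open>\<nu> \<ge> 0\<close>])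
    show "((\<lambda>t. u t - w t) has_vector_derivative ut t - wt t) (at t within {0..T1})"
      if "t \<in> {0..T1}" for t
      using ut wt that unfolding good_def by (intro has_vector_derivative_diff) blast+
    show "u t - w t \<in> H10 \<Omega>" if "t \<in> {0..T1}" for t
      using H[OF that] by (intro subspace_diff[OF subspace_H10])
    have "continuous_on {0..T1} (\<lambda>t. E1 (u t) - E1 (w t))"
      using ut wt unfolding good_def by (intro continuous_on_diff) blast+
    then show "continuous_on {0..T1} (\<lambda>t. E1 (u t - w t))"
      by (rule continuous_on_eq) (simp add: E1_diff H)
    show "continuous_on {0..T1} (\<lambda>t. ut t - wt t)"
      using ut wt unfolding good_def by (intro continuous_on_diff) blast+
    show "u 0 - w 0 = 0" "ut 0 - wt 0 = 0" using ut wt by (auto simp: good_def)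
    fix t \<phi> assume t: "t \<in> {0<..T1}" and \<phi>: "\<phi> \<in> H10 \<Omega>"
    have "((\<lambda>s. inner ((1 / (s - t)) *\<^sub>R (ut s - ut t)) \<phi> - inner ((1 / (s - t)) *\<^sub>R (wt s - wt t)) \<phi>) \<longlongrightarrow>
        (- \<nu> * inner (ut t) \<phi> - inner (E1 (u t)) (E1 \<phi>) + inner (F t) \<phi>)
        - (- \<nu> * inner (wt t) \<phi> - inner (E1 (w t)) (E1 \<phi>) + inner (F t) \<phi>)) (at t within {0..T1})"
      using ut wt t \<phi> unfolding good_def by (intro tendsto_diff) blast+
    moreover have "inner ((1 / (s - t)) *\<^sub>R (ut s - ut t)) \<phi> - inner ((1 / (s - t)) *\<^sub>R (wt s - wt t)) \<phi>
        = inner ((1 / (s - t)) *\<^sub>R (ut s - wt s - (ut t - wt t))) \<phi>" for s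
      by (simp add: inner_diff_left right_diff_distrib)
    moreover have "(- \<nu> * inner (ut t) \<phi> - inner (E1 (u t)) (E1 \<phi>) + inner (F t) \<phi>)
        - (- \<nu> * inner (wt t) \<phi> - inner (E1 (w t)) (E1 \<phi>) + inner (F t) \<phi>)
        = - \<nu> * inner (ut t - wt t) \<phi> - inner (E1 (u t - w t)) (E1 \<phi>)"
      using H[of t] t by (simp add: inner_diff_left E1_diff right_diff_distrib)
    ultimately show "((\<lambda>s. inner ((1 / (s - t)) *\<^sub>R (ut s - wt s - (ut t - wt t))) \<phi>) \<longlongrightarrow>
        - \<nu> * inner (ut t - wt t) \<phi> - inner (E1 (u t - w t)) (E1 \<phi>)) (at t within {0..T1})"
      by simp
  qed (rule \<tau>)
  then show ?thesis by simp
qed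

end

section \<open>The wave semigroup\<close>

locale wave_semigroup = energy \<Omega> \<kappa> for \<Omega> :: "(real^'n::finite) set" and \<kappa> :: real +
  fixes \<nu> :: real and T :: "real \<Rightarrow> (real^'n) l2 \<times> (real^'n) l2 \<Rightarrow> (real^'n) l2 \<times> (real^'n) l2"
  assumes semigroup: "contraction_semigroup \<kappa> \<Omega> T"
    and generator: "has_generator \<kappa> \<Omega> T (wave_domain \<Omega>) (wave_operator \<kappa> \<nu> \<Omega>)"
    and nu_pos: "\<nu> > 0"
begin

lemma T_in: "0 \<le> t \<Longrightarrow> x \<in> X \<Longrightarrow> T t x \<in> X"
  using semigroup by (simp add: contraction_semigroup_def)

text \<open>The semigroup conjugated by the energy embedding; \<open>inv_into\<close> is a true
  inverse on the image because the embedding is injective.\<close>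

definition P where "P t y = E (T t (inv_into X E y))"

lemma P_E: "x \<in> X \<Longrightarrow> P t (E x) = E (T t x)"
  by (simp add: P_def inv_into_f_f[OF inj_on_E])

sublocale S: subspace_semigroup "E ` X" P
proof
  show "closed (E ` X)" by (rule closed_E)
  show "subspace (E ` X)" by (rule subspace_E)
  show "P t y \<in> E ` X" if "0 \<le> t" "y \<in> E ` X" for t y
    using that by (auto simp: P_E T_in)
  show "P t (a *\<^sub>R x + b *\<^sub>R y) = a *\<^sub>R P t x + b *\<^sub>R P t y"
    if t: "0 \<le> t" and xy: "x \<in> E ` X" "y \<in> E ` X" for t x y a b
  proof -
    obtain x' y' where x': "x' \<in> X" "x = E x'" and y': "y' \<in> X" "y = E y'" using xy by blast
    have "T t (a *\<^sub>R x' + b *\<^sub>R y') = a *\<^sub>R T t x' + b *\<^sub>R T t y'"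
      using semigroup t x' y' unfolding contraction_semigroup_def by blast
    moreover have "a *\<^sub>R x' + b *\<^sub>R y' \<in> X"
      using x' y' by (intro subspace_add[OF subspace_X] subspace_scale[OF subspace_X])
    ultimately show ?thesis
      using x' y' t by (simp add: E_linear[symmetric] P_E T_in)
  qed
  show "P 0 y = y" if "y \<in> E ` X" for y
    using that semigroup by (auto simp: P_E contraction_semigroup_def)
  show "P (s + t) y = P s (P t y)" if "0 \<le> s" "0 \<le> t" "y \<in> E ` X" for s t y
    using that semigroup by (auto simp: P_E T_in contraction_semigroup_def)
  show "norm (P t y) \<le> norm y" if "0 \<le> t" "y \<in> E ` X" for t y
    using that semigroup by (auto simp: P_E contraction_semigroup_def)
  show "continuous_on {0..} (\<lambda>t. P t y)" if "y \<in> E ` X" for y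
    using that semigroup by (auto simp: P_E contraction_semigroup_def)
qed

text \<open>\<open>has_generator\<close> is an equivalence, so mere convergence of the difference
  quotients puts \<open>y\<close> into the domain. This is the source of the H2 regularity that
  integration by parts needs.\<close>

lemma orbit_integral_wave_domain:
  assumes x: "x \<in> X" and h: "0 \<le> h" and y: "y \<in> X" "E y = S.orbit_integral h (E x)"
  shows "y \<in> wave_domain \<Omega>" "T h x - x = wave_operator \<kappa> \<nu> \<Omega> y"
proof -
  have Tx: "T h x - x \<in> X" using T_in[OF h x] x by (rule subspace_diff[OF subspace_X])
  have "((\<lambda>k. (1 / k) *\<^sub>R (P k (E y) - E y)) \<longlongrightarrow> P h (E x) - E x) (at_right 0)"
    unfolding y(2) using x h by (intro S.orbit_integral_generator) auto
  moreover have "eventually (\<lambda>k. (1 / k) *\<^sub>R (P k (E y) - E y) = E ((1 / k) *\<^sub>R (T k y - y))) (at_right 0)"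
    using y(1) T_in subspace_diff[OF subspace_X]
    by (intro eventually_at_rightI[of 0 1]) (auto simp: P_E E_scaleR E_diff)
  ultimately have "((\<lambda>k. E ((1 / k) *\<^sub>R (T k y - y))) \<longlongrightarrow> P h (E x) - E x) (at_right 0)"
    by (rule Lim_transform_eventually)
  moreover have "P h (E x) - E x = E (T h x - x)"
    using x h by (simp add: P_E E_diff T_in)
  ultimately have "((\<lambda>k. E ((1 / k) *\<^sub>R (T k y - y))) \<longlongrightarrow> E (T h x - x)) (at_right 0)" by simp
  then have "y \<in> wave_domain \<Omega> \<and> T h x - x = wave_operator \<kappa> \<nu> \<Omega> y"
    using generator y(1) Tx unfolding has_generator_def by blast
  then show "y \<in> wave_domain \<Omega>" "T h x - x = wave_operator \<kappa> \<nu> \<Omega> y" by auto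
qed

end

section \<open>The variation of constants formula solves the weak problem\<close>

locale wave_mild = wave_semigroup \<Omega> \<kappa> \<nu> T
  for \<Omega> :: "(real^'n::finite) set" and \<kappa> \<nu> T +
  fixes F :: "real \<Rightarrow> (real^'n) l2" and u0 v0 :: "(real^'n) l2" and T1 :: real
    and V :: "real \<Rightarrow> (real^'n) l2 \<times> (real^'n) l2"
  assumes F_in: "t \<in> {0..T1} \<Longrightarrow> F t \<in> L2_on \<Omega>" and F_continuous: "continuous_on {0..T1} F"
    and G_in: "(u0, v0) \<in> X" and T1_nonneg: "0 \<le> T1"
    and V_eq: "t \<in> {0..T1} \<Longrightarrow> V t = T t (u0, v0) + energy_integral \<kappa> \<Omega> {0..t} (\<lambda>s. T (t - s) (0, F s))"
begin

lemma force_in: "s \<in> {0..T1} \<Longrightarrow> (0, F s) \<in> X"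
  using F_in H10_zero by (simp add: energy_space_def)

lemma E_force: "E (0, F s) = (0, F s)"
  by (simp add: energy_emb_def E1_zero)

sublocale M: mild_solution "E ` X" P "\<lambda>s. E (0, F s)" "E (u0, v0)" T1
proof
  show "continuous_on {0..T1} (\<lambda>s. E (0, F s))"
    unfolding E_force by (intro continuous_intros F_continuous)
qed (use force_in G_in in auto)

lemma has_energy_integral_iff:
  assumes t: "t \<in> {0..T1}"
  shows "has_energy_integral \<kappa> \<Omega> (\<lambda>s. T (t - s) (0, F s)) y {0..t} \<longleftrightarrow> y \<in> X \<and> E y = M.duhamel 0 t"
proof -
  have "((\<lambda>s. P (t - s) (E (0, F s))) has_integral M.duhamel 0 t) {0..t}"
    using t by (intro M.duhamel_has_integral) auto
  then have "((\<lambda>s. E (T (t - s) (0, F s))) has_integral M.duhamel 0 t) {0..t}"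
    by (rule has_integral_eq[rotated]) (use t force_in in \<open>auto simp: P_E\<close>)
  then show ?thesis
    using t force_in T_in unfolding has_energy_integral_def
    by (auto intro: has_integral_unique)
qed

text \<open>Existence comes from closedness of the embedded energy space, uniqueness from
  injectivity; only then does the description \<open>energy_integral\<close> denote the
  integral.\<close>

lemma duhamel_ex1:
  assumes "t \<in> {0..T1}"
  shows "\<exists>!y. has_energy_integral \<kappa> \<Omega> (\<lambda>s. T (t - s) (0, F s)) y {0..t}"
proof -
  have "M.duhamel 0 t \<in> E ` X" using assms by (intro M.duhamel_in) auto
  then obtain y where y: "y \<in> X" "E y = M.duhamel 0 t" by force
  show ?thesis
    unfolding has_energy_integral_iff[OF assms]
  proof (rule ex1I[of _ y])
    show "z = y" if "z \<in> X \<and> E z = M.duhamel 0 t" for z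
      using that y by (intro inj_onD[OF inj_on_E]) auto
  qed (use y in simp)
qed

lemma V_in: "t \<in> {0..T1} \<Longrightarrow> V t \<in> X" and E_V: "t \<in> {0..T1} \<Longrightarrow> E (V t) = M.mild t"
proof -
  assume t: "t \<in> {0..T1}"
  let ?I = "energy_integral \<kappa> \<Omega> {0..t} (\<lambda>s. T (t - s) (0, F s))"
  have "has_energy_integral \<kappa> \<Omega> (\<lambda>s. T (t - s) (0, F s)) ?I {0..t}"
    unfolding energy_integral_def by (rule theI'[OF duhamel_ex1[OF t]])
  then have I: "?I \<in> X" "E ?I = M.duhamel 0 t" by (simp_all add: has_energy_integral_iff[OF t])
  have TG: "T t (u0, v0) \<in> X" using t by (intro T_in G_in) auto
  show "V t \<in> X" unfolding V_eq[OF t] by (rule subspace_add[OF subspace_X TG I(1)])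
  show "E (V t) = M.mild t"
    unfolding V_eq[OF t] E_add[OF TG I(1)] I(2) by (simp add: M.mild_def P_E G_in)
qed

lemma V_0: "V 0 = (u0, v0)"
  using inj_onD[OF inj_on_E _ V_in G_in, of 0] E_V[of 0] T1_nonneg by (simp add: M.mild_0)

text \<open>The candidate for the second time derivative: the right-hand side of the equation as a
  functional, the Laplacian being represented by minus the Dirichlet form, with \<kappa> absorbed
  into \<open>E1\<close>.\<close>

definition acc :: "real \<Rightarrow> (real^'n) l2 \<Rightarrow> real" where
  "acc t w = - \<nu> * inner (snd (V t)) w - inner (E1 (fst (V t))) (E1 w) + inner (F t) w"

text \<open>\<open>V t'\<close> is taken as a new initial value. After integration by parts,
  \<open>y\<close> and \<open>r\<close> enter the velocity increment only through components of
  \<open>E y\<close> and \<open>E r\<close>, so convergence in the energy norm will suffice although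
  second derivatives of \<open>fst y\<close> are uncontrolled.\<close>

lemma V_step:
  assumes t: "0 \<le> t'" "t' \<le> t" "t \<le> T1"
  obtains y r where "y \<in> X" "E y = S.orbit_integral (t - t') (E (V t'))" "r \<in> X" "E r = M.duhamel t' t"
    "fst (V t) - fst (V t') = snd y + fst r"
    "\<And>w. w \<in> H10 \<Omega> \<Longrightarrow> inner (snd (V t) - snd (V t')) w
      = - \<nu> * inner (snd y) w - inner (E1 (fst y)) (E1 w) + inner (snd r) w"
proof -
  have t': "t' \<in> {0..T1}" "t \<in> {0..T1}" "0 \<le> t - t'" using t by auto
  have "S.orbit_integral (t - t') (E (V t')) \<in> E ` X" using V_in[OF t'(1)] by (intro S.orbit_integral_in) auto
  then obtain y where y: "y \<in> X" "E y = S.orbit_integral (t - t') (E (V t'))" by auto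
  have "M.duhamel t' t \<in> E ` X" using t by (intro M.duhamel_in) auto
  then obtain r where r: "r \<in> X" "E r = M.duhamel t' t" by auto
  have TV: "T (t - t') (V t') \<in> X" by (rule T_in[OF t'(3) V_in[OF t'(1)]])
  have "E (V t) = E (T (t - t') (V t') + r)"
    using M.mild_step[OF t] t' V_in E_add[OF TV r(1)] r(2) by (simp add: E_V[symmetric] P_E)
  then have "V t = T (t - t') (V t') + r"
    using inj_onD[OF inj_on_E _ V_in[OF t'(2)] subspace_add[OF subspace_X TV r(1)]] by blast
  then have eq: "V t - V t' = wave_operator \<kappa> \<nu> \<Omega> y + r"
    using orbit_integral_wave_domain(2)[OF V_in[OF t'(1)] t'(3) y] by (simp add: algebra_simps)
  have dom: "fst y \<in> H2 \<Omega>"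
    using orbit_integral_wave_domain(1)[OF V_in[OF t'(1)] t'(3) y] by (auto simp: wave_domain_def)
  have c1: "fst (V t) - fst (V t') = snd y + fst r"
    using arg_cong[OF eq, of fst] by (simp add: wave_operator_def case_prod_beta)
  have c2: "snd (V t) - snd (V t') = \<kappa> *\<^sub>R laplacian \<Omega> (fst y) - \<nu> *\<^sub>R snd y + snd r"
    using arg_cong[OF eq, of snd] by (simp add: wave_operator_def case_prod_beta)
  have "inner (snd (V t) - snd (V t')) w
      = - \<nu> * inner (snd y) w - inner (E1 (fst y)) (E1 w) + inner (snd r) w" if "w \<in> H10 \<Omega>" for w
    unfolding c2 using inner_laplacian[OF dom that] by (simp add: inner_E1 inner_add_left inner_diff_left)
  with y r c1 show ?thesis using that by blast
qed

text \<open>The second bound is linear in \<open>norm (E1 w)\<close> with a \<open>d\<close>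
  independent of \<open>w\<close>; this uniformity is what an estimate in the dual norm
  demands.\<close>

lemma V_increment:
  assumes "e > 0"
  obtains d where "d > 0" "\<And>t' t t0. 0 \<le> t' \<Longrightarrow> t' \<le> t0 \<Longrightarrow> t0 \<le> t \<Longrightarrow> t \<le> T1 \<Longrightarrow> t - t' < d \<Longrightarrow>
      norm (fst (V t) - fst (V t') - (t - t') *\<^sub>R snd (V t0)) \<le> e * (t - t')"
    "\<And>t' t t0 w. 0 \<le> t' \<Longrightarrow> t' \<le> t0 \<Longrightarrow> t0 \<le> t \<Longrightarrow> t \<le> T1 \<Longrightarrow> t - t' < d \<Longrightarrow> w \<in> H10 \<Omega> \<Longrightarrow>
      \<bar>inner (snd (V t) - snd (V t')) w - (t - t') * acc t0 w\<bar> \<le> e * (t - t') * norm (E1 w)"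
proof -
  \<comment> \<open>\<open>C\<close> dominates both constants that arise: 1 + CP in the displacement
    estimate and 1 + (\<nu> + 1) CP in the velocity estimate, each CP stemming from the Poincare
    inequality.\<close>
  define C where "C = 1 + CP + (\<nu> + 1) * CP"
  have C: "C > 0" using CP_pos nu_pos by (simp add: C_def add_pos_pos)
  define \<epsilon> where "\<epsilon> = e / C"
  have \<epsilon>: "\<epsilon> > 0" "\<epsilon> * C = e" using assms C by (auto simp: \<epsilon>_def)
  have \<epsilon>C1: "\<epsilon> * (1 + CP) \<le> e" and \<epsilon>C2: "\<epsilon> * (1 + (\<nu> + 1) * CP) \<le> e"
    unfolding \<epsilon>(2)[symmetric] C_def using \<epsilon>(1) CP_pos nu_pos by (auto intro!: mult_left_mono)
  obtain d1 where d1: "d1 > 0" "\<And>t' t t0. 0 \<le> t' \<Longrightarrow> t' \<le> t0 \<Longrightarrow> t0 \<le> t \<Longrightarrow> t \<le> T1 \<Longrightarrow> t - t' < d1 \<Longrightarrow>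
      norm (S.orbit_integral (t - t') (M.mild t') - (t - t') *\<^sub>R M.mild t0) \<le> \<epsilon> * (t - t')"
    using M.orbit_integral_close[OF \<epsilon>(1)] by blast
  obtain d2 where d2: "d2 > 0" "\<And>t' t t0. 0 \<le> t' \<Longrightarrow> t' \<le> t0 \<Longrightarrow> t0 \<le> t \<Longrightarrow> t \<le> T1 \<Longrightarrow> t - t' < d2 \<Longrightarrow>
      norm (M.duhamel t' t - (t - t') *\<^sub>R E (0, F t0)) \<le> \<epsilon> * (t - t')"
    using M.duhamel_close[OF \<epsilon>(1)] by blast
  have main: "norm (fst (V t) - fst (V t') - (t - t') *\<^sub>R snd (V t0)) \<le> e * (t - t')
      \<and> (\<forall>w\<in>H10 \<Omega>. \<bar>inner (snd (V t) - snd (V t')) w - (t - t') * acc t0 w\<bar> \<le> e * (t - t') * norm (E1 w))"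
    if t: "0 \<le> t'" "t' \<le> t0" "t0 \<le> t" "t \<le> T1" "t - t' < min d1 d2" for t' t t0
  proof -
    define h where "h = t - t'"
    have h: "h \<ge> 0" using t by (simp add: h_def)
    obtain y r where y: "y \<in> X" "E y = S.orbit_integral (t - t') (E (V t'))"
      and r: "r \<in> X" "E r = M.duhamel t' t"
      and V1: "fst (V t) - fst (V t') = snd y + fst r"
      and V2: "\<And>w. w \<in> H10 \<Omega> \<Longrightarrow> inner (snd (V t) - snd (V t')) w
        = - \<nu> * inner (snd y) w - inner (E1 (fst y)) (E1 w) + inner (snd r) w"
      by (rule V_step[OF t(1) order_trans[OF t(2,3)] t(4)]) (rule that)
    have "norm (E y - h *\<^sub>R E (V t0)) \<le> \<epsilon> * h"
      using d1(2)[of t' t0 t] t E_V[of t'] E_V[of t0] unfolding y(2) h_def by simp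
    moreover have "E y - h *\<^sub>R E (V t0) = (E1 (fst y) - h *\<^sub>R E1 (fst (V t0)), snd y - h *\<^sub>R snd (V t0))"
      by (simp add: energy_emb_def)
    ultimately have y1: "norm (E1 (fst y) - h *\<^sub>R E1 (fst (V t0))) \<le> \<epsilon> * h"
      and y2: "norm (snd y - h *\<^sub>R snd (V t0)) \<le> \<epsilon> * h"
      using norm_fst_le[of "E1 (fst y) - h *\<^sub>R E1 (fst (V t0))" "snd y - h *\<^sub>R snd (V t0)"]
        norm_snd_le[of "snd y - h *\<^sub>R snd (V t0)" "E1 (fst y) - h *\<^sub>R E1 (fst (V t0))"] by auto
    have "norm (E r - h *\<^sub>R (0, F t0)) \<le> \<epsilon> * h"
      using d2(2)[of t' t0 t] t unfolding r(2) h_def by (simp add: E_force)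
    moreover have "E r - h *\<^sub>R (0, F t0) = (E1 (fst r), snd r - h *\<^sub>R F t0)"
      by (simp add: energy_emb_def)
    ultimately have r1: "norm (E1 (fst r)) \<le> \<epsilon> * h" and r2: "norm (snd r - h *\<^sub>R F t0) \<le> \<epsilon> * h"
      using norm_fst_le[of "E1 (fst r)" "snd r - h *\<^sub>R F t0"]
        norm_snd_le[of "snd r - h *\<^sub>R F t0" "E1 (fst r)"] by auto
    \<comment> \<open>The force acts in the second component only, so the first component of the
      remainder is pure error.\<close>
    have "norm (fst r) \<le> CP * norm (E1 (fst r))"
      using r(1) by (intro poincare) (auto simp: energy_space_def)
    also have "\<dots> \<le> CP * (\<epsilon> * h)" using r1 CP_pos by simp
    finally have "norm (snd y - h *\<^sub>R snd (V t0) + fst r) \<le> \<epsilon> * h + CP * (\<epsilon> * h)"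
      by (intro norm_triangle_mono y2)
    also have "\<dots> = \<epsilon> * (1 + CP) * h" by (simp add: algebra_simps)
    also have "\<dots> \<le> e * h" by (rule mult_right_mono[OF \<epsilon>C1 h])
    finally have "norm (fst (V t) - fst (V t') - h *\<^sub>R snd (V t0)) \<le> e * h"
      unfolding V1 by (simp add: algebra_simps)
    moreover have "\<bar>inner (snd (V t) - snd (V t')) w - h * acc t0 w\<bar> \<le> e * h * norm (E1 w)"
      if w: "w \<in> H10 \<Omega>" for w
    proof -
      have eq: "inner (snd (V t) - snd (V t')) w - h * acc t0 w
          = - \<nu> * inner (snd y - h *\<^sub>R snd (V t0)) w - inner (E1 (fst y) - h *\<^sub>R E1 (fst (V t0))) (E1 w)
            + inner (snd r - h *\<^sub>R F t0) w"
        unfolding V2[OF w] acc_def by (simp add: inner_diff_left algebra_simps)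
      have i: "\<bar>inner a b\<bar> \<le> \<epsilon> * h * norm b" if "norm a \<le> \<epsilon> * h" for a b :: "'z::real_inner"
        using Cauchy_Schwarz_ineq2[of a b] mult_right_mono[OF that norm_ge_zero[of b]] by linarith
      have pw: "\<epsilon> * h * norm w \<le> \<epsilon> * h * (CP * norm (E1 w))"
        using poincare[OF w] \<epsilon> h by (intro mult_left_mono) auto
      have "\<bar>\<nu> * inner (snd y - h *\<^sub>R snd (V t0)) w\<bar> \<le> \<nu> * (\<epsilon> * h * (CP * norm (E1 w)))"
        unfolding abs_mult using i[OF y2, of w] pw nu_pos by (auto intro: mult_left_mono)
      moreover have "\<bar>inner (snd r - h *\<^sub>R F t0) w\<bar> \<le> \<epsilon> * h * (CP * norm (E1 w))"
        using i[OF r2, of w] pw by linarith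
      moreover note i[OF y1, of "E1 w"]
      ultimately have "\<bar>inner (snd (V t) - snd (V t')) w - h * acc t0 w\<bar>
          \<le> \<nu> * (\<epsilon> * h * (CP * norm (E1 w))) + \<epsilon> * h * norm (E1 w) + \<epsilon> * h * (CP * norm (E1 w))"
        unfolding eq by linarith
      also have "\<dots> = \<epsilon> * (1 + (\<nu> + 1) * CP) * (h * norm (E1 w))" by (simp add: algebra_simps)
      also have "\<dots> \<le> e * (h * norm (E1 w))"
        using \<epsilon>C2 h by (intro mult_right_mono) auto
      finally show ?thesis by (simp add: mult.assoc)
    qed
    ultimately show ?thesis unfolding h_def by blast
  qed
  show ?thesis
    by (rule that[of "min d1 d2"]) (use d1(1) d2(1) main in auto)
qed

text \<open>Both one-sided difference quotients at \<open>t\<close> are instances of \<open>V_increment\<close>, with \<open>t\<close> the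
  left or the right end of the interval.\<close>

lemma V_quotient:
  assumes "e > 0" and t: "t \<in> {0..T1}"
  shows "eventually (\<lambda>s. norm ((1 / (s - t)) *\<^sub>R (fst (V s) - fst (V t)) - snd (V t)) \<le> e \<and>
    (\<forall>w\<in>H10 \<Omega>. \<bar>inner ((1 / (s - t)) *\<^sub>R (snd (V s) - snd (V t))) w - acc t w\<bar> \<le> e * norm (E1 w)))
    (at t within {0..T1})"
proof -
  obtain d where d: "d > 0" "\<And>t' t t0. 0 \<le> t' \<Longrightarrow> t' \<le> t0 \<Longrightarrow> t0 \<le> t \<Longrightarrow> t \<le> T1 \<Longrightarrow> t - t' < d \<Longrightarrow>
      norm (fst (V t) - fst (V t') - (t - t') *\<^sub>R snd (V t0)) \<le> e * (t - t')"
    "\<And>t' t t0 w. 0 \<le> t' \<Longrightarrow> t' \<le> t0 \<Longrightarrow> t0 \<le> t \<Longrightarrow> t \<le> T1 \<Longrightarrow> t - t' < d \<Longrightarrow> w \<in> H10 \<Omega> \<Longrightarrow>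
      \<bar>inner (snd (V t) - snd (V t')) w - (t - t') * acc t0 w\<bar> \<le> e * (t - t') * norm (E1 w)"
    using V_increment[OF \<open>e > 0\<close>] by metis
  have "norm ((1 / (s - t)) *\<^sub>R (fst (V s) - fst (V t)) - snd (V t)) \<le> e \<and>
    (\<forall>w\<in>H10 \<Omega>. \<bar>inner ((1 / (s - t)) *\<^sub>R (snd (V s) - snd (V t))) w - acc t w\<bar> \<le> e * norm (E1 w))"
    if s: "s \<in> {0..T1}" "s \<noteq> t" "dist s t < d" for s
  proof -
    have "norm (fst (V s) - fst (V t) - (s - t) *\<^sub>R snd (V t)) \<le> e * \<bar>s - t\<bar> \<and>
      (\<forall>w\<in>H10 \<Omega>. \<bar>inner (snd (V s) - snd (V t)) w - (s - t) * acc t w\<bar> \<le> e * \<bar>s - t\<bar> * norm (E1 w))"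
    proof (cases "t \<le> s")
      case True
      then show ?thesis using d(2)[of t t s] d(3)[of t t s] s t by (auto simp: dist_real_def)
    next
      case False
      have "fst (V s) - fst (V t) - (s - t) *\<^sub>R snd (V t) = - (fst (V t) - fst (V s) - (t - s) *\<^sub>R snd (V t))"
        by (simp add: algebra_simps)
      moreover have "inner (snd (V s) - snd (V t)) w - (s - t) * acc t w
          = - (inner (snd (V t) - snd (V s)) w - (t - s) * acc t w)" for w
        by (simp add: inner_diff_left algebra_simps)
      ultimately show ?thesis
        using d(2)[of s t t] d(3)[of s t t] s t False by (simp only: norm_minus_cancel abs_minus_cancel) (auto simp: dist_real_def)
    qed
    then have a: "norm (fst (V s) - fst (V t) - (s - t) *\<^sub>R snd (V t)) \<le> e * \<bar>s - t\<bar>"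
      and b: "\<And>w. w \<in> H10 \<Omega> \<Longrightarrow> \<bar>inner (snd (V s) - snd (V t)) w - (s - t) * acc t w\<bar> \<le> e * \<bar>s - t\<bar> * norm (E1 w)"
      by auto
    have pos: "\<bar>s - t\<bar> > 0" using s by simp
    have "(1 / (s - t)) *\<^sub>R (fst (V s) - fst (V t)) - snd (V t)
        = (1 / (s - t)) *\<^sub>R (fst (V s) - fst (V t) - (s - t) *\<^sub>R snd (V t))"
      using s by (simp add: scaleR_diff_right)
    then have "norm ((1 / (s - t)) *\<^sub>R (fst (V s) - fst (V t)) - snd (V t)) \<le> e"
      using a pos by (simp add: pos_divide_le_eq)
    moreover have "\<bar>inner ((1 / (s - t)) *\<^sub>R (snd (V s) - snd (V t))) w - acc t w\<bar> \<le> e * norm (E1 w)"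
      if "w \<in> H10 \<Omega>" for w
    proof -
      have "inner ((1 / (s - t)) *\<^sub>R (snd (V s) - snd (V t))) w - acc t w
          = (inner (snd (V s) - snd (V t)) w - (s - t) * acc t w) / (s - t)"
        using s by (simp add: diff_divide_distrib)
      then show ?thesis using b[OF that] pos by (simp add: abs_divide pos_divide_le_eq mult_ac)
    qed
    ultimately show ?thesis by blast
  qed
  then show ?thesis unfolding eventually_at using d(1) by blast
qed

lemma V_has_vector_derivative:
  assumes t: "t \<in> {0..T1}"
  shows "((\<lambda>s. fst (V s)) has_vector_derivative snd (V t)) (at t within {0..T1})"
  unfolding has_vector_derivative_iff_quotient
proof (rule tendstoI)
  fix e :: real assume "e > 0"
  then have "e / 2 > 0" by simp
  from V_quotient[OF this t]
  show "eventually (\<lambda>s. dist ((1 / (s - t)) *\<^sub>R (fst (V s) - fst (V t))) (snd (V t)) < e) (at t within {0..T1})"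
    by eventually_elim (use \<open>e > 0\<close> in \<open>auto simp: dist_norm\<close>)
qed

lemma acc_Hm1: "acc t \<in> Hm1 \<kappa> \<Omega>"
proof -
  have "(\<lambda>w. - \<nu> * inner (snd (V t)) w - inner (E1 (fst (V t))) (E1 w) + inner (F t) w) \<in> Hm1 \<kappa> \<Omega>"
    by (intro Hm1_add Hm1_diff Hm1_cmult inner_Hm1 inner_E1_Hm1)
  then show ?thesis by (simp add: acc_def[abs_def])
qed

lemma V_Hm1_derivative:
  assumes t: "t \<in> {0..T1}"
  shows "((\<lambda>s. Hm1_norm \<kappa> \<Omega> (\<lambda>w. inner ((1 / (s - t)) *\<^sub>R (snd (V s) - snd (V t))) w - acc t w)) \<longlongrightarrow> 0)
    (at t within {0..T1})"
proof (rule tendstoI)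
  fix e :: real assume e: "e > 0"
  then have e2: "e / 2 > 0" by simp
  from V_quotient[OF this t]
  show "eventually (\<lambda>s. dist (Hm1_norm \<kappa> \<Omega> (\<lambda>w. inner ((1 / (s - t)) *\<^sub>R (snd (V s) - snd (V t))) w - acc t w)) 0 < e)
      (at t within {0..T1})"
  proof eventually_elim
    case (elim s)
    let ?l = "\<lambda>w. inner ((1 / (s - t)) *\<^sub>R (snd (V s) - snd (V t))) w - acc t w"
    have "Hm1_norm \<kappa> \<Omega> ?l \<le> e / 2" using elim e2 by (intro Hm1_norm_le) auto
    moreover have "0 \<le> Hm1_norm \<kappa> \<Omega> ?l" by (intro Hm1_norm_nonneg Hm1_diff inner_Hm1 acc_Hm1)
    ultimately show ?case using e by simp
  qed
qed

lemma EV_continuous: "continuous_on {0..T1} (\<lambda>t. E (V t))"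
  by (rule continuous_on_eq[OF M.mild_continuous]) (simp add: E_V)

text \<open>\<open>acc\<close> depends linearly on the velocity, the embedded displacement and the
  force, all continuous in time; the coefficient of \<open>norm (E1 w)\<close> in the estimate is a
  bound for the dual norm.\<close>

lemma acc_Hm1_continuous:
  assumes t: "t \<in> {0..T1}"
  shows "((\<lambda>s. Hm1_norm \<kappa> \<Omega> (\<lambda>w. acc s w - acc t w)) \<longlongrightarrow> 0) (at t within {0..T1})"
proof -
  let ?b = "\<lambda>s. (\<nu> * norm (snd (V s) - snd (V t)) + norm (F s - F t)) * CP
    + norm (E1 (fst (V s)) - E1 (fst (V t)))"
  have c: "((\<lambda>s. E1 (fst (V s))) \<longlongrightarrow> E1 (fst (V t))) (at t within {0..T1})"
      "((\<lambda>s. snd (V s)) \<longlongrightarrow> snd (V t)) (at t within {0..T1})" "(F \<longlongrightarrow> F t) (at t within {0..T1})"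
    using continuous_on_fst[OF EV_continuous] continuous_on_snd[OF EV_continuous] F_continuous t
    by (auto simp: energy_emb_def continuous_on_def)
  have "(?b \<longlongrightarrow> (\<nu> * norm (snd (V t) - snd (V t)) + norm (F t - F t)) * CP
      + norm (E1 (fst (V t)) - E1 (fst (V t)))) (at t within {0..T1})"
    by (intro tendsto_intros c)
  then have lim: "(?b \<longlongrightarrow> 0) (at t within {0..T1})" by simp
  have "norm (Hm1_norm \<kappa> \<Omega> (\<lambda>w. acc s w - acc t w)) \<le> ?b s" for s
  proof -
    have "Hm1_norm \<kappa> \<Omega> (\<lambda>w. acc s w - acc t w) \<le> ?b s"
    proof (rule Hm1_norm_le)
      fix w assume w: "w \<in> H10 \<Omega>"
      have i: "\<bar>inner a w\<bar> \<le> norm a * (CP * norm (E1 w))" for a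
        using Cauchy_Schwarz_ineq2[of a w] mult_left_mono[OF poincare[OF w] norm_ge_zero[of a]] by linarith
      have eq: "acc s w - acc t w = - \<nu> * inner (snd (V s) - snd (V t)) w
          - inner (E1 (fst (V s)) - E1 (fst (V t))) (E1 w) + inner (F s - F t) w"
        by (simp add: acc_def inner_diff_left algebra_simps)
      have "\<bar>\<nu> * inner (snd (V s) - snd (V t)) w\<bar> \<le> \<nu> * (norm (snd (V s) - snd (V t)) * (CP * norm (E1 w)))"
        unfolding abs_mult using i nu_pos by (auto intro: mult_left_mono)
      then have "\<bar>acc s w - acc t w\<bar> \<le> \<nu> * (norm (snd (V s) - snd (V t)) * (CP * norm (E1 w)))
          + norm (E1 (fst (V s)) - E1 (fst (V t))) * norm (E1 w) + norm (F s - F t) * (CP * norm (E1 w))"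
        unfolding eq using i[of "F s - F t"]
          Cauchy_Schwarz_ineq2[of "E1 (fst (V s)) - E1 (fst (V t))" "E1 w"] by linarith
      also have "\<dots> = ?b s * norm (E1 w)" by (simp add: algebra_simps)
      finally show "\<bar>acc s w - acc t w\<bar> \<le> ?b s * norm (E1 w)" .
    qed (use nu_pos CP_pos in simp)
    then show ?thesis using Hm1_norm_nonneg[OF Hm1_diff[OF acc_Hm1 acc_Hm1], of s t] by simp
  qed
  from Lim_null_comparison[OF always_eventually[OF allI[OF this]] lim] show ?thesis .
qed

lemma weak_solution_V: "weak_solution \<kappa> \<nu> \<Omega> T1 F u0 v0 (\<lambda>t. fst (V t))"
  unfolding weak_solution_def
proof (rule exI[of _ "\<lambda>t. snd (V t)"], rule exI[of _ acc], intro conjI)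
  show "\<forall>\<phi>. (\<forall>t\<in>{0..T1}. \<phi> t \<in> H10 \<Omega>) \<and> continuous_on {0..T1} (\<lambda>t. E1 (\<phi> t)) \<longrightarrow>
      (\<forall>t\<in>{0<..T1}. acc t (\<phi> t) = - \<nu> * inner (snd (V t)) (\<phi> t)
        - \<kappa> * inner (grad \<Omega> (fst (V t))) (grad \<Omega> (\<phi> t)) + inner (F t) (\<phi> t))"
    by (simp add: acc_def inner_E1)
qed (use V_has_vector_derivative V_in EV_continuous acc_Hm1 V_Hm1_derivative acc_Hm1_continuous V_0 in auto)

end

text \<open>The first conjunct certifies that the integral in the formula for \<open>V\<close>
  exists and is unique, since \<open>energy_integral\<close> is only a description. The third is
  separate because \<open>weak_solution\<close> hides the velocity behind an existential quantifier;
  it identifies the second component of \<open>V\<close> as the derivative of the first.\<close>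

theorem theorem3p1:
  fixes \<Omega> :: "(real^'n::finite) set" and \<nu> \<kappa> T\<^sub>1 :: real
    and T :: "real \<Rightarrow> (real^'n) l2 \<times> (real^'n) l2 \<Rightarrow> (real^'n) l2 \<times> (real^'n) l2"
    and F :: "real \<Rightarrow> (real^'n) l2" and u\<^sub>0 v\<^sub>0 :: "(real^'n) l2"
    and V :: "real \<Rightarrow> (real^'n) l2 \<times> (real^'n) l2"
  assumes "open \<Omega>" and "connected \<Omega>" and "\<Omega> \<noteq> {}" and "bounded \<Omega>"
    and "convex \<Omega> \<or> C2_domain \<Omega>"
    and "\<nu> > 0" and "\<kappa> > 0" and "T\<^sub>1 > 0"
    and "contraction_semigroup \<kappa> \<Omega> T"
    and "has_generator \<kappa> \<Omega> T (wave_domain \<Omega>) (wave_operator \<kappa> \<nu> \<Omega>)"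
    and "\<And>t. t \<in> {0..T\<^sub>1} \<Longrightarrow> F t \<in> L2_on \<Omega>" and "continuous_on {0..T\<^sub>1} F"
    and "(u\<^sub>0, v\<^sub>0) \<in> energy_space \<Omega>"
    and "\<And>t. t \<in> {0..T\<^sub>1} \<Longrightarrow>
      V t = T t (u\<^sub>0, v\<^sub>0) + energy_integral \<kappa> \<Omega> {0..t} (\<lambda>s. T (t - s) (0, F s))"
  shows "(\<forall>t\<in>{0..T\<^sub>1}. \<exists>!y. has_energy_integral \<kappa> \<Omega> (\<lambda>s. T (t - s) (0, F s)) y {0..t})
    \<and> weak_solution \<kappa> \<nu> \<Omega> T\<^sub>1 F u\<^sub>0 v\<^sub>0 (\<lambda>t. fst (V t))
    \<and> (\<forall>t\<in>{0..T\<^sub>1}. ((\<lambda>s. fst (V s)) has_vector_derivative snd (V t)) (at t within {0..T\<^sub>1}))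
    \<and> (\<forall>w. weak_solution \<kappa> \<nu> \<Omega> T\<^sub>1 F u\<^sub>0 v\<^sub>0 w \<longrightarrow> (\<forall>t\<in>{0..T\<^sub>1}. w t = fst (V t)))"
proof -
  interpret wave_mild \<Omega> \<kappa> \<nu> T F u\<^sub>0 v\<^sub>0 T\<^sub>1 V
    by unfold_locales (use assms in auto)
  show ?thesis
    using duhamel_ex1 weak_solution_V V_has_vector_derivative weak_solution_unique[OF less_imp_le[OF nu_pos]]
    by blast
qed

end
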